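(* Let $X=X^+\oplus X^0\oplus X^1$ with $\widetilde X=X^0\oplus X^1$ be as in the context, and let $J,J_{cp}\in C^1(X,\mathbb{R})$ be of the form $$J(u)=\tfrac12\|u^+\|^2-I(u),\qquad J_{cp}(u)=\tfrac12\|u^++u^0\|^2-I_{cp}(u).$$ Let $J$ be coercive on $\mathcal{N}$ and $J_{cp}$ be coercive on $\mathcal{N}_{cp}$. Suppose that $J$ and $J_{cp}$ satisfy (A1)–(A4), (B1)–(B3) (for $J_{cp}$: with $X^+\oplus X^0$, $X^1$, $I_{cp}$, $\mathcal{N}_{cp}$ in place of $X^+$, $\widetilde X$, $I$, $\mathcal{N}$), and set $c=\inf_{\mathcal{N}}J$ and $d=\inf_{\mathcal{N}_{cp}}J_{cp}$. Then the following statements hold. a) If (C1)–(C2) hold and $\beta<d$, then any $(PS)_\beta$-sequence of $J$ contained in $\mathcal{N}$ contains a weakly convergent subsequence with a nontrivial limit point. b) If (C1)–(C3) hold and $c<d$, then $c$ is achieved by a critical point (ground state) of $J$. c) Suppose that $J$ is even and satisfies the $(PS)_\beta^{\mathcal{T}}$-condition in $\mathcal{N}$ for any $\beta<\beta_0$, for some fixed $\beta_0\in(c,+\infty]$. Let $$m(\mathcal{N},\beta_0)=\sup\{\gamma(J^{-1}((0,\beta])\cap\mathcal{N}):\beta<\beta_0\},$$ where $\gamma$ stands for the Krasnoselskii genus for closed and symmetric subsets of $X$. Then $J$ has at least $m(\mathcal{N},\beta_0)$ pairs of critical points $u$ and $-u$ such that $u\ne0$ and $c\le J(u)<\beta_0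$.
   Context: $X$ is a reflexive Banach space with norm $\|\cdot\|$ and topological direct sum decomposition $X=X^+\oplus\widetilde X$, where $X^+$ is a Hilbert space; write $u=u^++\widetilde u$ with $u^+\in X^+$, $\widetilde u\in\widetilde X$; $\langle u,u\rangle=\|u\|^2$ for $u\in X^+$ and $\|u\|^2=\|u^+\|^2+\|\widetilde u\|^2$. Moreover $\widetilde X=X^0\oplus X^1$ with $X^0,X^1$ closed in $\widetilde X$ and $X^0$ a Hilbert space; $\widetilde u=u^0+u^1$ accordingly, $X^+$ and $X^0$ are orthogonal and $\langle u,u\rangle=\|u\|^2=\|u^+\|^2+\|u^0\|^2$ for $u\in X^+\oplus X^0$. The topology $\mathcal{T}$ on $X$ is the product of the norm topology on $X^+$ and the weak topology on $\widetilde X$; $u_n\xrightarrow{\mathcal{T}}u$ means $u_n^+\to u^+$ and $\widetilde u_n\rightharpoonup\widetilde u$. (For $J_{cp}$ the corresponding topology uses $X^+\oplus X^0$ and $X^1$.) $\mathcal{N}=\{u\in X\setminus\widetilde X:J'(u)|_{\mathbb{R}u\oplus\widetilde X}=0\}$ and $\mathcal{N}_{cp}=\{u\in X\setminus X^1:J_{cp}'(u)|_{\mathbb{R}u\oplus X^1}=0\}$. $J$ is coercive on $\mathcal{N}$ if $J(u)\to\infty$ as $u\in\mathcal{N}$, $\|u\|\to\infty$ (likewise for $J_{cp}$ on $\mathcal{N}_{cp}$). A $(PS)_\beta$-sequence for $J$ in $\mathcal{N}$ is $(u_n)\subset\mathcal{N}$ with $J'(u_n)\to0$ in $X^*$ and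 $J(u_n)\to\beta$; the $(PS)^{\mathcal{T}}_\beta$-condition in $\mathcal{N}$ says every such sequence has a $\mathcal{T}$-convergent subsequence (limit in $X$). Conditions: (A1) $I\in C^1(X,\mathbb{R})$ and $I(u)\ge I(0)=0$ for all $u\in X$. (A2) If $u_n\xrightarrow{\mathcal{T}}u$ then $\liminf I(u_n)\ge I(u)$. (A3) If $u_n\xrightarrow{\mathcal{T}}u$ and $I(u_n)\to I(u)$ then $u_n\to u$. (A4) There is $r>0$ with $\inf_{u\in X^+,\|u\|=r}J(u)>0$. (B1) $\|u^+\|+I(u)\to\infty$ as $\|u\|\to\infty$. (B2) $I(t_nu_n)/t_n^2\to\infty$ if $t_n\to\infty$ and $u_n^+\to u^+$ for some $u^+\ne0$. (B3) $\frac{t^2-1}{2}I'(u)(u)+tI'(u)(v)+I(u)-I(tu+v)<0$ for every $u\in\mathcal{N}$, $t\ge0$, $v\in\widetilde X$ with $u\ne tu+v$. (C1) $J_{cp}(u_n)-J(u_n)\to0$ if $(u_n)\subset\mathcal{N}_{cp}$ is bounded and $u_n^++u_n^0\rightharpoonup0$; moreover there is $M>0$ with $J_{cp}(u)-J(u)\le M\|u^++u^0\|^2$ for $u\in\mathcal{N}_{cp}$. (C2) $I(t_nu_n)/t_n^2\to\infty$ if $t_n\to\infty$ and $(I(tu_n^+))_n$ is bounded away from $0$ for any $t>1$. (C3) If $(u_n)\subset\mathcal{N}$ and $u_n\rightharpoonup u$, then $J'(u_n)\overset{*}{\rightharpoonup}J'(u)$ in $X^*$; moreover if $(u_n)\subset\mathcal{N}$,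 $u_n\rightharpoonup u$ and $u\in\mathcal{N}$, then $\liminf_{n\to\infty}J(u_n)\ge J(u)$. *)

theory Defs
  imports "HOL-Analysis.Analysis"
begin

section \<open>Reflexivity, weak convergence, derivatives\<close>

definition reflexive_space :: "'a::real_normed_vector itself \<Rightarrow> bool" where
  "reflexive_space _ \<longleftrightarrow>
    (\<forall>\<phi> :: ('a \<Rightarrow>\<^sub>L real) \<Rightarrow>\<^sub>L real. \<exists>x::'a. \<forall>f. blinfun_apply \<phi> f = blinfun_apply f x)"

definition weakly_converges :: "(nat \<Rightarrow> 'a::real_normed_vector) \<Rightarrow> 'a \<Rightarrow> bool" where
  "weakly_converges u l \<longleftrightarrow>
    (\<forall>f :: 'a \<Rightarrow>\<^sub>L real. (\<lambda>n. blinfun_apply f (u n)) \<longlonglongrightarrow> blinfun_apply f l)"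

definition weakly_star_converges ::
    "(nat \<Rightarrow> ('a::real_normed_vector \<Rightarrow>\<^sub>L real)) \<Rightarrow> ('a \<Rightarrow>\<^sub>L real) \<Rightarrow> bool" where
  "weakly_star_converges F G \<longleftrightarrow> (\<forall>v. (\<lambda>n. blinfun_apply (F n) v) \<longlonglongrightarrow> blinfun_apply G v)"

text \<open>The Frechet derivative as an element of the dual space; only meaningful where the
  functional is differentiable.\<close>

definition dual_deriv :: "('a::real_normed_vector \<Rightarrow> real) \<Rightarrow> 'a \<Rightarrow> ('a \<Rightarrow>\<^sub>L real)" where
  "dual_deriv J u = Blinfun (frechet_derivative J (at u))"

definition C1_functional :: "('a::real_normed_vector \<Rightarrow> real) \<Rightarrow> bool" where
  "C1_functional J \<longleftrightarrow> (\<forall>u. J differentiable (at u)) \<and> continuous_on UNIV (dual_deriv J)"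

section \<open>The decomposition of the space\<close>

definition sum_space :: "'a::real_vector set \<Rightarrow> 'a set \<Rightarrow> 'a set" where
  "sum_space V W = {v + w | v w. v \<in> V \<and> w \<in> W}"

definition direct_sum :: "'a::real_vector set \<Rightarrow> 'a set \<Rightarrow> 'a set \<Rightarrow> bool" where
  "direct_sum U V W \<longleftrightarrow> subspace V \<and> subspace W \<and> V \<inter> W = {0} \<and> U = sum_space V W"

text \<open>The component in \<open>V\<close> of a vector with respect to a decomposition of the whole space
  into the direct sum of \<open>V\<close> and \<open>W\<close>.\<close>

definition component :: "'a::real_vector set \<Rightarrow> 'a set \<Rightarrow> 'a \<Rightarrow> 'a" where
  "component V W u = (THE v. v \<in> V \<and> u - v \<in> W)"

definition topological_direct_sum :: "'a::real_normed_vector set \<Rightarrow> 'a set \<Rightarrow> bool" where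
  "topological_direct_sum V W \<longleftrightarrow>
    direct_sum UNIV V W \<and> continuous_on UNIV (component V W) \<and> continuous_on UNIV (component W V)"

definition inner_product_on :: "'a::real_normed_vector set \<Rightarrow> ('a \<Rightarrow> 'a \<Rightarrow> real) \<Rightarrow> bool" where
  "inner_product_on H ip \<longleftrightarrow>
    (\<forall>x\<in>H. \<forall>y\<in>H. ip x y = ip y x) \<and>
    (\<forall>x\<in>H. \<forall>y\<in>H. \<forall>z\<in>H. ip (x + y) z = ip x z + ip y z) \<and>
    (\<forall>a. \<forall>x\<in>H. \<forall>y\<in>H. ip (a *\<^sub>R x) y = a * ip x y) \<and>
    (\<forall>x\<in>H. ip x x = (norm x)\<^sup>2)"

text \<open>\<open>Xp\<close>, \<open>Xt\<close>, \<open>X0\<close>, \<open>X1\<close> are \<open>X\<^sup>+\<close>, \<open>X\<close> tilde, \<open>X\<^sup>0\<close>, \<open>X\<^sup>1\<close>.  One inner product \<open>ip\<close>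
  on \<open>X\<^sup>+ \<oplus> X\<^sup>0\<close> restricts to the inner products of \<open>X\<^sup>+\<close> and \<open>X\<^sup>0\<close>.  These are complete since
  they are closed in a Banach space, and orthogonality makes the squared norm additive
  on \<open>X\<^sup>+ \<oplus> X\<^sup>0\<close>.\<close>

definition space_decomposition ::
    "'a::banach set \<Rightarrow> 'a set \<Rightarrow> 'a set \<Rightarrow> 'a set \<Rightarrow> ('a \<Rightarrow> 'a \<Rightarrow> real) \<Rightarrow> bool" where
  "space_decomposition Xp Xt X0 X1 ip \<longleftrightarrow>
    topological_direct_sum Xp Xt \<and> closed Xp \<and> closed Xt \<and>
    (\<forall>u. (norm u)\<^sup>2 = (norm (component Xp Xt u))\<^sup>2 + (norm (component Xt Xp u))\<^sup>2) \<and>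
    direct_sum Xt X0 X1 \<and> closed X0 \<and> closed X1 \<and>
    inner_product_on (sum_space Xp X0) ip \<and> (\<forall>x\<in>Xp. \<forall>y\<in>X0. ip x y = 0)"

section \<open>The hypotheses on a single functional\<close>

text \<open>Everything in this section refers to a decomposition of the space as \<open>V \<oplus> W\<close>, with the
  leading quadratic part living on \<open>V\<close>.  It is used with \<open>V = X\<^sup>+\<close>, \<open>W = X\<^sup>0 \<oplus> X\<^sup>1\<close> for \<open>J\<close>, and
  with \<open>V = X\<^sup>+ \<oplus> X\<^sup>0\<close>, \<open>W = X\<^sup>1\<close> for \<open>J\<^sub>c\<^sub>p\<close>.\<close>

definition has_form ::
    "('a::real_normed_vector \<Rightarrow> real) \<Rightarrow> ('a \<Rightarrow> real) \<Rightarrow> 'a set \<Rightarrow> 'a set \<Rightarrow> bool" where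
  "has_form J I V W \<longleftrightarrow> (\<forall>u. J u = 1/2 * (norm (component V W u))\<^sup>2 - I u)"

text \<open>The \<open>W\<close>-components are tested against the dual of the whole space; as \<open>W\<close> is
  complemented, this is weak convergence in \<open>W\<close>.\<close>

definition T_converges ::
    "'a::real_normed_vector set \<Rightarrow> 'a set \<Rightarrow> (nat \<Rightarrow> 'a) \<Rightarrow> 'a \<Rightarrow> bool" where
  "T_converges V W u l \<longleftrightarrow>
    (\<lambda>n. component V W (u n)) \<longlonglongrightarrow> component V W l \<and>
    weakly_converges (\<lambda>n. component W V (u n)) (component W V l)"

definition nehari :: "('a::real_normed_vector \<Rightarrow> real) \<Rightarrow> 'a set \<Rightarrow> 'a set" where
  "nehari J W =
    {u. u \<notin> W \<and> (\<forall>z \<in> sum_space (span {u}) W. blinfun_apply (dual_deriv J u) z = 0)}"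

text \<open>Extended-real valued, so that the infimum over the empty set is \<open>\<infinity>\<close>.\<close>

definition nehari_level :: "('a::real_normed_vector \<Rightarrow> real) \<Rightarrow> 'a set \<Rightarrow> ereal" where
  "nehari_level J W = (INF u \<in> nehari J W. ereal (J u))"

definition coercive_on :: "'a::real_normed_vector set \<Rightarrow> ('a \<Rightarrow> real) \<Rightarrow> bool" where
  "coercive_on N J \<longleftrightarrow> filterlim J at_top (inf at_infinity (principal N))"

definition nonneg_C1 :: "('a::real_normed_vector \<Rightarrow> real) \<Rightarrow> bool" where
  "nonneg_C1 I \<longleftrightarrow> C1_functional I \<and> I 0 = 0 \<and> (\<forall>u. I u \<ge> I 0)"

definition T_lower_semicontinuous ::
    "('a::real_normed_vector \<Rightarrow> real) \<Rightarrow> 'a set \<Rightarrow> 'a set \<Rightarrow> bool" where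
  "T_lower_semicontinuous I V W \<longleftrightarrow>
    (\<forall>u l. T_converges V W u l \<longrightarrow> liminf (\<lambda>n. ereal (I (u n))) \<ge> ereal (I l))"

definition T_to_norm ::
    "('a::real_normed_vector \<Rightarrow> real) \<Rightarrow> 'a set \<Rightarrow> 'a set \<Rightarrow> bool" where
  "T_to_norm I V W \<longleftrightarrow>
    (\<forall>u l. T_converges V W u l \<and> (\<lambda>n. I (u n)) \<longlonglongrightarrow> I l \<longrightarrow> u \<longlonglongrightarrow> l)"

definition positive_on_sphere :: "('a::real_normed_vector \<Rightarrow> real) \<Rightarrow> 'a set \<Rightarrow> bool" where
  "positive_on_sphere J V \<longleftrightarrow>
    (\<exists>r>0. (INF u \<in> {u \<in> V. norm u = r}. ereal (J u)) > 0)"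

definition sum_coercive ::
    "('a::real_normed_vector \<Rightarrow> real) \<Rightarrow> 'a set \<Rightarrow> 'a set \<Rightarrow> bool" where
  "sum_coercive I V W \<longleftrightarrow> filterlim (\<lambda>u. norm (component V W u) + I u) at_top at_infinity"

definition superquadratic ::
    "('a::real_normed_vector \<Rightarrow> real) \<Rightarrow> 'a set \<Rightarrow> 'a set \<Rightarrow> bool" where
  "superquadratic I V W \<longleftrightarrow>
    (\<forall>(t :: nat \<Rightarrow> real) u l.
      filterlim t at_top sequentially \<and> l \<in> V \<and> l \<noteq> 0 \<and> (\<lambda>n. component V W (u n)) \<longlonglongrightarrow> l \<longrightarrow>
      filterlim (\<lambda>n. I (t n *\<^sub>R u n) / (t n)\<^sup>2) at_top sequentially)"

definition fibre_inequality ::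
    "('a::real_normed_vector \<Rightarrow> real) \<Rightarrow> ('a \<Rightarrow> real) \<Rightarrow> 'a set \<Rightarrow> bool" where
  "fibre_inequality J I W \<longleftrightarrow>
    (\<forall>u \<in> nehari J W. \<forall>t\<ge>0. \<forall>v\<in>W. u \<noteq> t *\<^sub>R u + v \<longrightarrow>
      (t\<^sup>2 - 1) / 2 * blinfun_apply (dual_deriv I u) u + t * blinfun_apply (dual_deriv I u) v
        + I u - I (t *\<^sub>R u + v) < 0)"

definition generalized_nehari_setting ::
    "('a::real_normed_vector \<Rightarrow> real) \<Rightarrow> ('a \<Rightarrow> real) \<Rightarrow> 'a set \<Rightarrow> 'a set \<Rightarrow> bool" where
  "generalized_nehari_setting J I V W \<longleftrightarrow>
    nonneg_C1 I \<and> T_lower_semicontinuous I V W \<and> T_to_norm I V W \<and> positive_on_sphere J V \<and>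
    sum_coercive I V W \<and> superquadratic I V W \<and> fibre_inequality J I W"

section \<open>The hypotheses relating the two functionals\<close>

text \<open>Here \<open>H = X\<^sup>+ \<oplus> X\<^sup>0\<close>, so that \<open>component H X1 u\<close> is \<open>u\<^sup>+ + u\<^sup>0\<close>.\<close>

definition compactly_close ::
    "('a::real_normed_vector \<Rightarrow> real) \<Rightarrow> ('a \<Rightarrow> real) \<Rightarrow> 'a set \<Rightarrow> 'a set \<Rightarrow> bool" where
  "compactly_close J Jcp H X1 \<longleftrightarrow>
    (\<forall>u. (\<forall>n. u n \<in> nehari Jcp X1) \<and> bounded (range u) \<and>
        weakly_converges (\<lambda>n. component H X1 (u n)) 0 \<longrightarrow>
      (\<lambda>n. Jcp (u n) - J (u n)) \<longlonglongrightarrow> 0) \<and>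
    (\<exists>M>0. \<forall>u \<in> nehari Jcp X1. Jcp u - J u \<le> M * (norm (component H X1 u))\<^sup>2)"

definition superquadratic_away_from_zero ::
    "('a::real_normed_vector \<Rightarrow> real) \<Rightarrow> 'a set \<Rightarrow> 'a set \<Rightarrow> bool" where
  "superquadratic_away_from_zero I V W \<longleftrightarrow>
    (\<forall>(t :: nat \<Rightarrow> real) u.
      filterlim t at_top sequentially \<and>
      (\<forall>s>1. \<exists>\<delta>>0. \<forall>n. \<bar>I (s *\<^sub>R component V W (u n))\<bar> \<ge> \<delta>) \<longrightarrow>
      filterlim (\<lambda>n. I (t n *\<^sub>R u n) / (t n)\<^sup>2) at_top sequentially)"

definition weakly_continuous_on_nehari ::
    "('a::real_normed_vector \<Rightarrow> real) \<Rightarrow> 'a set \<Rightarrow> bool" where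
  "weakly_continuous_on_nehari J W \<longleftrightarrow>
    (\<forall>u l. (\<forall>n. u n \<in> nehari J W) \<and> weakly_converges u l \<longrightarrow>
      weakly_star_converges (\<lambda>n. dual_deriv J (u n)) (dual_deriv J l)) \<and>
    (\<forall>u l. (\<forall>n. u n \<in> nehari J W) \<and> weakly_converges u l \<and> l \<in> nehari J W \<longrightarrow>
      liminf (\<lambda>n. ereal (J (u n))) \<ge> ereal (J l))"

section \<open>Palais-Smale sequences and genus\<close>

definition PS_sequence_in ::
    "'a::real_normed_vector set \<Rightarrow> ('a \<Rightarrow> real) \<Rightarrow> real \<Rightarrow> (nat \<Rightarrow> 'a) \<Rightarrow> bool" where
  "PS_sequence_in N J \<beta> u \<longleftrightarrow>
    (\<forall>n. u n \<in> N) \<and> (\<lambda>n. dual_deriv J (u n)) \<longlonglongrightarrow> 0 \<and> (\<lambda>n. J (u n)) \<longlonglongrightarrow> \<beta>"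

definition PS_T_condition ::
    "('a::real_normed_vector \<Rightarrow> real) \<Rightarrow> 'a set \<Rightarrow> 'a set \<Rightarrow> real \<Rightarrow> bool" where
  "PS_T_condition J V W \<beta> \<longleftrightarrow>
    (\<forall>u. PS_sequence_in (nehari J W) J \<beta> u \<longrightarrow>
      (\<exists>(r :: nat \<Rightarrow> nat) l. strict_mono r \<and> T_converges V W (u \<circ> r) l))"

text \<open>Intended for closed sets with \<open>A = - A\<close>: the least \<open>k\<close> admitting a continuous odd map
  from \<open>A\<close> to the nonzero vectors of \<open>k\<close>-dimensional real space, whose coordinates
  are \<open>f x 0, \<dots>, f x (k - 1)\<close>; it is \<open>\<infinity>\<close> if there is no such \<open>k\<close>, and \<open>0\<close> iff \<open>A\<close> is empty.\<close>

definition genus :: "'a::real_normed_vector set \<Rightarrow> enat" where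
  "genus A = Inf {enat k | k. \<exists>f :: 'a \<Rightarrow> nat \<Rightarrow> real.
      (\<forall>i<k. continuous_on A (\<lambda>x. f x i)) \<and>
      (\<forall>x\<in>A. \<forall>i<k. f (- x) i = - f x i) \<and>
      (\<forall>x\<in>A. \<exists>i<k. f x i \<noteq> 0)}"

definition genus_bound :: "('a::real_normed_vector \<Rightarrow> real) \<Rightarrow> 'a set \<Rightarrow> ereal \<Rightarrow> enat" where
  "genus_bound J N \<beta>0 = (SUP \<beta> \<in> {\<beta>::real. ereal \<beta> < \<beta>0}. genus (J -` {0<..\<beta>} \<inter> N))"

definition ecard :: "'b set \<Rightarrow> enat" where
  "ecard S = (if finite S then enat (card S) else \<infinity>)"

end

theory Submission
  imports Defs "HOL-Library.Diagonal_Subsequence"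
begin

text \<open>
  Write \<open>W\<close> for the space that carries no quadratic part and \<open>V\<close> for its complement. For a nonzero
  \<open>v \<in> V\<close> the functional \<open>J\<close> attains its maximum over the half space of all \<open>t v + y\<close> with \<open>t \<ge> 0\<close> and
  \<open>y \<in> W\<close>: superquadratic growth of \<open>I\<close> bounds \<open>t\<close>, coercivity bounds \<open>y\<close>, and weak compactness
  (\<open>fibre_compactness\<close>) gives a maximum, which is a critical point along the half space. The fibre inequality
  says that every point of the Nehari set is the strict maximum over its half space. So each half space contains
  exactly one point \<open>fibre_point v\<close> of the Nehari set, depending continuously on \<open>v\<close>
  (\<open>fibre_point_continuous\<close>), and the problem is one about \<open>reduced v = J (fibre_point v)\<close> on the unit sphere
  of the Hilbert space \<open>V\<close>.

  Weak limits. If the \<open>V\<close>-components \<open>v\<^sub>n\<close> of \<open>u\<^sub>n\<close> in the Nehari set tended weakly to zero, the points of the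
  Nehari set of \<open>Jcp\<close> over \<open>v\<^sub>n\<close> would lie in the half spaces of \<open>u\<^sub>n\<close>, so that \<open>J\<close> is at most \<open>J u\<^sub>n\<close> on
  them; as \<open>J\<close> and \<open>Jcp\<close> agree asymptotically there, the level of \<open>u\<^sub>n\<close> would be at least the infimum of
  \<open>Jcp\<close>. Hence below that level the weak limit has a nonzero \<open>V\<close>-component
  (\<open>weak_limit_component_nonzero\<close>). For a ground state this is more than nontriviality: it is what places the
  weak limit of a minimizing Palais-Smale sequence in the Nehari set (\<open>ground_state_exists\<close>).

  Descent. A gradient flow is replaced by iterating one continuous map of the sphere, odd if \<open>J\<close> is even: a
  gradient step with a continuously chosen length, followed by normalization (\<open>descent_map\<close>). It lowers \<open>reduced\<close> by at least a
  constant times gradient norm times step length. Since \<open>reduced\<close> is a maximum, the drop over one step is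
  estimated by the mean value theorem for \<open>J\<close> at a single point, and the derivative of \<open>reduced\<close> itself never
  enters (\<open>reduced_drop\<close>). Every orbit meets points with arbitrarily small gradient (\<open>descent_orbit\<close>), which yields
  Palais-Smale sequences at the infimum.

  Multiplicity. Suppose that there are only \<open>k\<close> pairs of critical points. The orbit of every point of a sublevel
  set visits a small ball around a critical direction. It cannot visit the balls around two opposite ones,
  because leaving a neighbourhood costs more than the oscillation of \<open>reduced\<close> on the small balls
  (\<open>descent_orbit_trapped\<close>), while opposite points have equal levels. The sets of points visiting a given ball
  are therefore open and disjoint from their mirror images, and \<open>k\<close> such pairs of sets cover the sublevel set.
  Comparing distances to complements turns them into \<open>k\<close> odd functions without common zero
  (\<open>genus_le_paired_cover\<close>), so the genus is at most \<open>k\<close>.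

  The functional analysis behind this is the Hahn-Banach theorem, the Eberlein-Smulian theorem for reflexive
  spaces and the Riesz representation on a complete inner product subspace.
\<close>

section \<open>The Hahn-Banach theorem\<close>

text \<open>Homogeneity is stated as an inequality, which is all that infima of such functionals inherit directly;
  rescaling by the inverse factor turns it into the equation \<open>sublinear_scale\<close>.\<close>

definition sublinear :: "('a::real_vector \<Rightarrow> real) \<Rightarrow> bool" where
  "sublinear p \<longleftrightarrow> p 0 = 0 \<and> (\<forall>x y. p (x + y) \<le> p x + p y) \<and> (\<forall>a>0. \<forall>x. p (a *\<^sub>R x) \<le> a * p x)"

lemma sublinear_scale:
  assumes "sublinear p" "0 \<le> a"
  shows "p (a *\<^sub>R x) = a * p x"
proof (cases "a = 0")
  case True
  then show ?thesis using assms by (simp add: sublinear_def)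
next
  case False
  then have a: "0 < a" using assms by simp
  have "p (inverse a *\<^sub>R (a *\<^sub>R x)) \<le> inverse a * p (a *\<^sub>R x)"
    using assms a unfolding sublinear_def by (meson positive_imp_inverse_positive)
  then have "a * p x \<le> p (a *\<^sub>R x)" using a by (simp add: field_simps)
  then show ?thesis using assms a unfolding sublinear_def by (meson order_antisym)
qed

lemma sublinear_minus_le: "sublinear p \<Longrightarrow> - p (- x) \<le> p x"
proof -
  assume "sublinear p"
  then have "p 0 = 0" "p (x + - x) \<le> p x + p (- x)" unfolding sublinear_def by blast+
  then show ?thesis by simp
qed

text \<open>A sublinear functional below \<open>q\<close> whose value at \<open>- z\<close> is as small as sublinearity permits, namely \<open>- q z\<close>.
  Applied to a minimal functional it yields additivity; applied to the initial one it prescribes the value at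
  \<open>z\<close> of every linear functional below it.\<close>

definition ray_reduction :: "('a::real_vector \<Rightarrow> real) \<Rightarrow> 'a \<Rightarrow> 'a \<Rightarrow> real" where
  "ray_reduction q z x = (INF t\<in>{0::real..}. q (x + t *\<^sub>R z) - t * q z)"

lemma ray_reduction_lower:
  assumes "sublinear q" "0 \<le> t"
  shows "ray_reduction q z x \<le> q (x + t *\<^sub>R z) - t * q z"
  unfolding ray_reduction_def
proof (rule cINF_lower)
  show "bdd_below ((\<lambda>t. q (x + t *\<^sub>R z) - t * q z) ` {0..})"
  proof (rule bdd_belowI2)
    fix t :: real assume "t \<in> {0..}"
    then have "t * q z = q ((x + t *\<^sub>R z) + (- x))"
      using sublinear_scale[OF assms(1), of t z] by simp
    also have "\<dots> \<le> q (x + t *\<^sub>R z) + q (- x)" using assms(1) unfolding sublinear_def by blast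
    finally show "- q (- x) \<le> q (x + t *\<^sub>R z) - t * q z" by simp
  qed
qed (use assms in auto)

lemma ray_reduction_le: "sublinear q \<Longrightarrow> ray_reduction q z x \<le> q x"
  using ray_reduction_lower[of q 0 z x] by simp

lemma sublinear_ray_reduction:
  assumes q: "sublinear q"
  shows "sublinear (ray_reduction q z)"
proof -
  have add: "ray_reduction q z (x + y) \<le> ray_reduction q z x + ray_reduction q z y" for x y
  proof -
    have "ray_reduction q z (x + y) - (q (x + s *\<^sub>R z) - s * q z) \<le> q (y + t *\<^sub>R z) - t * q z"
      if "0 \<le> s" "0 \<le> t" for s t
    proof -
      have "ray_reduction q z (x + y) \<le> q ((x + y) + (s + t) *\<^sub>R z) - (s + t) * q z"
        using ray_reduction_lower[OF q, of "s + t"] that by simp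
      also have "(x + y) + (s + t) *\<^sub>R z = (x + s *\<^sub>R z) + (y + t *\<^sub>R z)" by (simp add: algebra_simps)
      also have "q \<dots> \<le> q (x + s *\<^sub>R z) + q (y + t *\<^sub>R z)" using q unfolding sublinear_def by blast
      finally show ?thesis by (simp add: algebra_simps)
    qed
    then have "ray_reduction q z (x + y) - (q (x + s *\<^sub>R z) - s * q z) \<le> ray_reduction q z y"
      if "0 \<le> s" for s
      unfolding ray_reduction_def[of q z y] by (intro cINF_greatest) (use that in auto)
    then have "ray_reduction q z (x + y) - ray_reduction q z y \<le> q (x + s *\<^sub>R z) - s * q z"
      if "0 \<le> s" for s using that by (smt (verit))
    then have "ray_reduction q z (x + y) - ray_reduction q z y \<le> ray_reduction q z x"
      unfolding ray_reduction_def[of q z x] by (intro cINF_greatest) auto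
    then show ?thesis by simp
  qed
  have scale: "ray_reduction q z (a *\<^sub>R x) \<le> a * ray_reduction q z x" if a: "0 < a" for a x
  proof -
    have "inverse a * ray_reduction q z (a *\<^sub>R x) \<le> q (x + t *\<^sub>R z) - t * q z" if t: "0 \<le> t" for t
    proof -
      have "ray_reduction q z (a *\<^sub>R x) \<le> q (a *\<^sub>R x + (a * t) *\<^sub>R z) - (a * t) * q z"
        using ray_reduction_lower[OF q, of "a * t"] t a by simp
      also have "a *\<^sub>R x + (a * t) *\<^sub>R z = a *\<^sub>R (x + t *\<^sub>R z)" by (simp add: algebra_simps)
      also have "q \<dots> = a * q (x + t *\<^sub>R z)" using sublinear_scale[OF q] a by simp
      finally have "ray_reduction q z (a *\<^sub>R x) \<le> a * (q (x + t *\<^sub>R z) - t * q z)"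
        by (simp add: algebra_simps)
      then show ?thesis using a by (simp add: field_simps)
    qed
    then have "inverse a * ray_reduction q z (a *\<^sub>R x) \<le> ray_reduction q z x"
      unfolding ray_reduction_def[of q z x] by (intro cINF_greatest) auto
    then show ?thesis using a by (simp add: field_simps)
  qed
  have "ray_reduction q z 0 = (INF t\<in>{0::real..}. 0)"
    unfolding ray_reduction_def using sublinear_scale[OF q] by (intro INF_cong) auto
  then show ?thesis unfolding sublinear_def using add scale by simp
qed

text \<open>By Zorn's lemma: the pointwise infimum of a chain stays sublinear, since of two members the smaller one
  serves for both summands, and it is finite, since every member is at least \<open>- p (- x)\<close>.\<close>

lemma minimal_sublinear_below:
  assumes p: "sublinear p"
  obtains q where "sublinear q" "\<And>x. q x \<le> p x"
    "\<And>q'. sublinear q' \<Longrightarrow> (\<And>x. q' x \<le> q x) \<Longrightarrow> q' = q"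
proof -
  define A where "A = {q. sublinear q \<and> q \<le> p}"
  have "\<exists>m\<in>A. \<forall>a\<in>A. m \<ge> a \<longrightarrow> a = m"
  proof (rule predicate_Zorn)
    show "partial_order_on A (relation_of (\<lambda>x y. y \<le> x) A)"
      by (rule partial_order_on_relation_ofI) auto
    fix C assume "C \<in> Chains (relation_of (\<lambda>x y. y \<le> x) A)"
    then have C: "C \<subseteq> A" "\<And>a b. a \<in> C \<Longrightarrow> b \<in> C \<Longrightarrow> a \<le> b \<or> b \<le> a"
      unfolding Chains_def relation_of_def by auto
    show "\<exists>u\<in>A. \<forall>a\<in>C. u \<le> a"
    proof (cases "C = {}")
      case True
      then show ?thesis using p unfolding A_def by auto
    next
      case False
      define u where "u x = (INF q\<in>C. q x)" for x
      have bdd: "bdd_below ((\<lambda>q. q x) ` C)" for x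
      proof (rule bdd_belowI2)
        fix q assume "q \<in> C"
        then have "sublinear q" "q (- x) \<le> p (- x)" using C(1) by (auto simp: A_def le_fun_def)
        then show "- p (- x) \<le> q x" using sublinear_minus_le[of q x] by simp
      qed
      have low: "u x \<le> q x" if "q \<in> C" for q x
        unfolding u_def by (rule cINF_lower[OF bdd that])
      have sub: "sublinear q" if "q \<in> C" for q using that C(1) by (auto simp: A_def)
      have add: "u (x + y) \<le> u x + u y" for x y
      proof -
        have *: "u (x + y) \<le> q1 x + q2 y" if q: "q1 \<in> C" "q2 \<in> C" for q1 q2
        proof -
          obtain q where "q \<in> C" "q x \<le> q1 x" "q y \<le> q2 y"
            using C(2)[OF q] q unfolding le_fun_def by blast
          moreover have "q (x + y) \<le> q x + q y"
            using sub[OF \<open>q \<in> C\<close>] unfolding sublinear_def by blast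
          ultimately show ?thesis using low[of q "x + y"] by linarith
        qed
        have "u (x + y) - q1 x \<le> u y" if q: "q1 \<in> C" for q1
          unfolding u_def[of y]
          by (rule cINF_greatest[OF False]) (use *[OF q] in \<open>simp add: algebra_simps\<close>)
        then have "u (x + y) - u y \<le> u x"
          unfolding u_def[of x]
          by (intro cINF_greatest[OF False]) (simp add: algebra_simps)
        then show ?thesis by simp
      qed
      have scale: "u (a *\<^sub>R x) \<le> a * u x" if a: "0 < a" for a x
      proof -
        have "inverse a * u (a *\<^sub>R x) \<le> q x" if "q \<in> C" for q
          using low[OF that, of "a *\<^sub>R x"] sublinear_scale[OF sub[OF that], of a x] a
          by (simp add: field_simps)
        then have "inverse a * u (a *\<^sub>R x) \<le> u x"
          unfolding u_def[of x] by (intro cINF_greatest[OF False])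
        then show ?thesis using a by (simp add: field_simps)
      qed
      have "u 0 = (INF q\<in>C. 0)"
        unfolding u_def using sub by (intro INF_cong) (auto simp: sublinear_def)
      then have "sublinear u" unfolding sublinear_def using add scale False by simp
      moreover have "u \<le> p"
        unfolding le_fun_def
      proof
        fix x
        obtain q where "q \<in> C" using False by blast
        then have "u x \<le> q x" "q x \<le> p x" using low[of q x] C(1) by (auto simp: A_def le_fun_def)
        then show "u x \<le> p x" by linarith
      qed
      ultimately show ?thesis using low unfolding A_def le_fun_def by blast
    qed
  qed
  then obtain m where m: "m \<in> A" "\<And>a. a \<in> A \<Longrightarrow> a \<le> m \<Longrightarrow> a = m" by blast
  show ?thesis
  proof
    show "sublinear m" using m(1) by (simp add: A_def)
    show mp: "m x \<le> p x" for x using m(1) by (simp add: A_def le_fun_def)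
    fix q' assume q': "sublinear q'" "\<And>x. q' x \<le> m x"
    have "q' x \<le> p x" for x using q'(2)[of x] mp[of x] by linarith
    then have "q' \<in> A" using q'(1) by (simp add: A_def le_fun_def)
    then show "q' = m" using m(2)[of q'] q'(2) by (simp add: le_fun_def)
  qed
qed

text \<open>A minimal sublinear functional equals all its ray reductions, and the bound that these give for \<open>t = 1\<close> is
  superadditivity; so it is linear.\<close>

theorem hahn_banach_sublinear:
  assumes p: "sublinear p"
  obtains f where "linear f" "\<And>x. f x \<le> p x" "f z = p z"
proof -
  obtain q where q: "sublinear q" "\<And>x. q x \<le> ray_reduction p z x"
    and min: "\<And>q'. sublinear q' \<Longrightarrow> (\<And>x. q' x \<le> q x) \<Longrightarrow> q' = q"
    using minimal_sublinear_below[OF sublinear_ray_reduction[OF p, of z]] by blast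
  have qp: "q x \<le> p x" for x using q(2)[of x] ray_reduction_le[OF p, of z x] by simp
  have add: "q (x + y) = q x + q y" for x y
  proof (rule antisym)
    show "q (x + y) \<le> q x + q y" using q(1) unfolding sublinear_def by blast
    have "ray_reduction q y = q"
      by (rule min[OF sublinear_ray_reduction[OF q(1)] ray_reduction_le[OF q(1)]])
    then show "q x + q y \<le> q (x + y)"
      using ray_reduction_lower[OF q(1), of 1 y x] by simp
  qed
  have neg: "q (- x) = - q x" for x
    using add[of x "- x"] q(1) by (simp add: sublinear_def)
  have "linear q"
  proof
    show "q (x + y) = q x + q y" for x y by (rule add)
    show "q (a *\<^sub>R x) = a *\<^sub>R q x" for a x
      using sublinear_scale[OF q(1), of a x] sublinear_scale[OF q(1), of "- a" x] neg[of "(- a) *\<^sub>R x"]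
      by (cases "0 \<le> a") auto
  qed
  moreover have "q z = p z"
  proof (rule antisym[OF qp])
    have "q (- z) \<le> p (- z + 1 *\<^sub>R z) - 1 * p z"
      using q(2)[of "- z"] ray_reduction_lower[OF p, of 1 z "- z"] by simp
    then show "p z \<le> q z" using neg[of z] p by (simp add: sublinear_def)
  qed
  ultimately show ?thesis using qp that by blast
qed

lemma sublinear_infdist_subspace:
  fixes Y :: "'a::real_normed_vector set"
  assumes Y: "subspace Y"
  shows "sublinear (\<lambda>x. infdist x Y)"
  unfolding sublinear_def
proof (intro conjI allI impI)
  have ne: "Y \<noteq> {}" using subspace_0[OF Y] by blast
  show "infdist 0 Y = 0" using subspace_0[OF Y] by simp
  have near: "\<exists>y\<in>Y. norm (x - y) < infdist x Y + e" if "0 < e" for x e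
  proof -
    have "Inf (dist x ` Y) < infdist x Y + e" using that ne by (simp add: infdist_def)
    then show ?thesis
      using cInf_lessD[of "dist x ` Y" "infdist x Y + e"] ne by (auto simp: dist_norm)
  qed
  have le: "infdist x Y \<le> norm (x - y)" if "y \<in> Y" for x y
    using infdist_le[OF that, of x] by (simp add: dist_norm)
  fix x y
  show "infdist (x + y) Y \<le> infdist x Y + infdist y Y"
  proof (rule field_le_epsilon)
    fix e :: real assume "0 < e"
    then obtain a b where a: "a \<in> Y" "norm (x - a) < infdist x Y + e/2"
      and b: "b \<in> Y" "norm (y - b) < infdist y Y + e/2"
      using near[of "e/2" x] near[of "e/2" y] by auto
    have "infdist (x + y) Y \<le> norm (x + y - (a + b))" using le subspace_add[OF Y a(1) b(1)] by blast
    also have "\<dots> \<le> norm (x - a) + norm (y - b)"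
      by (metis add_diff_add norm_triangle_ineq)
    finally show "infdist (x + y) Y \<le> infdist x Y + infdist y Y + e" using a b by linarith
  qed
next
  have ne: "Y \<noteq> {}" using subspace_0[OF Y] by blast
  fix a :: real and x assume a: "0 < a"
  have "infdist (a *\<^sub>R x) Y / a \<le> dist x y" if "y \<in> Y" for y
  proof -
    have "infdist (a *\<^sub>R x) Y \<le> dist (a *\<^sub>R x) (a *\<^sub>R y)"
      by (rule infdist_le) (rule subspace_scale[OF Y that])
    also have "\<dots> = a * dist x y"
      using a by (simp add: dist_norm flip: scaleR_diff_right)
    finally show ?thesis using a by (simp add: field_simps)
  qed
  then have "infdist (a *\<^sub>R x) Y / a \<le> infdist x Y"
    unfolding infdist_notempty[OF ne, of x] by (intro cINF_greatest[OF ne]) auto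
  then show "infdist (a *\<^sub>R x) Y \<le> a * infdist x Y" using a by (simp add: field_simps)
qed

lemma linear_le_norm_imp_blinfun:
  fixes f :: "'a::real_normed_vector \<Rightarrow> real"
  assumes f: "linear f" and le: "\<And>x. f x \<le> C * norm x"
  obtains F :: "'a \<Rightarrow>\<^sub>L real" where "blinfun_apply F = f"
proof -
  have "\<bar>f x\<bar> \<le> norm x * C" for x
    using le[of x] le[of "- x"] linear_neg[OF f, of x] by (simp add: abs_le_iff mult.commute)
  then have "bounded_linear f"
    using f by (intro bounded_linear_intro) (auto simp: linear_add linear_cmul)
  then show ?thesis using that bounded_linear_Blinfun_apply by blast
qed

text \<open>The distance from a subspace is sublinear, vanishes there and is dominated by the norm. One statement thus
  covers separation of points from closed subspaces and, for the zero subspace, norming functionals.\<close>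

lemma distance_functional:
  fixes Y :: "'a::real_normed_vector set"
  assumes Y: "subspace Y"
  obtains f :: "'a \<Rightarrow>\<^sub>L real"
  where "\<And>y. y \<in> Y \<Longrightarrow> f y = 0" "\<And>z. \<bar>f z\<bar> \<le> norm z" "f x = infdist x Y"
proof -
  obtain h where h: "linear h" "\<And>z. h z \<le> infdist z Y" "h x = infdist x Y"
    using hahn_banach_sublinear[OF sublinear_infdist_subspace[OF Y]] by blast
  have le: "h z \<le> norm z" for z
    using h(2)[of z] infdist_le[OF subspace_0[OF Y], of z] by simp
  then obtain F :: "'a \<Rightarrow>\<^sub>L real" where F: "blinfun_apply F = h"
    using linear_le_norm_imp_blinfun[OF h(1), of 1] by auto
  have "h y = 0" if "y \<in> Y" for y
    using h(2)[of y] h(2)[of "- y"] that subspace_neg[OF Y that] linear_neg[OF h(1), of y] by simp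
  moreover have "\<bar>h z\<bar> \<le> norm z" for z
    using le[of z] le[of "- z"] linear_neg[OF h(1), of z] by (simp add: abs_le_iff)
  ultimately show ?thesis using that[of F] F h(3) by simp
qed

lemma norming_functional:
  fixes x :: "'a::real_normed_vector"
  obtains f :: "'a \<Rightarrow>\<^sub>L real" where "\<And>z. \<bar>f z\<bar> \<le> norm z" "f x = norm x"
  using distance_functional[of "{0}" x] by (auto simp: infdist_singleton)

section \<open>Weak sequential compactness in reflexive spaces\<close>

lemma weakly_converges_subseq:
  "weakly_converges u l \<Longrightarrow> strict_mono r \<Longrightarrow> weakly_converges (u \<circ> r) l"
  unfolding weakly_converges_def o_def
  by (metis (no_types, lifting) LIMSEQ_subseq_LIMSEQ comp_apply ext)

lemma weakly_converges_bounded_linear: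
  assumes "bounded_linear T" "weakly_converges u l"
  shows "weakly_converges (\<lambda>n. T (u n)) (T l)"
  unfolding weakly_converges_def
proof
  fix f :: "'b \<Rightarrow>\<^sub>L real"
  have "bounded_linear (\<lambda>x. f (T x))"
    by (rule bounded_linear_compose[OF blinfun.bounded_linear_right assms(1)])
  then have "blinfun_apply (Blinfun (\<lambda>x. f (T x))) = (\<lambda>x. f (T x))"
    by (rule bounded_linear_Blinfun_apply)
  then show "(\<lambda>n. f (T (u n))) \<longlonglongrightarrow> f (T l)"
    using assms(2)[unfolded weakly_converges_def, rule_format, of "Blinfun (\<lambda>x. f (T x))"] by simp
qed

lemma closed_subspace_weakly_closed:
  fixes Y :: "'a::real_normed_vector set"
  assumes Y: "subspace Y" "closed Y" and u: "\<And>n. u n \<in> Y" "weakly_converges u l"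
  shows "l \<in> Y"
proof (rule ccontr)
  assume l: "l \<notin> Y"
  obtain f :: "'a \<Rightarrow>\<^sub>L real" where f: "\<And>y. y \<in> Y \<Longrightarrow> f y = 0" "f l = infdist l Y"
    using distance_functional[OF Y(1)] by metis
  have "(\<lambda>n. f (u n)) \<longlonglongrightarrow> f l" using u(2) unfolding weakly_converges_def by blast
  then have "infdist l Y = 0" using f u(1) by (simp add: LIMSEQ_const_iff)
  then show False
    using l Y(2) subspace_0[OF Y(1)] in_closed_iff_infdist_zero by blast
qed

text \<open>The limes superior along the sequence is a sublinear functional on the dual space. A linear functional below
  it belongs to the bidual, hence is evaluation at a point: a weak cluster point of the sequence.\<close>

lemma reflexive_generalized_limit:
  fixes u :: "nat \<Rightarrow> 'a::real_normed_vector"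
  assumes refl: "reflexive_space TYPE('a)" and bdd: "bounded (range u)"
  obtains x where "\<And>f :: 'a \<Rightarrow>\<^sub>L real. ereal (f x) \<le> limsup (\<lambda>n. ereal (f (u n)))"
proof -
  obtain B where B: "\<And>n. norm (u n) \<le> B" "0 < B"
    using bdd unfolding bounded_pos by auto
  have ub: "\<bar>f (u n)\<bar> \<le> norm f * B" for f :: "'a \<Rightarrow>\<^sub>L real" and n
    using norm_blinfun[of f "u n"] mult_left_mono[OF B(1)[of n], of "norm f"]
    by (metis norm_ge_zero order_trans real_norm_def)
  define p where "p f = real_of_ereal (limsup (\<lambda>n. ereal (blinfun_apply f (u n))))" for f :: "'a \<Rightarrow>\<^sub>L real"
  have lim_bounds: "ereal (- (norm f * B)) \<le> limsup (\<lambda>n. ereal (f (u n)))"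
     "limsup (\<lambda>n. ereal (f (u n))) \<le> ereal (norm f * B)" for f :: "'a \<Rightarrow>\<^sub>L real"
  proof -
    show "limsup (\<lambda>n. ereal (f (u n))) \<le> ereal (norm f * B)"
      by (rule Limsup_bounded) (use ub[of f] in \<open>auto intro!: always_eventually simp: abs_le_iff\<close>)
    have "ereal (- (norm f * B)) \<le> ereal (f (u n))" for n
      using ub[of f n] by (auto simp: abs_le_iff)
    then show "ereal (- (norm f * B)) \<le> limsup (\<lambda>n. ereal (f (u n)))"
      by (intro le_Limsup) auto
  qed
  have p: "limsup (\<lambda>n. ereal (f (u n))) = ereal (p f)" for f :: "'a \<Rightarrow>\<^sub>L real"
    unfolding p_def using lim_bounds[of f]
    by (cases "limsup (\<lambda>n. ereal (f (u n)))") auto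
  have "sublinear p"
    unfolding sublinear_def
  proof (intro conjI allI impI)
    show "p 0 = 0" unfolding p_def by (simp add: Limsup_const)
    fix f g :: "'a \<Rightarrow>\<^sub>L real"
    have "limsup (\<lambda>n. ereal (f (u n)) + ereal (g (u n)))
        \<le> limsup (\<lambda>n. ereal (f (u n))) + limsup (\<lambda>n. ereal (g (u n)))"
      by (rule ereal_limsup_add_mono)
    then show "p (f + g) \<le> p f + p g"
      using p[of "f + g"] p[of f] p[of g] by (simp add: blinfun.add_left)
  next
    fix a :: real and f :: "'a \<Rightarrow>\<^sub>L real" assume "0 < a"
    then have "limsup (\<lambda>n. ereal a * ereal (f (u n))) = ereal a * limsup (\<lambda>n. ereal (f (u n)))"
      by (intro limsup_ereal_mult_left) auto
    then show "p (a *\<^sub>R f) \<le> a * p f"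
      using p[of "a *\<^sub>R f"] p[of f] by (simp add: blinfun.scaleR_left)
  qed
  then obtain h where h: "linear h" "\<And>f. h f \<le> p f"
    using hahn_banach_sublinear by metis
  have "h f \<le> B * norm f" for f
    using h(2)[of f] lim_bounds(2)[of f] p[of f] by (simp add: mult.commute)
  then obtain \<phi> :: "('a \<Rightarrow>\<^sub>L real) \<Rightarrow>\<^sub>L real" where "blinfun_apply \<phi> = h"
    using linear_le_norm_imp_blinfun[OF h(1)] by blast
  then obtain x where "\<And>f. h f = blinfun_apply f x"
    using refl unfolding reflexive_space_def by metis
  then show ?thesis using that h(2) p by (metis ereal_less_eq(3))
qed

text \<open>Combinations are indexed by lists of coefficient-index pairs: countability is immediate, and addition is
  concatenation.\<close>

lemma countable_rational_combinations:
  fixes u :: "nat \<Rightarrow> 'a::real_normed_vector"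
  obtains D where "countable D" "D \<noteq> {}" "subspace (closure D)" "range u \<subseteq> closure D"
proof -
  define comb where "comb l = sum_list (map (\<lambda>(q, n). of_rat q *\<^sub>R u n) l)" for l :: "(rat \<times> nat) list"
  define D where "D = range comb"
  have add: "x + y \<in> D" if xy: "x \<in> D" "y \<in> D" for x y
  proof -
    obtain l k where "x = comb l" "y = comb k" using xy unfolding D_def by blast
    then have "x + y = comb (l @ k)" by (simp add: comb_def)
    then show ?thesis unfolding D_def by blast
  qed
  have scale: "of_rat q *\<^sub>R x \<in> D" if x: "x \<in> D" for q x
  proof -
    obtain l where l: "x = comb l" using x unfolding D_def by blast
    have "of_rat q *\<^sub>R comb l = comb (map (\<lambda>(r, n). (q * r, n)) l)"
      unfolding comb_def by (induction l) (auto simp: of_rat_mult algebra_simps)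
    then show ?thesis using l unfolding D_def by blast
  qed
  have "comb [] = 0" "\<And>n. comb [(1, n)] = u n" by (auto simp: comb_def)
  then have mem: "0 \<in> D" "\<And>n. u n \<in> D" unfolding D_def by (metis rangeI)+
  have "subspace (closure D)"
    unfolding subspace_def
  proof (intro conjI ballI allI)
    show "0 \<in> closure D" using mem closure_subset by blast
    fix x y assume "x \<in> closure D" "y \<in> closure D"
    then obtain a b where "\<And>n. a n \<in> D" "a \<longlonglongrightarrow> x" "\<And>n. b n \<in> D" "b \<longlonglongrightarrow> y"
      unfolding closure_sequential by metis
    then show "x + y \<in> closure D"
      unfolding closure_sequential using add tendsto_add by (metis (no_types, lifting))
  next
    fix c :: real and x assume "x \<in> closure D"
    then obtain a where a: "\<And>n. a n \<in> D" "a \<longlonglongrightarrow> x" unfolding closure_sequential by metis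
    have "c \<in> closure (\<rat>::real set)" by (simp add: Rats_closure_real)
    then obtain q where q: "\<And>n. q n \<in> \<rat>" "q \<longlonglongrightarrow> c" unfolding closure_sequential by metis
    have "q n *\<^sub>R a n \<in> D" for n
      using scale[OF a(1)] q(1)[of n] by (metis Rats_cases)
    then show "c *\<^sub>R x \<in> closure D"
      unfolding closure_sequential using tendsto_scaleR[OF q(2) a(2)] by (intro exI conjI allI)
  qed
  moreover have "countable D" unfolding D_def by simp
  ultimately show ?thesis using that mem closure_subset by blast
qed

text \<open>A diagonal subsequence makes countably many functionals converge that separate the points of the closed span
  of the sequence. They identify all weak cluster points of all further subsequences, and uniqueness of the
  cluster point is weak convergence.\<close>

theorem reflexive_bounded_weakly_convergent_subseq:
  fixes u :: "nat \<Rightarrow> 'a::real_normed_vector"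
  assumes refl: "reflexive_space TYPE('a)" and bdd: "bounded (range u)"
  obtains r :: "nat \<Rightarrow> nat" and x where "strict_mono r" "weakly_converges (u \<circ> r) x"
proof -
  obtain D where D: "countable D" "D \<noteq> {}" "subspace (closure D)" "range u \<subseteq> closure D"
    using countable_rational_combinations by blast
  have "\<exists>f :: 'a \<Rightarrow>\<^sub>L real. (\<forall>z. \<bar>f z\<bar> \<le> norm z) \<and> f d = norm d" for d
    using norming_functional[of d] by metis
  then obtain F :: "'a \<Rightarrow> 'a \<Rightarrow>\<^sub>L real"
    where F: "\<And>d z. \<bar>F d z\<bar> \<le> norm z" "\<And>d. F d d = norm d" by metis
  have separates: "y = 0" if y: "y \<in> closure D" "\<And>d. d \<in> D \<Longrightarrow> F d y = 0" for y
  proof -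
    have "norm y \<le> e" if "0 < e" for e
    proof -
      obtain d where d: "d \<in> D" "dist d y < e / 2"
        using y(1) \<open>0 < e\<close> closure_approachable[of y D] by (meson half_gt_zero)
      have "norm d = F d (d - y)" using F(2)[of d] y(2)[OF d(1)] by (simp add: blinfun.diff_right)
      also have "\<dots> \<le> norm (d - y)" using F(1)[of d "d - y"] by simp
      finally show ?thesis
        using d(2) norm_triangle_ineq2[of y d] by (simp add: dist_norm norm_minus_commute)
    qed
    then show ?thesis using field_le_epsilon[of "norm y" 0] by simp
  qed
  define P where "P k r \<longleftrightarrow> convergent (\<lambda>n. F (from_nat_into D k) (u (r n)))"
    for k and r :: "nat \<Rightarrow> nat"
  interpret subseqs P
  proof
    fix k and s :: "nat \<Rightarrow> nat"
    obtain B where B: "\<And>n. norm (u n) \<le> B" using bdd unfolding bounded_iff by auto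
    have "bounded (range (\<lambda>n. F (from_nat_into D k) (u (s n))))"
      unfolding bounded_iff using order_trans[OF F(1) B] by (auto intro!: exI[of _ B])
    then obtain r where "strict_mono r" "convergent ((\<lambda>n. F (from_nat_into D k) (u (s n))) \<circ> r)"
      using bounded_imp_convergent_subsequence unfolding convergent_def by metis
    then show "\<exists>r'. strict_mono r' \<and> P k (s \<circ> r')" unfolding P_def o_def by blast
  qed
  have conv: "convergent (\<lambda>n. F (from_nat_into D k) (u (diagseq n)))" for k
  proof -
    have "P k (diagseq \<circ> (+) (Suc k))"
    proof (rule diagseq_holds)
      fix r s :: "nat \<Rightarrow> nat" and n assume "strict_mono r" "P n s"
      then show "P n (s \<circ> r)"
        using convergent_subseq_convergent[of "\<lambda>m. F (from_nat_into D n) (u (s m))" r]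
        unfolding P_def o_def by auto
    qed
    then have "convergent (\<lambda>n. F (from_nat_into D k) (u (diagseq (n + Suc k))))"
      unfolding P_def o_def by (simp add: add.commute)
    then show ?thesis
      using convergent_ignore_initial_segment[of "\<lambda>n. F (from_nat_into D k) (u (diagseq n))" "Suc k"] by simp
  qed
  define v where "v = u \<circ> diagseq"
  have vD: "v n \<in> closure D" for n using D(4) unfolding v_def by auto
  have Fconv: "convergent (\<lambda>n. F d (v n))" if "d \<in> D" for d
    using conv[of "to_nat_on D d"] that D(1) unfolding v_def by simp
  have bddv: "bounded (range (v \<circ> s))" for s
    by (rule bounded_subset[OF bdd]) (auto simp: v_def)
  \<comment> \<open>A weak cluster point of a subsequence lies in the closure of \<open>D\<close> and is determined there by
    the limits of the functionals \<open>F d\<close>.\<close>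
  have cluster: "x \<in> closure D \<and> (\<forall>d\<in>D. F d x = lim (\<lambda>n. F d (v n)))"
    if s: "strict_mono s" and x: "\<And>f :: 'a \<Rightarrow>\<^sub>L real. ereal (f x) \<le> limsup (\<lambda>n. ereal (f ((v \<circ> s) n)))"
    for x s
  proof -
    have eq: "f x = L" if L: "(\<lambda>n. f (v n)) \<longlonglongrightarrow> L" for f :: "'a \<Rightarrow>\<^sub>L real" and L
    proof -
      have "(\<lambda>n. f ((v \<circ> s) n)) \<longlonglongrightarrow> L"
        using LIMSEQ_subseq_LIMSEQ[OF L s] by (simp add: o_def)
      then have "(\<lambda>n. ereal (f ((v \<circ> s) n))) \<longlonglongrightarrow> ereal L" "(\<lambda>n. ereal ((- f) ((v \<circ> s) n))) \<longlonglongrightarrow> ereal (- L)"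
        by (auto simp: blinfun.minus_left intro!: tendsto_intros)
      then have "ereal (f x) \<le> ereal L" "ereal ((- f) x) \<le> ereal (- L)"
        using x[of f] x[of "- f"] lim_imp_Limsup by (metis trivial_limit_sequentially)+
      then show ?thesis by (simp add: blinfun.minus_left)
    qed
    have "x \<in> closure D"
    proof (rule ccontr)
      assume nx: "x \<notin> closure D"
      obtain f :: "'a \<Rightarrow>\<^sub>L real" where f: "\<And>y. y \<in> closure D \<Longrightarrow> f y = 0" "f x = infdist x (closure D)"
        using distance_functional[OF D(3)] by metis
      have "f x = 0" using eq[of f 0] f(1) vD by simp
      then show False using f(2) nx D(2) in_closed_iff_infdist_zero[of "closure D" x] by auto
    qed
    moreover have "F d x = lim (\<lambda>n. F d (v n))" if "d \<in> D" for d
      using eq[of "F d"] Fconv[OF that] by (simp add: convergent_LIMSEQ_iff)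
    ultimately show ?thesis by blast
  qed
  obtain x where x: "\<And>f :: 'a \<Rightarrow>\<^sub>L real. ereal (f x) \<le> limsup (\<lambda>n. ereal (f ((v \<circ> id) n)))"
    using reflexive_generalized_limit[OF refl bddv[of id]] by blast
  have unique: "y = x"
    if s: "strict_mono s" and y: "\<And>f :: 'a \<Rightarrow>\<^sub>L real. ereal (f y) \<le> limsup (\<lambda>n. ereal (f ((v \<circ> s) n)))" for y s
  proof -
    have "F d (y - x) = 0" if "d \<in> D" for d
      using cluster[OF s y] cluster[OF strict_mono_id x] that by (simp add: blinfun.diff_right)
    moreover have "y - x \<in> closure D"
      using cluster[OF s y] cluster[OF strict_mono_id x] subspace_diff[OF D(3)] by blast
    ultimately show ?thesis using separates[of "y - x"] by simp
  qed
  have above: "\<forall>\<^sub>F n in sequentially. f x - e < f (v n)" if e: "0 < e" for f :: "'a \<Rightarrow>\<^sub>L real" and e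
  proof (rule ccontr)
    assume "\<not> ?thesis"
    then have "infinite {n. f (v n) \<le> f x - e}"
      by (simp add: cofinite_eq_sequentially[symmetric] eventually_cofinite not_less)
    then obtain s :: "nat \<Rightarrow> nat" where s: "strict_mono s" "\<And>n. f (v (s n)) \<le> f x - e"
      using infinite_enumerate[of "{n. f (v n) \<le> f x - e}"] by auto
    obtain y where y: "\<And>f :: 'a \<Rightarrow>\<^sub>L real. ereal (f y) \<le> limsup (\<lambda>n. ereal (f ((v \<circ> s) n)))"
      using reflexive_generalized_limit[OF refl bddv[of s]] by blast
    have "limsup (\<lambda>n. ereal (f ((v \<circ> s) n))) \<le> ereal (f x - e)"
      by (rule Limsup_bounded) (use s(2) in auto)
    then have "ereal (f y) \<le> ereal (f x - e)" using y[of f] by (rule order_trans[rotated])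
    then show False using unique[OF s(1) y] e by simp
  qed
  have "weakly_converges v x"
    unfolding weakly_converges_def
  proof
    fix f :: "'a \<Rightarrow>\<^sub>L real"
    show "(\<lambda>n. f (v n)) \<longlonglongrightarrow> f x"
      unfolding tendsto_iff
    proof (intro allI impI)
      fix e :: real assume "0 < e"
      from eventually_conj[OF above[OF this, of f] above[OF this, of "- f"]]
      show "\<forall>\<^sub>F n in sequentially. dist (f (v n)) (f x) < e"
        by eventually_elim (auto simp: dist_real_def blinfun.minus_left)
    qed
  qed
  then show ?thesis using that subseq_diagseq unfolding v_def by blast
qed

section \<open>Direct sums and derivatives\<close>

lemma direct_sum_commute: "direct_sum U V W \<Longrightarrow> direct_sum U W V"
  unfolding direct_sum_def sum_space_def by (auto simp: Int_commute) (metis add.commute)+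

lemma component_eqI:
  assumes "direct_sum UNIV V W" "v \<in> V" "u - v \<in> W"
  shows "component V W u = v"
  unfolding component_def
proof (rule the_equality)
  fix v' assume v': "v' \<in> V \<and> u - v' \<in> W"
  have ds: "subspace V" "subspace W" "V \<inter> W = {0}" using assms(1) unfolding direct_sum_def by auto
  have "v' - v \<in> V" "(u - v) - (u - v') \<in> W"
    using assms v' ds by (blast intro: subspace_diff)+
  moreover have "(u - v) - (u - v') = v' - v" by simp
  ultimately have "v' - v \<in> V \<inter> W" by simp
  then show "v' = v" unfolding ds by simp
qed (use assms in auto)

lemma component_in_space:
  assumes "direct_sum UNIV V W"
  shows "component V W u \<in> V" "u - component V W u \<in> W"
proof -
  obtain v w where vw: "u = v + w" "v \<in> V" "w \<in> W"
    using assms UNIV_I[of u] unfolding direct_sum_def sum_space_def by blast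
  then have "component V W u = v" using component_eqI[OF assms vw(2), of u] by simp
  then show "component V W u \<in> V" "u - component V W u \<in> W" using vw by auto
qed

lemma component_other:
  assumes "direct_sum UNIV V W"
  shows "component W V u = u - component V W u"
  using component_in_space[OF assms, of u] by (intro component_eqI direct_sum_commute[OF assms]) auto

lemma linear_component:
  assumes "direct_sum UNIV V W"
  shows "linear (component V W)"
proof
  have sub: "subspace V" "subspace W" using assms unfolding direct_sum_def by auto
  note c = component_in_space[OF assms]
  show "component V W (x + y) = component V W x + component V W y" for x y
  proof (rule component_eqI[OF assms])
    have "(x - component V W x) + (y - component V W y) \<in> W" by (intro subspace_add sub c)
    then show "x + y - (component V W x + component V W y) \<in> W" by (simp add: algebra_simps)
  qed (intro subspace_add sub c)
  show "component V W (a *\<^sub>R x) = a *\<^sub>R component V W x" for a x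
  proof (rule component_eqI[OF assms])
    have "a *\<^sub>R (x - component V W x) \<in> W" by (intro subspace_scale sub c)
    then show "a *\<^sub>R x - a *\<^sub>R component V W x \<in> W" by (simp add: algebra_simps)
  qed (intro subspace_scale sub c)
qed

lemma component_of_sum:
  "direct_sum UNIV V W \<Longrightarrow> v \<in> V \<Longrightarrow> w \<in> W \<Longrightarrow> component V W (v + w) = v"
  by (rule component_eqI) auto

lemma component_eq_0_iff: "direct_sum UNIV V W \<Longrightarrow> component V W u = 0 \<longleftrightarrow> u \<in> W"
  using component_in_space[of V W u] component_eqI[of V W 0 u]
  by (auto simp: direct_sum_def subspace_0)

lemma direct_sum_assoc:
  assumes UW: "direct_sum UNIV U W" and W: "direct_sum W V Z"
  shows "direct_sum UNIV (sum_space U V) Z"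
proof -
  have sub: "subspace U" "subspace W" "subspace V" "subspace Z"
    and int: "U \<inter> W = {0}" "V \<inter> Z = {0}" and sum: "UNIV = sum_space U W" "W = sum_space V Z"
    using UW W unfolding direct_sum_def by auto
  have Wmem: "v + z \<in> W" if "v \<in> V" "z \<in> Z" for v z using that sum(2) unfolding sum_space_def by blast
  have VW: "v \<in> W" if "v \<in> V" for v using Wmem[OF that subspace_0[OF sub(4)]] by simp
  have ZW: "z \<in> W" if "z \<in> Z" for z using Wmem[OF subspace_0[OF sub(3)] that] by simp
  have "sum_space U V = {x + y |x y. x \<in> U \<and> y \<in> V}" by (simp add: sum_space_def)
  then have "subspace (sum_space U V)" using subspace_sums[OF sub(1,3)] by simp
  moreover have "x = 0" if x: "x \<in> sum_space U V" "x \<in> Z" for x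
  proof -
    obtain u v where uv: "x = u + v" "u \<in> U" "v \<in> V" using x(1) unfolding sum_space_def by blast
    have "u = x - v" using uv(1) by simp
    then have "u \<in> W" using subspace_diff[OF sub(2) ZW[OF x(2)] VW[OF uv(3)]] by simp
    then have "u = 0" using uv(2) int(1) by blast
    then show "x = 0" using uv x(2) int(2) by auto
  qed
  moreover have "0 \<in> sum_space U V" using calculation(1) subspace_0 by blast
  moreover have "x \<in> sum_space (sum_space U V) Z" for x
  proof -
    obtain u y where "x = u + y" "u \<in> U" "y \<in> W" using sum(1) UNIV_I[of x] unfolding sum_space_def by blast
    moreover obtain v z where "y = v + z" "v \<in> V" "z \<in> Z"
      using \<open>y \<in> W\<close> sum(2) unfolding sum_space_def by blast
    ultimately have "x = (u + v) + z" "u + v \<in> sum_space U V" "z \<in> Z"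
      unfolding sum_space_def by (auto simp: add.assoc)
    then show ?thesis unfolding sum_space_def[of "sum_space U V"] by blast
  qed
  ultimately show ?thesis
    using sub(4) subspace_0[OF sub(4)] unfolding direct_sum_def by blast
qed

lemma C1_functional_has_derivative:
  assumes "C1_functional J"
  shows "(J has_derivative blinfun_apply (dual_deriv J u)) (at u)"
proof -
  have d: "(J has_derivative frechet_derivative J (at u)) (at u)"
    using assms unfolding C1_functional_def frechet_derivative_works by blast
  then have "blinfun_apply (dual_deriv J u) = frechet_derivative J (at u)"
    unfolding dual_deriv_def by (intro bounded_linear_Blinfun_apply has_derivative_bounded_linear)
  then show ?thesis using d by simp
qed

lemma C1_functional_isCont: "C1_functional J \<Longrightarrow> isCont J u"
  using C1_functional_has_derivative has_derivative_continuous by blast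

lemma C1_functional_directional_derivative:
  assumes "C1_functional J"
  shows "((\<lambda>s. J (u + s *\<^sub>R z)) has_real_derivative dual_deriv J (u + s *\<^sub>R z) z) (at s)"
proof -
  have "((\<lambda>s. u + s *\<^sub>R z) has_derivative (\<lambda>h. h *\<^sub>R z)) (at s)"
    by (auto intro!: derivative_eq_intros)
  then have "((\<lambda>s. J (u + s *\<^sub>R z)) has_derivative (\<lambda>h. dual_deriv J (u + s *\<^sub>R z) (h *\<^sub>R z))) (at s)"
    using has_derivative_compose[OF _ C1_functional_has_derivative[OF assms]] by blast
  then show ?thesis
    unfolding has_field_derivative_def by (simp add: blinfun.scaleR_right mult.commute[of _ "blinfun_apply _ _"])
qed

lemma dual_deriv_unique:
  assumes "C1_functional J" "((\<lambda>s. J (u + s *\<^sub>R z)) has_real_derivative D) (at 0)"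
  shows "dual_deriv J u z = D"
  using DERIV_unique[OF assms(2)] C1_functional_directional_derivative[OF assms(1), of u z 0] by simp

lemma even_functional_dual_deriv:
  assumes "C1_functional J" and even: "\<And>u. J (- u) = J u"
  shows "dual_deriv J (- u) = - dual_deriv J u"
proof (rule blinfun_eqI)
  fix z
  have "((\<lambda>s. J (u + s *\<^sub>R (- z))) has_real_derivative dual_deriv J u (- z)) (at 0)"
    using C1_functional_directional_derivative[OF assms(1), of u "- z" 0] by simp
  moreover have "J (u + s *\<^sub>R (- z)) = J (- u + s *\<^sub>R z)" for s
    using even[of "u + s *\<^sub>R (- z)"] by simp
  ultimately show "dual_deriv J (- u) z = (- dual_deriv J u) z"
    using dual_deriv_unique[OF assms(1), of "- u" z] by (simp add: blinfun.minus_left blinfun.minus_right)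
qed

lemma nehari_iff:
  assumes W: "subspace W"
  shows "u \<in> nehari J W \<longleftrightarrow>
    u \<notin> W \<and> dual_deriv J u u = 0 \<and> (\<forall>w\<in>W. dual_deriv J u w = 0)"
proof -
  have "dual_deriv J u z = 0"
    if "dual_deriv J u u = 0" "\<forall>w\<in>W. dual_deriv J u w = 0" and z: "z \<in> sum_space (span {u}) W" for z
    using that unfolding sum_space_def span_singleton
    by (auto simp: blinfun.add_right blinfun.scaleR_right)
  moreover have "u \<in> sum_space (span {u}) W" "w \<in> sum_space (span {u}) W" if "w \<in> W" for w
  proof -
    show "u \<in> sum_space (span {u}) W"
      unfolding sum_space_def using subspace_0[OF W] span_base[of u "{u}"] by force
    show "w \<in> sum_space (span {u}) W"
      unfolding sum_space_def using that span_0[of "{u}"] by force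
  qed
  ultimately show ?thesis
    unfolding nehari_def using subspace_0[OF W] by blast
qed

lemma unbounded_imp_subseq_at_top:
  fixes f :: "nat \<Rightarrow> real"
  assumes "\<not> bdd_above (range f)"
  obtains s :: "nat \<Rightarrow> nat" where "strict_mono s" "filterlim (f \<circ> s) at_top sequentially"
proof -
  have ex: "\<exists>n>m. f n > c" for m c
  proof (rule ccontr)
    assume "\<not> ?thesis"
    then have "n \<le> m \<or> f n \<le> c" for n by (meson not_le)
    then have "range f \<subseteq> f ` {..m} \<union> {..c}" by auto
    moreover have "bdd_above (f ` {..m} \<union> {..c})" by simp
    ultimately show False using assms bdd_above_mono[of "f ` {..m} \<union> {..c}" "range f"] by simp
  qed
  then obtain nxt where nxt: "\<And>m c. nxt m c > m" "\<And>m c. f (nxt m c) > c" by metis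
  define s where "s = rec_nat 0 (\<lambda>k m. nxt m (real k))"
  have s: "s (Suc k) = nxt (s k) (real k)" for k by (simp add: s_def)
  have "strict_mono s" unfolding strict_mono_Suc_iff using nxt(1) s by simp
  moreover have "filterlim (\<lambda>k. f (s (Suc k))) at_top sequentially"
    by (rule filterlim_at_top_mono[OF filterlim_real_sequentially])
      (use nxt(2) s in \<open>auto intro!: always_eventually less_imp_le\<close>)
  then have "filterlim (f \<circ> s) at_top sequentially"
    unfolding o_def by (rule filterlim_sequentially_Suc[THEN iffD1])
  ultimately show ?thesis using that by blast
qed

section \<open>The fibre map onto the generalized Nehari manifold\<close>

locale nehari_setting =
  fixes V W :: "'a::banach set" and J I :: "'a \<Rightarrow> real"
  assumes refl: "reflexive_space TYPE('a)"
    and decomp: "direct_sum UNIV V W"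
    and closed_W: "closed W"
    and C1_J: "C1_functional J"
    and form: "has_form J I V W"
    and setting: "generalized_nehari_setting J I V W"
begin

abbreviation pr :: "'a \<Rightarrow> 'a" where "pr \<equiv> component V W"

lemma subspace_V: "subspace V" and subspace_W: "subspace W"
  using decomp unfolding direct_sum_def by auto

lemma C1_I: "C1_functional I" and I_nonneg: "0 \<le> I u"
  using setting unfolding generalized_nehari_setting_def nonneg_C1_def by auto

lemma J_eq: "J u = 1/2 * (norm (pr u))\<^sup>2 - I u"
  using form unfolding has_form_def by blast

lemma pr_sum: "v \<in> V \<Longrightarrow> w \<in> W \<Longrightarrow> pr (v + w) = v"
  by (rule component_of_sum[OF decomp])

lemma pr_V: "v \<in> V \<Longrightarrow> pr v = v"
  using pr_sum[of v 0] subspace_0[OF subspace_W] by simp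

lemma pr_in: "pr u \<in> V" and rest_in: "u - pr u \<in> W"
  using component_in_space[OF decomp] by auto

lemma pr_eq_0_iff: "pr u = 0 \<longleftrightarrow> u \<in> W"
  by (rule component_eq_0_iff[OF decomp])

lemma linear_pr: "linear pr" by (rule linear_component[OF decomp])

lemma J_le: "J u \<le> 1/2 * (norm (pr u))\<^sup>2"
  using J_eq[of u] I_nonneg[of u] by simp

text \<open>\<open>J + I\<close> is the quadratic part, so where the latter has a directional derivative, \<open>I'\<close> and \<open>J'\<close> can be
  exchanged. This is used along \<open>u\<close> itself and along \<open>W\<close>, where the derivative is explicit.\<close>

lemma dual_deriv_sum:
  assumes "((\<lambda>s. 1/2 * (norm (pr (u + s *\<^sub>R z)))\<^sup>2) has_real_derivative D) (at 0)"
  shows "dual_deriv I u z = D - dual_deriv J u z"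
proof (rule dual_deriv_unique[OF C1_I])
  have "I x = 1/2 * (norm (pr x))\<^sup>2 - J x" for x using J_eq[of x] by simp
  then show "((\<lambda>s. I (u + s *\<^sub>R z)) has_real_derivative D - dual_deriv J u z) (at 0)"
    using DERIV_diff[OF assms C1_functional_directional_derivative[OF C1_J, of u z 0]] by simp
qed

lemma dual_deriv_I_self: "dual_deriv I u u = (norm (pr u))\<^sup>2 - dual_deriv J u u"
proof (rule dual_deriv_sum)
  have "1/2 * (norm (pr (u + s *\<^sub>R u)))\<^sup>2 = 1/2 * (1 + s)\<^sup>2 * (norm (pr u))\<^sup>2" for s
  proof -
    have "pr (u + s *\<^sub>R u) = (1 + s) *\<^sub>R pr u"
      using linear_pr by (simp add: linear_add linear_cmul scaleR_add_left)
    then show ?thesis by (simp add: power_mult_distrib)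
  qed
  moreover have "((\<lambda>s. 1/2 * (1 + s)\<^sup>2 * (norm (pr u))\<^sup>2) has_real_derivative (norm (pr u))\<^sup>2) (at 0)"
    by (auto intro!: derivative_eq_intros)
  ultimately show "((\<lambda>s. 1/2 * (norm (pr (u + s *\<^sub>R u)))\<^sup>2) has_real_derivative (norm (pr u))\<^sup>2) (at 0)"
    by simp
qed

lemma dual_deriv_I_W: 
  assumes "w \<in> W" shows "dual_deriv I u w = - dual_deriv J u w"
proof -
  have "pr (u + s *\<^sub>R w) = pr u" for s
    using linear_pr pr_eq_0_iff[of w] assms by (simp add: linear_add linear_cmul)
  then have "dual_deriv I u w = 0 - dual_deriv J u w" by (intro dual_deriv_sum) simp
  then show ?thesis by simp
qed

text \<open>The fibre inequality is exactly the statement that a point of the Nehari set is the strict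
  maximum of \<open>J\<close> on its half space: the derivatives of \<open>I\<close> in it can be replaced, because \<open>J'\<close> vanishes
  on \<open>\<real>u + W\<close>, by the quadratic part of \<open>J\<close>.\<close>

lemma nehari_strict_max:
  assumes u: "u \<in> nehari J W" and t: "0 \<le> t" and v: "v \<in> W" and ne: "u \<noteq> t *\<^sub>R u + v"
  shows "J (t *\<^sub>R u + v) < J u"
proof -
  have u': "dual_deriv J u u = 0" "dual_deriv J u v = 0"
    using u v nehari_iff[OF subspace_W] by auto
  have "(t\<^sup>2 - 1) / 2 * dual_deriv I u u + t * dual_deriv I u v + I u - I (t *\<^sub>R u + v) < 0"
    using setting u t v ne unfolding generalized_nehari_setting_def fibre_inequality_def by blast
  then have "(t\<^sup>2 - 1) / 2 * (norm (pr u))\<^sup>2 + I u < I (t *\<^sub>R u + v)"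
    using dual_deriv_I_self[of u] dual_deriv_I_W[OF v, of u] u' by simp
  moreover have "pr (t *\<^sub>R u + v) = t *\<^sub>R pr u"
    using linear_pr pr_eq_0_iff[of v] v by (simp add: linear_add linear_cmul)
  ultimately show ?thesis
    using J_eq[of u] J_eq[of "t *\<^sub>R u + v"] by (simp add: power_mult_distrib field_simps)
qed

lemma nehari_max:
  assumes "u \<in> nehari J W" "0 \<le> t" "v \<in> W"
  shows "J (t *\<^sub>R u + v) \<le> J u"
  using nehari_strict_max[OF assms] by (cases "u = t *\<^sub>R u + v") auto

lemma nehari_scaled_component_le:
  assumes u: "u \<in> nehari J W" and t: "0 \<le> t" and v: "v \<in> W"
  shows "J (t *\<^sub>R pr u + v) \<le> J u"
proof -
  have "v - t *\<^sub>R (u - pr u) \<in> W" using v rest_in subspace_W by (auto intro: subspace_diff subspace_scale)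
  from nehari_max[OF u t this] show ?thesis by (simp add: algebra_simps)
qed

lemma positive_on_small_sphere:
  obtains a r where "0 < a" "0 < r" "\<And>v. v \<in> V \<Longrightarrow> norm v = r \<Longrightarrow> a \<le> J v"
proof -
  obtain r where r: "0 < r" "0 < (INF u \<in> {u \<in> V. norm u = r}. ereal (J u))"
    using setting unfolding generalized_nehari_setting_def positive_on_sphere_def by blast
  then obtain a where a: "0 < ereal a" "ereal a < (INF u \<in> {u \<in> V. norm u = r}. ereal (J u))"
    using ereal_dense2[of 0] by auto
  have "a \<le> J v" if "v \<in> V" "norm v = r" for v
  proof -
    have "(INF u \<in> {u \<in> V. norm u = r}. ereal (J u)) \<le> ereal (J v)"
      by (rule INF_lower) (use that in auto)
    then have "ereal a \<le> ereal (J v)" using a(2) by (meson less_imp_le order_trans)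
    then show ?thesis by simp
  qed
  then show ?thesis using that r a by simp
qed

lemma weak_lower_bound:
  assumes T: "T_converges V W u l" and e: "0 < e"
  shows "\<forall>\<^sub>F n in sequentially. I l - e < I (u n)"
proof -
  have "ereal (I l) \<le> liminf (\<lambda>n. ereal (I (u n)))"
    using setting T unfolding generalized_nehari_setting_def T_lower_semicontinuous_def by blast
  moreover have "ereal (I l - e) < ereal (I l)" using e by simp
  ultimately have "ereal (I l - e) < liminf (\<lambda>n. ereal (I (u n)))" by (rule less_le_trans[rotated])
  from less_LiminfD[OF this] show ?thesis by simp
qed

text \<open>Along fibres over a convergent sequence of nonzero directions, a lower bound on \<open>J\<close> gives
  compactness: superquadraticity bounds the factors, then coercivity of \<open>\<lambda>u. norm (pr u) + I u\<close> bounds the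
  points, and reflexivity provides the limit, at which the value of \<open>J\<close> can only be larger.\<close>

lemma fibre_compactness:
  assumes w: "\<And>n. w n \<in> V" "w \<longlonglongrightarrow> w0" "w0 \<in> V" "w0 \<noteq> 0"
    and t: "\<And>n. 0 \<le> t n" and y: "\<And>n. y n \<in> W"
    and low: "\<And>n. b \<le> J (t n *\<^sub>R w n + y n)"
  obtains r t0 y0 where "strict_mono (r :: nat \<Rightarrow> nat)" "(\<lambda>n. t (r n)) \<longlonglongrightarrow> t0" "0 \<le> t0" "y0 \<in> W"
    "T_converges V W (\<lambda>n. t (r n) *\<^sub>R w (r n) + y (r n)) (t0 *\<^sub>R w0 + y0)"
    "\<And>e. 0 < e \<Longrightarrow>
      \<forall>\<^sub>F n in sequentially. J (t (r n) *\<^sub>R w (r n) + y (r n)) < J (t0 *\<^sub>R w0 + y0) + e"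
proof -
  define u where "u n = t n *\<^sub>R w n + y n" for n
  have pru: "pr (u n) = t n *\<^sub>R w n" for n
    unfolding u_def using pr_sum[OF subspace_scale[OF subspace_V w(1)] y] .
  obtain C where C: "\<And>n. norm (w n) \<le> C"
    using convergent_imp_Bseq[OF convergentI[OF w(2)]] unfolding Bseq_def by auto
  have C0: "0 \<le> C" using C[of 0] norm_ge_zero order_trans by blast
  have Iu: "I (u n) = 1/2 * (t n)\<^sup>2 * (norm (w n))\<^sup>2 - J (u n)" for n
    using J_eq[of "u n"] pru[of n] by (simp add: power_mult_distrib)
  have "bdd_above (range t)"
  proof (rule ccontr)
    assume "\<not> bdd_above (range t)"
    then obtain s where s: "strict_mono (s :: nat \<Rightarrow> nat)" "filterlim (t \<circ> s) at_top sequentially"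
      by (rule unbounded_imp_subseq_at_top)
    \<comment> \<open>Dividing the points by their factors gives components that converge to the nonzero \<open>w0\<close>.\<close>
    define z where "z n = w (s n) + (1 / t (s n)) *\<^sub>R y (s n)" for n
    have "pr (z n) = w (s n)" for n
      unfolding z_def by (rule pr_sum[OF w(1) subspace_scale[OF subspace_W y]])
    moreover have "(\<lambda>n. w (s n)) \<longlonglongrightarrow> w0" using LIMSEQ_subseq_LIMSEQ[OF w(2) s(1)] by (simp add: o_def)
    ultimately have "(\<lambda>n. pr (z n)) \<longlonglongrightarrow> w0" by simp
    moreover have "superquadratic I V W" using setting unfolding generalized_nehari_setting_def by blast
    ultimately have "filterlim (\<lambda>n. I ((t \<circ> s) n *\<^sub>R z n) / ((t \<circ> s) n)\<^sup>2) at_top sequentially"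
      using s(2) w(3,4) unfolding superquadratic_def by blast
    then have "\<forall>\<^sub>F n in sequentially. C\<^sup>2 + \<bar>b\<bar> < I (t (s n) *\<^sub>R z n) / (t (s n))\<^sup>2"
      unfolding filterlim_at_top_dense by simp
    moreover have "\<forall>\<^sub>F n in sequentially. 1 < t (s n)"
      using s(2) unfolding filterlim_at_top_dense by simp
    ultimately have "\<forall>\<^sub>F n in sequentially. False"
    proof eventually_elim
      case (elim n)
      let ?t = "t (s n)"
      have "?t *\<^sub>R z n = u (s n)" using elim(2) by (simp add: z_def u_def algebra_simps)
      then have "(C\<^sup>2 + \<bar>b\<bar>) * ?t\<^sup>2 < I (u (s n))" using elim by (simp add: field_simps)
      moreover have "I (u (s n)) \<le> ?t\<^sup>2 * C\<^sup>2 + \<bar>b\<bar>"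
      proof -
        have "(norm (w (s n)))\<^sup>2 \<le> C\<^sup>2" using C by (simp add: power_mono)
        then have "?t\<^sup>2 * (norm (w (s n)))\<^sup>2 \<le> ?t\<^sup>2 * C\<^sup>2" by (intro mult_left_mono) auto
        moreover have "0 \<le> ?t\<^sup>2 * C\<^sup>2" by simp
        ultimately show ?thesis using Iu[of "s n"] low[of "s n"] unfolding u_def by linarith
      qed
      moreover have "\<bar>b\<bar> \<le> \<bar>b\<bar> * ?t\<^sup>2"
        using elim(2) mult_left_mono[of 1 "?t\<^sup>2" "\<bar>b\<bar>"] by simp
      ultimately show False by (simp add: algebra_simps)
    qed
    then show False by simp
  qed
  then obtain T where T: "\<And>n. t n \<le> T" unfolding bdd_above_def by auto
  have T0: "0 \<le> T" using T[of 0] t[of 0] by linarith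
  have tw: "norm (t n *\<^sub>R w n) \<le> T * C" for n
    using mult_mono[OF T C T0 norm_ge_zero] t[of n] by simp
  have ubd: "bounded (range u)"
  proof (rule ccontr)
    assume nb: "\<not> bounded (range u)"
    have "filterlim (\<lambda>u. norm (pr u) + I u) at_top at_infinity"
      using setting unfolding generalized_nehari_setting_def sum_coercive_def by blast
    then have "\<forall>\<^sub>F x in at_infinity. T * C + (T * C)\<^sup>2 + \<bar>b\<bar> < norm (pr x) + I x"
      unfolding filterlim_at_top_dense by blast
    then obtain R where R: "\<And>x. R \<le> norm x \<Longrightarrow> T * C + (T * C)\<^sup>2 + \<bar>b\<bar> < norm (pr x) + I x"
      unfolding eventually_at_infinity by blast
    obtain n where "R \<le> norm (u n)"
      using nb unfolding bounded_iff by (metis linear rangeE)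
    then have "T * C + (T * C)\<^sup>2 + \<bar>b\<bar> < norm (pr (u n)) + I (u n)" by (rule R)
    moreover have "I (u n) \<le> (T * C)\<^sup>2 + \<bar>b\<bar>"
    proof -
      have "(norm (pr (u n)))\<^sup>2 \<le> (T * C)\<^sup>2" using power_mono[OF tw norm_ge_zero, of n 2] pru[of n] by simp
      moreover have "b \<le> J (u n)" using low[of n] by (simp add: u_def)
      ultimately show ?thesis using J_eq[of "u n"] zero_le_power2[of "T * C"] by linarith
    qed
    ultimately show False using tw[of n] pru[of n] by simp
  qed
  have ybd: "bounded (range y)"
  proof -
    obtain K where "\<And>n. norm (u n) \<le> K" using ubd unfolding bounded_iff by auto
    then have "norm (y n) \<le> K + T * C" for n
      using norm_triangle_ineq4[of "u n" "t n *\<^sub>R w n"] tw[of n] unfolding u_def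
      by (smt (verit) add_diff_cancel_left')
    then show ?thesis unfolding bounded_iff by blast
  qed
  obtain r1 y0 where r1: "strict_mono (r1 :: nat \<Rightarrow> nat)" "weakly_converges (y \<circ> r1) y0"
    using reflexive_bounded_weakly_convergent_subseq[OF refl ybd] by blast
  have "bounded (range (t \<circ> r1))"
    unfolding bounded_iff using t T by (auto intro!: exI[of _ T])
  then obtain t0 r2 where r2: "strict_mono (r2 :: nat \<Rightarrow> nat)" "((t \<circ> r1) \<circ> r2) \<longlonglongrightarrow> t0"
    using bounded_imp_convergent_subsequence by metis
  define r where "r = r1 \<circ> r2"
  have r: "strict_mono r" unfolding r_def by (rule strict_mono_o[OF r1(1) r2(1)])
  have tr: "(\<lambda>n. t (r n)) \<longlonglongrightarrow> t0" using r2(2) by (simp add: r_def o_def)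
  have yr: "weakly_converges (\<lambda>n. y (r n)) y0"
    using weakly_converges_subseq[OF r1(2) r2(1)] by (simp add: r_def o_def)
  have y0: "y0 \<in> W" by (rule closed_subspace_weakly_closed[OF subspace_W closed_W y yr])
  have t0: "0 \<le> t0" using LIMSEQ_le_const[OF tr, of 0] t by blast
  have wr: "(\<lambda>n. w (r n)) \<longlonglongrightarrow> w0" using LIMSEQ_subseq_LIMSEQ[OF w(2) r] by (simp add: o_def)
  have twr: "(\<lambda>n. t (r n) *\<^sub>R w (r n)) \<longlonglongrightarrow> t0 *\<^sub>R w0" by (rule tendsto_scaleR[OF tr wr])
  have comp: "component W V (u n) = y n" for n
    using component_other[OF decomp, of "u n"] pru[of n] by (simp add: u_def)
  have prl: "pr (t0 *\<^sub>R w0 + y0) = t0 *\<^sub>R w0"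
    by (rule pr_sum[OF subspace_scale[OF subspace_V w(3)] y0])
  have Tc: "T_converges V W (\<lambda>n. u (r n)) (t0 *\<^sub>R w0 + y0)"
    unfolding T_converges_def pru comp prl component_other[OF decomp, of "t0 *\<^sub>R w0 + y0"]
    using twr yr by simp
  have up: "\<forall>\<^sub>F n in sequentially. J (u (r n)) < J (t0 *\<^sub>R w0 + y0) + e" if e: "0 < e" for e
  proof -
    have "(\<lambda>n. 1/2 * (norm (t (r n) *\<^sub>R w (r n)))\<^sup>2) \<longlonglongrightarrow> 1/2 * (norm (t0 *\<^sub>R w0))\<^sup>2"
      by (intro tendsto_intros twr)
    from order_tendstoD(2)[OF this, of "1/2 * (norm (t0 *\<^sub>R w0))\<^sup>2 + e/2"]
    have "\<forall>\<^sub>F n in sequentially. 1/2 * (norm (t (r n) *\<^sub>R w (r n)))\<^sup>2 < 1/2 * (norm (t0 *\<^sub>R w0))\<^sup>2 + e/2"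
      using e by simp
    moreover have "\<forall>\<^sub>F n in sequentially. I (t0 *\<^sub>R w0 + y0) - e/2 < I (u (r n))"
      by (rule weak_lower_bound[OF Tc]) (use e in simp)
    ultimately show ?thesis
    proof eventually_elim
      case (elim n)
      then show ?case using J_eq[of "u (r n)"] J_eq[of "t0 *\<^sub>R w0 + y0"] pru[of "r n"] prl by simp
    qed
  qed
  show ?thesis
    using that[OF r tr t0 y0] Tc up unfolding u_def by blast
qed

lemma fibre_maximum_exists:
  assumes v: "v \<in> V" "v \<noteq> 0"
  obtains t y where "0 \<le> t" "y \<in> W" "\<And>s z. 0 \<le> s \<Longrightarrow> z \<in> W \<Longrightarrow> J (s *\<^sub>R v + z) \<le> J (t *\<^sub>R v + y)"
proof -
  define F where "F = {(t :: real, y). 0 \<le> t \<and> y \<in> W}"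
  define j where "j p = J (fst p *\<^sub>R v + snd p)" for p
  have cpt: "\<exists>p\<in>F. \<forall>e>0. \<forall>N. \<exists>n\<ge>N. j (q n) < j p + e"
    if q: "\<And>n. q n \<in> F" and low: "\<And>n. b \<le> j (q n)" for q :: "nat \<Rightarrow> real \<times> 'a" and b
  proof -
    have q': "0 \<le> fst (q n)" "snd (q n) \<in> W" for n using q[of n] by (auto simp: F_def case_prod_beta)
    obtain r t0 y0 where r: "strict_mono (r :: nat \<Rightarrow> nat)" and F: "0 \<le> t0" "y0 \<in> W" and
      up: "\<And>e. 0 < e \<Longrightarrow> \<forall>\<^sub>F n in sequentially.
        J (fst (q (r n)) *\<^sub>R v + snd (q (r n))) < J (t0 *\<^sub>R v + y0) + e"
      by (rule fibre_compactness[of "\<lambda>n. v" v "\<lambda>n. fst (q n)" "\<lambda>n. snd (q n)" b])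
        (use q' low v in \<open>auto simp: j_def\<close>)
    have "\<exists>n\<ge>N. j (q n) < j (t0, y0) + e" if "0 < e" for e N
    proof -
      obtain n where "n \<ge> N" "j (q (r n)) < j (t0, y0) + e"
        using eventually_conj[OF up[OF \<open>0 < e\<close>] eventually_ge_at_top[of N]]
        by (auto simp: j_def eventually_sequentially)
      moreover have "N \<le> r n" using \<open>n \<ge> N\<close> seq_suble[OF r, of n] by linarith
      ultimately show ?thesis by blast
    qed
    then show ?thesis using F unfolding F_def by (intro bexI[of _ "(t0, y0)"]) auto
  qed
  have F0: "(0, 0) \<in> F" using subspace_0[OF subspace_W] by (simp add: F_def)
  have bdd: "bdd_above (j ` F)"
  proof (rule ccontr)
    assume nb: "\<not> bdd_above (j ` F)"
    have "\<exists>p\<in>F. real n < j p" for n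
    proof (rule ccontr)
      assume "\<not> ?thesis"
      then show False using nb by (metis bdd_aboveI2 not_le)
    qed
    then obtain q where q: "\<And>n. q n \<in> F" "\<And>n. real n < j (q n)" by metis
    have low: "0 \<le> j (q n)" for n using q(2)[of n] by linarith
    obtain p where p: "\<forall>e>0. \<forall>N. \<exists>n\<ge>N. j (q n) < j p + e"
      using bexE[OF cpt[of q 0, OF q(1) low]] by metis
    obtain N where N: "j p + 1 < real N" using reals_Archimedean2 by blast
    obtain n where "n \<ge> N" "j (q n) < j p + 1" using p zero_less_one by metis
    then show False using q(2)[of n] N by linarith
  qed
  define s where "s = Sup (j ` F)"
  have "\<exists>p\<in>F. s - 1 / real (Suc n) < j p" for n
    using less_cSupD[of "j ` F" "s - 1 / real (Suc n)"] F0 by (auto simp: s_def)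
  then obtain q where q: "\<And>n. q n \<in> F" "\<And>n. s - 1 / real (Suc n) < j (q n)" by metis
  have low: "s - 1 \<le> j (q n)" for n
  proof -
    have "1 / real (Suc n) \<le> 1" by simp
    then show ?thesis using q(2)[of n] by linarith
  qed
  obtain p where p: "p \<in> F" "\<forall>e>0. \<forall>N. \<exists>n\<ge>N. j (q n) < j p + e"
    using bexE[OF cpt[of q "s - 1", OF q(1) low]] by metis
  have "s \<le> j p"
  proof (rule field_le_epsilon)
    fix e :: real assume "0 < e"
    then obtain N where N: "1 / real (Suc N) < e / 2"
      using nat_approx_posE[of "e/2"] by auto
    obtain n where n: "n \<ge> N" "j (q n) < j p + e/2" using p(2) half_gt_zero[OF \<open>0 < e\<close>] by metis
    have "1 / real (Suc n) \<le> 1 / real (Suc N)" using n(1) by (simp add: field_simps)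
    then show "s \<le> j p + e" using q(2)[of n] n(2) N by linarith
  qed
  moreover have "J (s' *\<^sub>R v + z) \<le> s" if "0 \<le> s'" "z \<in> W" for s' z
    unfolding s_def using cSUP_upper[OF _ bdd, of "(s', z)"] that by (simp add: F_def j_def)
  ultimately have "J (s' *\<^sub>R v + z) \<le> J (fst p *\<^sub>R v + snd p)" if "0 \<le> s'" "z \<in> W" for s' z
    using that unfolding j_def by (meson order_trans)
  moreover have "0 \<le> fst p" "snd p \<in> W" using p(1) by (auto simp: F_def)
  ultimately show ?thesis using that by blast
qed

text \<open>\<open>J\<close> is positive on a small sphere of \<open>V\<close> but nonpositive on \<open>W\<close>, so the maximum over the half space is not
  on its boundary \<open>W\<close>. Hence \<open>J'\<close> vanishes there along \<open>W\<close> and along the point itself.\<close>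

lemma fibre_point_exists:
  assumes v: "v \<in> V" "v \<noteq> 0"
  shows "\<exists>u\<in>nehari J W. \<exists>t>0. pr u = t *\<^sub>R v"
proof -
  obtain t y where ty: "0 \<le> t" "y \<in> W"
    and max: "\<And>s z. 0 \<le> s \<Longrightarrow> z \<in> W \<Longrightarrow> J (s *\<^sub>R v + z) \<le> J (t *\<^sub>R v + y)"
    using fibre_maximum_exists[OF v] by blast
  obtain a r where a: "0 < a" "0 < r" "\<And>v. v \<in> V \<Longrightarrow> norm v = r \<Longrightarrow> a \<le> J v"
    using positive_on_small_sphere by blast
  define u where "u = t *\<^sub>R v + y"
  have pru: "pr u = t *\<^sub>R v" unfolding u_def using pr_sum subspace_scale[OF subspace_V v(1)] ty(2) by blast
  have "a \<le> J ((r / norm v) *\<^sub>R v + 0)"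
    using a(3)[of "(r / norm v) *\<^sub>R v"] v a(2) subspace_scale[OF subspace_V v(1)] by simp
  also have "\<dots> \<le> J u" unfolding u_def using max[of "r / norm v" 0] a(2) subspace_0[OF subspace_W] by simp
  finally have "0 < 1/2 * (norm (t *\<^sub>R v))\<^sup>2" using J_le[of u] a(1) unfolding pru by linarith
  then have "t \<noteq> 0" by auto
  then have t: "0 < t" using ty(1) by simp
  have crit: "dual_deriv J u z = 0" if z: "\<And>s. \<bar>s\<bar> < 1 \<Longrightarrow> J (u + s *\<^sub>R z) \<le> J u" for z
    using DERIV_local_max[OF C1_functional_directional_derivative[OF C1_J, of u z 0], of 1] z by simp
  have "dual_deriv J u u = 0"
  proof (rule crit)
    fix s :: real assume "\<bar>s\<bar> < 1"
    then have "J (((1 + s) * t) *\<^sub>R v + (1 + s) *\<^sub>R y) \<le> J u"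
      unfolding u_def using t subspace_scale[OF subspace_W ty(2)] by (intro max) auto
    then show "J (u + s *\<^sub>R u) \<le> J u" by (simp add: u_def algebra_simps)
  qed
  moreover have "dual_deriv J u z = 0" if "z \<in> W" for z
  proof (rule crit)
    fix s :: real
    have "J (t *\<^sub>R v + (y + s *\<^sub>R z)) \<le> J u"
      unfolding u_def using ty that subspace_W by (intro max) (auto intro: subspace_add subspace_scale)
    then show "J (u + s *\<^sub>R z) \<le> J u" by (simp add: u_def algebra_simps)
  qed
  moreover have "u \<notin> W" using pru t v(2) pr_eq_0_iff[of u] by simp
  ultimately show ?thesis using nehari_iff[OF subspace_W] pru t by blast
qed

text \<open>The chosen point is the only one, by \<open>fibre_point_eqI\<close> below.\<close>

definition fibre_point :: "'a \<Rightarrow> 'a" where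
  "fibre_point v = (SOME u. u \<in> nehari J W \<and> (\<exists>t>0. pr u = t *\<^sub>R v))"

lemma fibre_point:
  assumes "v \<in> V" "v \<noteq> 0"
  shows "fibre_point v \<in> nehari J W" "\<exists>t>0. pr (fibre_point v) = t *\<^sub>R v"
proof -
  have "\<exists>u. u \<in> nehari J W \<and> (\<exists>t>0. pr u = t *\<^sub>R v)" using fibre_point_exists[OF assms] by blast
  from someI_ex[OF this]
  show "fibre_point v \<in> nehari J W" "\<exists>t>0. pr (fibre_point v) = t *\<^sub>R v"
    unfolding fibre_point_def by blast+
qed

definition fibre_scale :: "'a \<Rightarrow> real" where
  "fibre_scale v = norm (pr (fibre_point v)) / norm v"

lemma fibre_scale:
  assumes "v \<in> V" "v \<noteq> 0"
  shows "0 < fibre_scale v" "pr (fibre_point v) = fibre_scale v *\<^sub>R v"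
  using fibre_point(2)[OF assms] assms(2) unfolding fibre_scale_def by auto

text \<open>The half space over \<open>v\<close> is also the half space over its Nehari point, which differs from a positive
  multiple of \<open>v\<close> by an element of \<open>W\<close>.\<close>

lemma fibre_strict_max:
  assumes v: "v \<in> V" "v \<noteq> 0" and s: "0 \<le> s" "z \<in> W" and ne: "s *\<^sub>R v + z \<noteq> fibre_point v"
  shows "J (s *\<^sub>R v + z) < J (fibre_point v)"
proof -
  let ?u = "fibre_point v" and ?t = "fibre_scale v"
  note t = fibre_scale[OF v]
  define y where "y = z - (s / ?t) *\<^sub>R (?u - pr ?u)"
  have y: "y \<in> W" unfolding y_def using s(2) rest_in subspace_W by (auto intro: subspace_diff subspace_scale)
  have eq: "(s / ?t) *\<^sub>R ?u + y = s *\<^sub>R v + z"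
    unfolding y_def using t by (simp add: algebra_simps)
  show ?thesis
    using nehari_strict_max[OF fibre_point(1)[OF v], of "s / ?t" y] y s(1) t(1) ne unfolding eq by auto
qed

lemma fibre_max:
  assumes "v \<in> V" "v \<noteq> 0" "0 \<le> s" "z \<in> W"
  shows "J (s *\<^sub>R v + z) \<le> J (fibre_point v)"
  using fibre_strict_max[OF assms] by (cases "s *\<^sub>R v + z = fibre_point v") auto

lemma fibre_point_eqI:
  assumes u: "u \<in> nehari J W" and t: "0 < t" and eq: "pr u = t *\<^sub>R v" and v: "v \<in> V"
  shows "fibre_point v = u"
proof (rule ccontr)
  assume ne: "fibre_point v \<noteq> u"
  have v0: "v \<noteq> 0"
    using u eq pr_eq_0_iff[of u] nehari_iff[OF subspace_W] by auto
  have "J (t *\<^sub>R v + (u - pr u)) < J (fibre_point v)"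
    by (rule fibre_strict_max[OF v v0]) (use t rest_in[of u] ne eq in auto)
  moreover have "J ((fibre_scale v / t) *\<^sub>R pr u + (fibre_point v - pr (fibre_point v))) \<le> J u"
    by (rule nehari_scaled_component_le[OF u]) (use fibre_scale(1)[OF v v0] t rest_in in auto)
  ultimately show False using eq t fibre_scale(2)[OF v v0] by (simp add: algebra_simps)
qed

lemma fibre_point_cong:
  assumes v: "v \<in> V" "v \<noteq> 0" and c: "0 < c"
  shows "fibre_point (c *\<^sub>R v) = fibre_point v"
proof (rule fibre_point_eqI[OF fibre_point(1)[OF v]])
  show "0 < fibre_scale v / c" using fibre_scale(1)[OF v] c by simp
  show "pr (fibre_point v) = (fibre_scale v / c) *\<^sub>R (c *\<^sub>R v)" using fibre_scale(2)[OF v] c by simp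
  show "c *\<^sub>R v \<in> V" by (rule subspace_scale[OF subspace_V v(1)])
qed

lemma nehari_level_positive:
  obtains a where "0 < a" "\<And>u. u \<in> nehari J W \<Longrightarrow> a \<le> J u"
proof -
  obtain a r where a: "0 < a" "0 < r" "\<And>v. v \<in> V \<Longrightarrow> norm v = r \<Longrightarrow> a \<le> J v"
    using positive_on_small_sphere by blast
  have "a \<le> J u" if u: "u \<in> nehari J W" for u
  proof -
    have "pr u \<noteq> 0" using u pr_eq_0_iff[of u] nehari_iff[OF subspace_W] by auto
    then have "a \<le> J ((r / norm (pr u)) *\<^sub>R pr u)"
      using a subspace_scale[OF subspace_V pr_in] by (intro a(3)) auto
    then show ?thesis
      using nehari_scaled_component_le[OF u, of "r / norm (pr u)" 0] a(2) subspace_0[OF subspace_W] by simp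
  qed
  then show ?thesis using that a(1) by blast
qed

text \<open>Along a subsequence the maximum points converge in the weak sense of \<open>T_converges\<close> to a point \<open>l\<close>
  over \<open>w0\<close> whose value is an upper bound for the limit of the maxima. Moving the maximum over \<open>w0\<close> into
  the nearby fibres shows that the maxima do not fall below \<open>J (fibre_point w0)\<close> in the limit. So \<open>l\<close> is a
  maximum, hence the fibre point, and the values converge, which upgrades the convergence to the norm.\<close>

lemma fibre_point_continuous:
  assumes w: "\<And>n. w n \<in> V - {0}" "w \<longlonglongrightarrow> w0" "w0 \<in> V - {0}"
  shows "(\<lambda>n. fibre_point (w n)) \<longlonglongrightarrow> fibre_point w0"
proof (rule ccontr)
  assume "\<not> ?thesis"
  then obtain e where e: "0 < e" "\<not> (\<forall>\<^sub>F n in sequentially. dist (fibre_point (w n)) (fibre_point w0) < e)"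
    unfolding tendsto_iff by blast
  then have "infinite {n. e \<le> dist (fibre_point (w n)) (fibre_point w0)}"
    by (simp add: cofinite_eq_sequentially[symmetric] eventually_cofinite not_less)
  then obtain s :: "nat \<Rightarrow> nat" where s: "strict_mono s" "\<And>n. e \<le> dist (fibre_point (w (s n))) (fibre_point w0)"
    using infinite_enumerate[of "{n. e \<le> dist (fibre_point (w n)) (fibre_point w0)}"] by auto
  obtain a where a: "0 < a" "\<And>u. u \<in> nehari J W \<Longrightarrow> a \<le> J u"
    using nehari_level_positive by blast
  have w': "w n \<in> V" "w n \<noteq> 0" for n using w(1)[of n] by auto
  have w0: "w0 \<in> V" "w0 \<noteq> 0" using w(3) by auto
  define t where "t n = fibre_scale (w (s n))" for n
  define y where "y n = fibre_point (w (s n)) - pr (fibre_point (w (s n)))" for n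
  have u: "t n *\<^sub>R w (s n) + y n = fibre_point (w (s n))" for n
    unfolding t_def y_def using fibre_scale(2)[OF w'] by simp
  have ws: "(\<lambda>n. w (s n)) \<longlonglongrightarrow> w0" using LIMSEQ_subseq_LIMSEQ[OF w(2) s(1)] by (simp add: o_def)
  have ty: "0 \<le> t n" "y n \<in> W" "a \<le> J (t n *\<^sub>R w (s n) + y n)" for n
    unfolding u unfolding t_def y_def
    using fibre_scale(1)[OF w'] rest_in a(2) fibre_point(1)[OF w'] by (auto intro: less_imp_le)
  obtain r t0 y0 where r: "strict_mono (r :: nat \<Rightarrow> nat)" and tr: "(\<lambda>n. t (r n)) \<longlonglongrightarrow> t0"
    and t0: "0 \<le> t0" "y0 \<in> W"
    and T: "T_converges V W (\<lambda>n. t (r n) *\<^sub>R w (s (r n)) + y (r n)) (t0 *\<^sub>R w0 + y0)"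
    and up: "\<And>e. 0 < e \<Longrightarrow> \<forall>\<^sub>F n in sequentially.
      J (t (r n) *\<^sub>R w (s (r n)) + y (r n)) < J (t0 *\<^sub>R w0 + y0) + e"
    by (rule fibre_compactness[of "\<lambda>n. w (s n)" w0 t y a]) (use w' ws w0 ty in auto)
  define l where "l = t0 *\<^sub>R w0 + y0"
  note T = T[unfolded u, folded l_def]
  note up = up[unfolded u, folded l_def]
  have wsr: "(\<lambda>n. w (s (r n))) \<longlonglongrightarrow> w0" using LIMSEQ_subseq_LIMSEQ[OF ws r] by (simp add: o_def)
  define z where "z = fibre_point w0 - pr (fibre_point w0)"
  have z: "z \<in> W" "fibre_scale w0 *\<^sub>R w0 + z = fibre_point w0"
    unfolding z_def using rest_in[of "fibre_point w0"] fibre_scale(2)[OF w0] by auto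
  have "(\<lambda>n. fibre_scale w0 *\<^sub>R w (s (r n)) + z) \<longlonglongrightarrow> fibre_scale w0 *\<^sub>R w0 + z"
    using wsr by (intro tendsto_intros)
  then have "(\<lambda>n. J (fibre_scale w0 *\<^sub>R w (s (r n)) + z)) \<longlonglongrightarrow> J (fibre_point w0)"
    unfolding z(2) by (rule isCont_tendsto_compose[OF C1_functional_isCont[OF C1_J]])
  moreover have below: "J (fibre_scale w0 *\<^sub>R w (s (r n)) + z) \<le> J (fibre_point (w (s (r n))))" for n
    by (rule fibre_max[OF w']) (use fibre_scale(1)[OF w0] z in auto)
  ultimately have lo: "\<forall>\<^sub>F n in sequentially. J (fibre_point w0) - e < J (fibre_point (w (s (r n))))"
    if "0 < e" for e
    using order_tendstoD(1)[of _ "J (fibre_point w0)" sequentially "J (fibre_point w0) - e"] that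
    by (smt (verit) eventually_mono)
  have "J (fibre_point w0) \<le> J l"
  proof (rule field_le_epsilon)
    fix e :: real assume "0 < e"
    then obtain n where "J (fibre_point (w (s (r n)))) < J l + e/2"
        "J (fibre_point w0) - e/2 < J (fibre_point (w (s (r n))))"
      using eventually_happens[OF eventually_conj[OF up[of "e/2"] lo[of "e/2"]]] by auto
    then show "J (fibre_point w0) \<le> J l + e" by linarith
  qed
  then have l: "l = fibre_point w0"
    using fibre_strict_max[OF w0 t0] unfolding l_def by (meson not_le)
  have "(\<lambda>n. J (fibre_point (w (s (r n))))) \<longlonglongrightarrow> J l"
    unfolding tendsto_iff
  proof (intro allI impI)
    fix e :: real assume "0 < e"
    from eventually_conj[OF up[OF this] lo[OF this]]
    show "\<forall>\<^sub>F n in sequentially. dist (J (fibre_point (w (s (r n))))) (J l) < e"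
      unfolding l by eventually_elim (auto simp: dist_real_def)
  qed
  moreover have "(\<lambda>n. pr (fibre_point (w (s (r n))))) \<longlonglongrightarrow> pr l"
    using T unfolding T_converges_def by blast
  ultimately have "(\<lambda>n. 1/2 * (norm (pr (fibre_point (w (s (r n))))))\<^sup>2 - J (fibre_point (w (s (r n)))))
      \<longlonglongrightarrow> 1/2 * (norm (pr l))\<^sup>2 - J l"
    by (intro tendsto_intros)
  then have "(\<lambda>n. I (fibre_point (w (s (r n))))) \<longlonglongrightarrow> I l"
    using J_eq by simp
  then have "(\<lambda>n. fibre_point (w (s (r n)))) \<longlonglongrightarrow> l"
    using setting T unfolding generalized_nehari_setting_def T_to_norm_def by blast
  then have "\<forall>\<^sub>F n in sequentially. dist (fibre_point (w (s (r n)))) (fibre_point w0) < e"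
    unfolding l using e(1) by (rule tendstoD)
  then show False using s(2) by (auto simp: eventually_sequentially not_less[symmetric])
qed

end

section \<open>Riesz representation on a complete subspace\<close>

locale inner_subspace =
  fixes V :: "'a::banach set" and ip :: "'a \<Rightarrow> 'a \<Rightarrow> real"
  assumes sub: "subspace V" and closed: "closed V" and ip: "inner_product_on V ip"
begin

lemma ip_commute: "x \<in> V \<Longrightarrow> y \<in> V \<Longrightarrow> ip x y = ip y x"
  and ip_add: "x \<in> V \<Longrightarrow> y \<in> V \<Longrightarrow> z \<in> V \<Longrightarrow> ip (x + y) z = ip x z + ip y z"
  and ip_scale: "x \<in> V \<Longrightarrow> y \<in> V \<Longrightarrow> ip (a *\<^sub>R x) y = a * ip x y"
  and ip_self: "x \<in> V \<Longrightarrow> ip x x = (norm x)\<^sup>2"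
  using ip unfolding inner_product_on_def by blast+

lemma norm_sq_add_scaled:
  assumes x: "x \<in> V" and y: "y \<in> V"
  shows "(norm (x + a *\<^sub>R y))\<^sup>2 = (norm x)\<^sup>2 + 2 * a * ip x y + a\<^sup>2 * (norm y)\<^sup>2"
proof -
  note mem = x y subspace_scale[OF sub y] subspace_add[OF sub x subspace_scale[OF sub y]]
  have sw: "ip x (x + a *\<^sub>R y) = ip x x + a * ip x y" "ip y (x + a *\<^sub>R y) = ip x y + a * ip y y"
    using ip_commute[of x "x + a *\<^sub>R y"] ip_commute[of y "x + a *\<^sub>R y"] ip_add[of x "a *\<^sub>R y" x]
      ip_add[of x "a *\<^sub>R y" y] ip_scale[of y x a] ip_scale[of y y a] ip_commute[of x y] mem by simp_all
  have "(norm (x + a *\<^sub>R y))\<^sup>2 = ip (x + a *\<^sub>R y) (x + a *\<^sub>R y)" using ip_self mem by simp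
  also have "\<dots> = ip x (x + a *\<^sub>R y) + a * ip y (x + a *\<^sub>R y)"
    using ip_add ip_scale mem by simp
  finally show ?thesis
    using sw ip_self[OF x] ip_self[OF y] by (simp add: algebra_simps power2_eq_square)
qed

lemma parallelogram:
  assumes x: "x \<in> V" and y: "y \<in> V"
  shows "(norm (x + y))\<^sup>2 + (norm (x - y))\<^sup>2 = 2 * (norm x)\<^sup>2 + 2 * (norm y)\<^sup>2"
  using norm_sq_add_scaled[OF x y, of 1] norm_sq_add_scaled[OF x y, of "- 1"] by simp

lemma cauchy_schwarz:
  assumes x: "x \<in> V" and y: "y \<in> V"
  shows "\<bar>ip x y\<bar> \<le> norm x * norm y"
proof (cases "y = 0")
  case True
  then have "ip x y = 0" using norm_sq_add_scaled[OF x y, of 1] by simp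
  then show ?thesis by simp
next
  case False
  define a where "a = - ip x y / (norm y)\<^sup>2"
  have ny: "0 < (norm y)\<^sup>2" using False by simp
  have "0 \<le> (norm x)\<^sup>2 + 2 * a * ip x y + a\<^sup>2 * (norm y)\<^sup>2"
    using norm_sq_add_scaled[OF x y, of a] by (metis zero_le_power2)
  also have "2 * a * ip x y + a\<^sup>2 * (norm y)\<^sup>2 = - (ip x y)\<^sup>2 / (norm y)\<^sup>2"
    unfolding a_def using ny by (simp add: field_simps power2_eq_square)
  then have "(norm x)\<^sup>2 + 2 * a * ip x y + a\<^sup>2 * (norm y)\<^sup>2 = (norm x)\<^sup>2 - (ip x y)\<^sup>2 / (norm y)\<^sup>2" by simp
  finally have "(ip x y)\<^sup>2 \<le> (norm x * norm y)\<^sup>2"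
    using ny by (simp add: field_simps power_mult_distrib)
  then show ?thesis by (metis abs_le_square_iff abs_of_nonneg mult_nonneg_nonneg norm_ge_zero)
qed

text \<open>The representing vector is the minimum of \<open>\<lambda>x. (norm x)\<^sup>2 - 2 * f x\<close>; minimizing sequences
  are Cauchy by the parallelogram law.\<close>

lemma riesz_exists:
  fixes f :: "'a \<Rightarrow>\<^sub>L real"
  shows "\<exists>g\<in>V. \<forall>z\<in>V. ip g z = f z"
proof -
  define q where "q x = (norm x)\<^sup>2 - 2 * f x" for x
  have lb: "- (norm f)\<^sup>2 \<le> q x" for x
  proof -
    have "f x \<le> norm f * norm x" using norm_blinfun[of f x] by (simp add: abs_le_iff)
    moreover have "0 \<le> (norm f - norm x)\<^sup>2" by simp
    ultimately show ?thesis unfolding q_def by (simp add: power2_eq_square algebra_simps)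
  qed
  have bdd: "bdd_below (q ` V)" using lb by (auto intro!: bdd_belowI2)
  have V0: "0 \<in> V" by (rule subspace_0[OF sub])
  define m where "m = Inf (q ` V)"
  have m: "m \<le> q x" if "x \<in> V" for x unfolding m_def by (rule cINF_lower[OF bdd that])
  have "\<exists>x\<in>V. q x < m + 1 / real (Suc n)" for n
    using cInf_lessD[of "q ` V" "m + 1 / real (Suc n)"] V0 by (auto simp: m_def)
  then obtain x where x: "\<And>n. x n \<in> V" "\<And>n. q (x n) < m + 1 / real (Suc n)" by metis
  have close: "(norm (x i - x j))\<^sup>2 \<le> 2 / real (Suc i) + 2 / real (Suc j)" for i j
  proof -
    have "m \<le> q ((1/2) *\<^sub>R (x i + x j))" by (intro m subspace_scale sub subspace_add x)
    moreover have "(norm ((1/2) *\<^sub>R (x i + x j)))\<^sup>2 = (norm (x i + x j))\<^sup>2 / 4"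
      by (simp only: norm_scaleR power_mult_distrib) (simp add: power_divide)
    moreover have "2 * f ((1/2) *\<^sub>R (x i + x j)) = f (x i) + f (x j)"
      unfolding blinfun.scaleR_right blinfun.add_right by simp
    ultimately have "m \<le> (norm (x i + x j))\<^sup>2 / 4 - (f (x i) + f (x j))"
      unfolding q_def by (simp only:)
    then have "(norm (x i - x j))\<^sup>2 \<le> 2 * q (x i) + 2 * q (x j) - 4 * m"
      using parallelogram[OF x(1)[of i] x(1)[of j]] unfolding q_def by simp
    then show ?thesis using x(2)[of i] x(2)[of j] by simp
  qed
  have "Cauchy x"
  proof (rule metric_CauchyI)
    fix e :: real assume e: "0 < e"
    then obtain N where N: "1 / real (Suc N) < e\<^sup>2 / 4" using nat_approx_posE[of "e\<^sup>2/4"] by auto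
    have "dist (x i) (x j) < e" if "N \<le> i" "N \<le> j" for i j
    proof -
      have "1 / real (Suc i) \<le> 1 / real (Suc N)" "1 / real (Suc j) \<le> 1 / real (Suc N)"
        using that by (simp_all add: field_simps)
      then have "(norm (x i - x j))\<^sup>2 < e\<^sup>2" using close[of i j] N by simp
      then show ?thesis using e by (simp add: dist_norm power_less_imp_less_base)
    qed
    then show "\<exists>M. \<forall>m\<ge>M. \<forall>n\<ge>M. dist (x m) (x n) < e" by blast
  qed
  then obtain g where g: "x \<longlonglongrightarrow> g" by (metis convergent_def Cauchy_convergent)
  have gV: "g \<in> V" by (rule closed_sequentially[OF closed x(1) g])
  have "(\<lambda>n. q (x n)) \<longlonglongrightarrow> q g" unfolding q_def by (intro tendsto_intros g)
  moreover have "(\<lambda>n. m + 1 / real (Suc n)) \<longlonglongrightarrow> m + 0"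
    by (intro tendsto_intros LIMSEQ_Suc[OF lim_1_over_n])
  ultimately have "q g \<le> m + 0"
    by (rule LIMSEQ_le) (use less_imp_le[OF x(2)] in blast)
  then have qg: "q g \<le> m" by simp
  have "ip g z = f z" if z: "z \<in> V" for z
  proof -
    have D: "((\<lambda>s. q g + 2 * s * (ip g z - f z) + s\<^sup>2 * (norm z)\<^sup>2) has_real_derivative 2 * (ip g z - f z)) (at 0)"
      by (auto intro!: derivative_eq_intros)
    have "q g \<le> q g + 2 * s * (ip g z - f z) + s\<^sup>2 * (norm z)\<^sup>2" for s
    proof -
      have "q g \<le> q (g + s *\<^sub>R z)" using qg m[OF subspace_add[OF sub gV subspace_scale[OF sub z, of s]]] by simp
      also have "\<dots> = q g + 2 * s * (ip g z - f z) + s\<^sup>2 * (norm z)\<^sup>2"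
        unfolding q_def norm_sq_add_scaled[OF gV z]
        by (simp add: blinfun.add_right blinfun.scaleR_right algebra_simps)
      finally show ?thesis .
    qed
    then have "2 * (ip g z - f z) = 0" using DERIV_local_min[OF D, of 1] by simp
    then show ?thesis by simp
  qed
  then show ?thesis using gV by blast
qed

definition riesz :: "('a \<Rightarrow>\<^sub>L real) \<Rightarrow> 'a" where
  "riesz f = (SOME g. g \<in> V \<and> (\<forall>z\<in>V. ip g z = f z))"

lemma riesz:
  fixes f :: "'a \<Rightarrow>\<^sub>L real"
  shows "riesz f \<in> V" "z \<in> V \<Longrightarrow> ip (riesz f) z = f z"
proof -
  have "\<exists>g. g \<in> V \<and> (\<forall>z\<in>V. ip g z = f z)" using riesz_exists by blast
  from someI_ex[OF this] show "riesz f \<in> V" "z \<in> V \<Longrightarrow> ip (riesz f) z = f z"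
    unfolding riesz_def by blast+
qed

lemma riesz_eqI:
  fixes f :: "'a \<Rightarrow>\<^sub>L real"
  assumes g: "g \<in> V" "\<And>z. z \<in> V \<Longrightarrow> ip g z = f z"
  shows "riesz f = g"
proof -
  let ?d = "riesz f + (- 1) *\<^sub>R g"
  have d: "?d \<in> V" by (intro subspace_add subspace_scale sub riesz g)
  have "ip ?d ?d = ip (riesz f) ?d + (- 1) * ip g ?d"
    unfolding ip_add[OF riesz(1) subspace_scale[OF sub g(1)] d] ip_scale[OF g(1) d] ..
  then have "ip ?d ?d = 0" unfolding riesz(2)[OF d] g(2)[OF d] by simp
  then show ?thesis using ip_self[OF d] by simp
qed

lemma riesz_add_scaled: "riesz (f + a *\<^sub>R h) = riesz f + a *\<^sub>R riesz h"
proof (rule riesz_eqI)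
  show "riesz f + a *\<^sub>R riesz h \<in> V" by (intro subspace_add subspace_scale sub riesz)
  show "ip (riesz f + a *\<^sub>R riesz h) z = (f + a *\<^sub>R h) z" if "z \<in> V" for z
    using that ip_add[OF riesz(1) subspace_scale[OF sub riesz(1)] that] ip_scale[OF riesz(1) that]
      riesz(2)[OF that] by (simp add: blinfun.add_left blinfun.scaleR_left)
qed

lemma riesz_minus: "riesz (- f) = - riesz f"
  using riesz_add_scaled[of 0 "- 1" f] riesz_add_scaled[of f "- 1" f] by simp

lemma norm_riesz_sq:
  fixes f :: "'a \<Rightarrow>\<^sub>L real"
  shows "(norm (riesz f))\<^sup>2 = f (riesz f)"
  using riesz(2)[OF riesz(1)] ip_self[OF riesz(1)] by simp

lemma norm_riesz_le: "norm (riesz f) \<le> norm f"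
proof -
  have "(norm (riesz f))\<^sup>2 \<le> norm f * norm (riesz f)"
    using norm_riesz_sq[of f] norm_blinfun[of f "riesz f"] by simp
  then show ?thesis
    by (cases "norm (riesz f) = 0") (auto simp: power2_eq_square mult_right_le_imp_le)
qed

lemma bounded_linear_riesz: "bounded_linear riesz"
proof (rule bounded_linear_intro)
  show "riesz (f + h) = riesz f + riesz h" for f h using riesz_add_scaled[of f 1 h] by simp
  have "riesz 0 = 0" using norm_riesz_le[of 0] by simp
  then show "riesz (a *\<^sub>R f) = a *\<^sub>R riesz f" for a f using riesz_add_scaled[of 0 a f] by simp
  show "norm (riesz f) \<le> norm f * 1" for f using norm_riesz_le[of f] by simp
qed

lemma abs_le_norm_riesz:
  fixes f :: "'a \<Rightarrow>\<^sub>L real"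
  shows "z \<in> V \<Longrightarrow> \<bar>f z\<bar> \<le> norm (riesz f) * norm z"
  using cauchy_schwarz[OF riesz(1)] riesz(2) by metis

end

section \<open>A continuous choice of step lengths\<close>

text \<open>The largest scale at which \<open>P\<close> holds uniformly near \<open>w\<close>, capped at \<open>1\<close>. Being 1-Lipschitz in \<open>w\<close>, it turns a
  locally uniform choice of step lengths into a continuous one. The scale \<open>0\<close> imposes nothing, so the supremum
  is over a nonempty set, and the value is \<open>0\<close> at points where no positive scale works.\<close>

definition uniform_radius :: "('a::metric_space \<Rightarrow> real \<Rightarrow> bool) \<Rightarrow> 'a set \<Rightarrow> 'a \<Rightarrow> real" where
  "uniform_radius P S w =
    Sup {\<rho>. 0 \<le> \<rho> \<and> \<rho> \<le> 1 \<and> (\<forall>w'\<in>S. dist w w' < \<rho> \<longrightarrow> (\<forall>s. 0 < s \<and> s \<le> \<rho> \<longrightarrow> P w' s))}"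

lemma uniform_radius_ge:
  assumes "0 \<le> \<rho>" "\<rho> \<le> 1" "\<And>w' s. w' \<in> S \<Longrightarrow> dist w w' < \<rho> \<Longrightarrow> 0 < s \<Longrightarrow> s \<le> \<rho> \<Longrightarrow> P w' s"
  shows "\<rho> \<le> uniform_radius P S w"
  unfolding uniform_radius_def by (rule cSup_upper) (use assms in \<open>auto intro!: bdd_aboveI[of _ 1]\<close>)

lemma uniform_radius_nonneg: "0 \<le> uniform_radius P S w"
  by (rule uniform_radius_ge) auto

lemma uniform_radius_lessD:
  assumes "r < uniform_radius P S w"
  obtains \<rho> where "r < \<rho>" "0 \<le> \<rho>" "\<rho> \<le> 1"
    "\<And>w' s. w' \<in> S \<Longrightarrow> dist w w' < \<rho> \<Longrightarrow> 0 < s \<Longrightarrow> s \<le> \<rho> \<Longrightarrow> P w' s"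
proof -
  have "{\<rho>. 0 \<le> \<rho> \<and> \<rho> \<le> 1 \<and> (\<forall>w'\<in>S. dist w w' < \<rho> \<longrightarrow> (\<forall>s. 0 < s \<and> s \<le> \<rho> \<longrightarrow> P w' s))} \<noteq> {}"
    by (auto intro!: exI[of _ 0])
  from less_cSupD[OF this assms[unfolded uniform_radius_def]] show ?thesis using that by blast
qed

lemma uniform_radius_lipschitz:
  "\<bar>uniform_radius P S w - uniform_radius P S z\<bar> \<le> dist w z"
proof -
  have "uniform_radius P S w \<le> uniform_radius P S z + dist w z" for w z
  proof (rule ccontr)
    assume "\<not> ?thesis"
    then obtain \<rho> where \<rho>: "uniform_radius P S z + dist w z < \<rho>" "0 \<le> \<rho>" "\<rho> \<le> 1"
      "\<And>w' s. w' \<in> S \<Longrightarrow> dist w w' < \<rho> \<Longrightarrow> 0 < s \<Longrightarrow> s \<le> \<rho> \<Longrightarrow> P w' s"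
      using uniform_radius_lessD[of "uniform_radius P S z + dist w z" P S w] by (auto simp: not_le)
    have "\<rho> - dist w z \<le> uniform_radius P S z"
    proof (rule uniform_radius_ge)
      show "0 \<le> \<rho> - dist w z" using \<rho>(1) uniform_radius_nonneg[of P S z] by linarith
      show "\<rho> - dist w z \<le> 1" using \<rho>(3) zero_le_dist[of w z] by linarith
      fix w' s assume w': "w' \<in> S" "dist z w' < \<rho> - dist w z" and s: "0 < s" "s \<le> \<rho> - dist w z"
      have "dist w w' < \<rho>" using w'(2) dist_triangle[of w w' z] by linarith
      moreover have "s \<le> \<rho>" using s(2) zero_le_dist[of w z] by linarith
      ultimately show "P w' s" using \<rho>(4) w'(1) s(1) by blast
    qed
    then show False using \<rho>(1) by linarith
  qed
  from this[of w z] this[of z w] show ?thesis by (simp add: dist_commute abs_le_iff)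
qed

lemma uniform_radius_uminus:
  fixes w :: "'a::real_normed_vector"
  assumes S: "\<And>w. w \<in> S \<Longrightarrow> - w \<in> S" and P: "\<And>w s. w \<in> S \<Longrightarrow> P w s \<Longrightarrow> P (- w) s"
  shows "uniform_radius P S (- w) = uniform_radius P S w"
proof -
  have le: "uniform_radius P S w \<le> uniform_radius P S (- w)" for w
  proof (rule ccontr)
    assume "\<not> ?thesis"
    then obtain \<rho> where \<rho>: "uniform_radius P S (- w) < \<rho>" "0 \<le> \<rho>" "\<rho> \<le> 1"
      "\<And>w' s. w' \<in> S \<Longrightarrow> dist w w' < \<rho> \<Longrightarrow> 0 < s \<Longrightarrow> s \<le> \<rho> \<Longrightarrow> P w' s"
      using uniform_radius_lessD[of "uniform_radius P S (- w)" P S w] by (auto simp: not_le)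
    have "\<rho> \<le> uniform_radius P S (- w)"
    proof (rule uniform_radius_ge[OF \<rho>(2,3)])
      fix w' s assume "w' \<in> S" "dist (- w) w' < \<rho>" "0 < s" "s \<le> \<rho>"
      moreover have "dist w (- w') = dist (- w) w'"
        using dist_minus[of w "- w'"] by simp
      ultimately show "P w' s" using \<rho>(4)[of "- w'" s] S P[of "- w'" s] by auto
    qed
    then show False using \<rho>(1) by linarith
  qed
  from le[of w] le[of "- w"] show ?thesis by simp
qed

section \<open>Descent on the unit sphere\<close>

text \<open>Iterating a continuous map which decreases \<open>\<Psi>\<close> by at least a constant times \<open>G\<close> times the step length
  makes \<open>G\<close> small somewhere on the orbit: otherwise the orbit has finite length, hence a limit, which the map
  cannot move.\<close>

lemma descent_orbit:
  fixes \<sigma> :: "'a::complete_space \<Rightarrow> 'a"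
  assumes S: "closed S" "\<And>v. v \<in> S \<Longrightarrow> \<sigma> v \<in> S" "continuous_on S \<sigma>"
    and G: "continuous_on S G" and k: "0 < k"
    and step: "\<And>v. v \<in> S \<Longrightarrow> k * G v * dist (\<sigma> v) v \<le> \<Psi> v - \<Psi> (\<sigma> v)"
    and moves: "\<And>v. v \<in> S \<Longrightarrow> 0 < G v \<Longrightarrow> \<sigma> v \<noteq> v"
    and low: "\<And>v. v \<in> S \<Longrightarrow> b \<le> (\<Psi> v :: real)"
    and v: "v \<in> S" and d: "0 < (d :: real)"
  shows "\<exists>n. G ((\<sigma> ^^ n) v) < d"
proof (rule ccontr)
  assume neg: "\<not> ?thesis"
  define x where "x n = (\<sigma> ^^ n) v" for n
  have x: "x n \<in> S" for n by (induction n) (use v S(2) in \<open>auto simp: x_def\<close>)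
  have xSuc: "x (Suc n) = \<sigma> (x n)" for n by (simp add: x_def)
  have G: "d \<le> G (x n)" for n using neg by (auto simp: x_def not_less)
  have len: "dist (x (Suc n)) (x n) \<le> (\<Psi> (x n) - \<Psi> (x (Suc n))) / (k * d)" for n
  proof -
    have "k * d * dist (x (Suc n)) (x n) \<le> k * G (x n) * dist (x (Suc n)) (x n)"
      using G[of n] k by (intro mult_right_mono mult_left_mono) auto
    also have "\<dots> \<le> \<Psi> (x n) - \<Psi> (x (Suc n))" using step[OF x] xSuc by simp
    finally show ?thesis using k d by (simp add: field_simps)
  qed
  have "summable (\<lambda>n. dist (x (Suc n)) (x n))"
  proof (rule bounded_imp_summable)
    show "(\<Sum>i\<le>n. dist (x (Suc i)) (x i)) \<le> (\<Psi> v - b) / (k * d)" for n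
    proof -
      have "(\<Sum>i\<le>n. dist (x (Suc i)) (x i)) \<le> (\<Sum>i\<le>n. (\<Psi> (x i) - \<Psi> (x (Suc i))) / (k * d))"
        by (intro sum_mono len)
      also have "\<dots> = (\<Psi> (x 0) - \<Psi> (x (Suc n))) / (k * d)"
        using sum_telescope[of "\<lambda>i. \<Psi> (x i)" n] by (simp flip: sum_divide_distrib)
      also have "\<dots> \<le> (\<Psi> v - b) / (k * d)"
        using low[OF x, of "Suc n"] k d by (intro divide_right_mono) (auto simp: x_def)
      finally show ?thesis .
    qed
  qed auto
  then have "Cauchy x"
    unfolding Cauchy_altdef2
  proof -
    assume sm: "summable (\<lambda>n. dist (x (Suc n)) (x n))"
    show "\<forall>e>0. \<exists>N. \<forall>n\<ge>N. dist (x n) (x N) < e"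
    proof (intro allI impI)
      fix e :: real assume "0 < e"
      then obtain N where N: "\<And>m n. m \<ge> N \<Longrightarrow> norm (\<Sum>i\<in>{m..<n}. dist (x (Suc i)) (x i)) < e"
        using sm unfolding summable_Cauchy by blast
      have tri: "dist (x n) (x m) \<le> (\<Sum>i\<in>{m..<n}. dist (x (Suc i)) (x i))" if "m \<le> n" for m n
        using that
      proof (induction n rule: dec_induct)
        case (step n)
        then show ?case using dist_triangle[of "x (Suc n)" "x m" "x n"] by simp
      qed simp
      have "dist (x n) (x N) < e" if "N \<le> n" for n
        using tri[OF that] N[of N n] by simp
      then show "\<exists>N. \<forall>n\<ge>N. dist (x n) (x N) < e" by blast
    qed
  qed
  then obtain l where l: "x \<longlonglongrightarrow> l" by (metis convergent_def Cauchy_convergent)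
  have lS: "l \<in> S" by (rule closed_sequentially[OF S(1) x l])
  have "(\<lambda>n. \<sigma> (x n)) \<longlonglongrightarrow> \<sigma> l"
    by (rule continuous_on_tendsto_compose[OF S(3) l lS]) (simp add: x)
  moreover have "(\<lambda>n. \<sigma> (x n)) \<longlonglongrightarrow> l" using LIMSEQ_Suc[OF l] xSuc by simp
  ultimately have fixed: "\<sigma> l = l" by (rule LIMSEQ_unique)
  have "(\<lambda>n. G (x n)) \<longlonglongrightarrow> G l"
    by (rule continuous_on_tendsto_compose[OF assms(4) l lS]) (simp add: x)
  then have "d \<le> G l" using G by (intro LIMSEQ_le_const) auto
  then show False using moves[OF lS] fixed d by simp
qed

locale nehari_hilbert = nehari_setting V W J I + inner_subspace V ip
  for V W :: "'a::banach set" and J I :: "'a \<Rightarrow> real" and ip :: "'a \<Rightarrow> 'a \<Rightarrow> real" +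
  assumes norm_pr_le: "norm (component V W u) \<le> norm u"
begin

lemma bounded_linear_pr: "bounded_linear pr"
  using linear_pr norm_pr_le by (intro bounded_linear_intro[of _ 1]) (auto simp: linear_add linear_cmul)

definition sphere_V :: "'a set" where "sphere_V = {v \<in> V. norm v = 1}"

definition reduced :: "'a \<Rightarrow> real" where "reduced v = J (fibre_point v)"

text \<open>The gradient of \<open>reduced\<close> on \<open>V\<close> up to the positive factor \<open>fibre_scale v\<close>. It is continuous, and it
  vanishes exactly over the critical points of \<open>J\<close> in the Nehari set.\<close>

definition grad :: "'a \<Rightarrow> 'a" where "grad v = riesz (dual_deriv J (fibre_point v))"

lemma sphere_VD: "v \<in> sphere_V \<Longrightarrow> v \<in> V \<and> v \<noteq> 0 \<and> norm v = 1"
  unfolding sphere_V_def by auto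

lemma closed_sphere_V: "closed sphere_V"
proof -
  have "closed {v :: 'a. norm v = 1}" by (intro closed_Collect_eq continuous_intros)
  moreover have "sphere_V = V \<inter> {v. norm v = 1}" by (auto simp: sphere_V_def)
  ultimately show ?thesis using closed_Int[OF closed] by simp
qed

lemma continuous_on_fibre_point: "continuous_on (V - {0}) fibre_point"
  unfolding continuous_on_sequentially using fibre_point_continuous by (auto simp: o_def)

lemma continuous_on_dual_deriv_J: "continuous_on A (dual_deriv J)"
  using C1_J unfolding C1_functional_def by (blast intro: continuous_on_subset)

lemma continuous_on_grad: "continuous_on (V - {0}) grad"
proof -
  have "continuous_on (V - {0}) (\<lambda>v. dual_deriv J (fibre_point v))"
    by (rule continuous_on_compose2[OF continuous_on_dual_deriv_J continuous_on_fibre_point]) auto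
  then show ?thesis
    unfolding grad_def by (rule bounded_linear.continuous_on[OF bounded_linear_riesz])
qed

lemma continuous_on_reduced: "continuous_on (V - {0}) reduced"
proof -
  have "continuous_on UNIV J"
    using C1_functional_isCont[OF C1_J] by (simp add: continuous_at_imp_continuous_on)
  then show ?thesis
    unfolding reduced_def by (rule continuous_on_compose2[OF _ continuous_on_fibre_point]) auto
qed

lemma sphere_V_subset: "sphere_V \<subseteq> V - {0}" using sphere_VD by blast

text \<open>On the Nehari set \<open>J'\<close> vanishes on \<open>W\<close>, so its norm in the whole dual is controlled by the
  gradient in \<open>V\<close>.\<close>

lemma norm_dual_deriv_le_grad:
  assumes "v \<in> V" "v \<noteq> 0"
  shows "norm (dual_deriv J (fibre_point v)) \<le> norm (grad v)"
proof (rule norm_blinfun_bound)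
  fix z
  let ?f = "dual_deriv J (fibre_point v)"
  have "?f (z - pr z) = 0"
    using fibre_point(1)[OF assms] rest_in nehari_iff[OF subspace_W] by blast
  then have "norm (?f z) = \<bar>?f (pr z)\<bar>" by (simp add: blinfun.diff_right)
  also have "\<dots> \<le> norm (grad v) * norm (pr z)"
    unfolding grad_def by (rule abs_le_norm_riesz[OF pr_in])
  also have "\<dots> \<le> norm (grad v) * norm z" by (intro mult_left_mono norm_pr_le) auto
  finally show "norm (?f z) \<le> norm (grad v) * norm z" .
qed auto

lemma grad_eq_0_iff:
  assumes "v \<in> V" "v \<noteq> 0"
  shows "grad v = 0 \<longleftrightarrow> dual_deriv J (fibre_point v) = 0"
  using norm_dual_deriv_le_grad[OF assms] norm_riesz_le[of "dual_deriv J (fibre_point v)"]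
  by (auto simp: grad_def)

lemma norm_pr_nehari_ge:
  obtains k where "0 < k" "\<And>u. u \<in> nehari J W \<Longrightarrow> k \<le> norm (pr u)"
proof -
  obtain a where a: "0 < a" "\<And>u. u \<in> nehari J W \<Longrightarrow> a \<le> J u" using nehari_level_positive by blast
  have "sqrt a \<le> norm (pr u)" if "u \<in> nehari J W" for u
  proof -
    have "a \<le> (norm (pr u))\<^sup>2" using a(2)[OF that] a(1) J_le[of u] by simp
    then show ?thesis using real_le_lsqrt real_sqrt_le_mono by fastforce
  qed
  then show ?thesis using that[of "sqrt a"] a(1) by simp
qed

text \<open>The reduced functional is a maximum over fibres, so it is bounded below at \<open>v\<close> by the value of \<open>J\<close>
  at any point of that fibre. Choosing the point obtained by moving the maximum over a nearby fibre
  turns descent of the reduced functional into the mean value theorem for \<open>J\<close>.\<close>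

lemma reduced_drop:
  assumes v: "v \<in> V" "v \<noteq> 0" and w: "v - s *\<^sub>R g \<noteq> 0" and g: "g \<in> V"
  shows "\<exists>\<theta>. 0 < \<theta> \<and> \<theta> < 1 \<and> (let u = fibre_point (v - s *\<^sub>R g); c = fibre_scale (v - s *\<^sub>R g) * s in
      c * dual_deriv J (u + (\<theta> * c) *\<^sub>R g) g \<le> reduced v - reduced (v - s *\<^sub>R g))"
proof -
  let ?w = "v - s *\<^sub>R g"
  have wV: "?w \<in> V" by (intro subspace_diff subspace_scale subspace_V v g)
  define u where "u = fibre_point ?w"
  define c where "c = fibre_scale ?w * s"
  have D: "((\<lambda>\<theta>. J (u + \<theta> *\<^sub>R (c *\<^sub>R g))) has_real_derivative dual_deriv J (u + \<theta> *\<^sub>R (c *\<^sub>R g)) (c *\<^sub>R g)) (at \<theta>)" for \<theta>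
    by (rule C1_functional_directional_derivative[OF C1_J])
  obtain \<theta> where \<theta>: "0 < \<theta>" "\<theta> < 1"
    "J (u + 1 *\<^sub>R (c *\<^sub>R g)) - J (u + 0 *\<^sub>R (c *\<^sub>R g)) = (1 - 0) * dual_deriv J (u + \<theta> *\<^sub>R (c *\<^sub>R g)) (c *\<^sub>R g)"
    using MVT2[OF zero_less_one D] by auto
  have "J (fibre_scale ?w *\<^sub>R v + (u - pr u)) \<le> J (fibre_point v)"
    by (rule fibre_max[OF v _ rest_in]) (use fibre_scale(1)[OF wV w] in simp)
  moreover have "fibre_scale ?w *\<^sub>R v + (u - pr u) = u + c *\<^sub>R g"
    using fibre_scale(2)[OF wV w] unfolding u_def c_def by (simp add: algebra_simps)
  ultimately have "c * dual_deriv J (u + (\<theta> * c) *\<^sub>R g) g \<le> reduced v - reduced ?w"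
    using \<theta>(3) unfolding reduced_def u_def by (simp add: blinfun.scaleR_right)
  then show ?thesis using \<theta> unfolding u_def c_def Let_def by blast
qed

text \<open>As \<open>v\<close> tends to \<open>v0\<close> and \<open>s\<close> to zero, the lower bound of \<open>reduced_drop\<close> divided by \<open>s\<close> tends to
  \<open>fibre_scale v0 * (norm (grad v0))\<^sup>2\<close>. On the unit sphere \<open>fibre_scale v0\<close> is the norm of the component of a
  Nehari point, so it is at least \<open>2 * k\<close> and leaves room for the constant \<open>k\<close>.\<close>

lemma local_descent:
  assumes k: "0 < k" "\<And>u. u \<in> nehari J W \<Longrightarrow> 2 * k \<le> norm (pr u)" and h: "0 < h"
    and v0: "v0 \<in> sphere_V" "grad v0 \<noteq> 0"
  shows "\<exists>\<rho>>0. \<forall>v\<in>sphere_V. dist v0 v < \<rho> \<longrightarrow> (\<forall>s. 0 < s \<and> s \<le> \<rho> \<longrightarrow>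
    s * norm (grad v) \<le> h \<and> k * s * (norm (grad v))\<^sup>2 \<le> reduced v - reduced (v - s *\<^sub>R grad v))"
proof (rule ccontr)
  assume neg: "\<not> ?thesis"
  define P where "P v s \<longleftrightarrow> s * norm (grad v) \<le> h \<and>
    k * s * (norm (grad v))\<^sup>2 \<le> reduced v - reduced (v - s *\<^sub>R grad v)" for v s
  have neg': "\<not> (\<exists>\<rho>>0. \<forall>v\<in>sphere_V. dist v0 v < \<rho> \<longrightarrow> (\<forall>s. 0 < s \<and> s \<le> \<rho> \<longrightarrow> P v s))"
    using neg unfolding P_def .
  have "\<exists>v s. v \<in> sphere_V \<and> dist v0 v < 1 / real (Suc n) \<and> 0 < s \<and> s \<le> 1 / real (Suc n) \<and> \<not> P v s" for n
  proof -
    have "0 < 1 / real (Suc n)" by simp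
    then show ?thesis using neg' by blast
  qed
  then obtain v s where vs: "\<And>n. v n \<in> sphere_V" "\<And>n. dist v0 (v n) < 1 / real (Suc n)"
      "\<And>n. 0 < s n" "\<And>n. s n \<le> 1 / real (Suc n)" and bad: "\<And>n. \<not> P (v n) (s n)"
    by metis
  have inv: "(\<lambda>n. 1 / real (Suc n)) \<longlonglongrightarrow> 0" by (rule LIMSEQ_Suc[OF lim_1_over_n])
  have sl: "s \<longlonglongrightarrow> 0"
    by (rule tendsto_sandwich[OF _ _ tendsto_const inv])
      (use less_imp_le[OF vs(3)] vs(4) in \<open>auto simp del: of_nat_Suc\<close>)
  have vl: "v \<longlonglongrightarrow> v0"
  proof (rule metric_LIMSEQ_I)
    fix r :: real assume "0 < r"
    from order_tendstoD(2)[OF inv this] obtain N where N: "\<And>n. N \<le> n \<Longrightarrow> 1 / real (Suc n) < r"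
      unfolding eventually_sequentially by blast
    then have "dist (v n) v0 < r" if "N \<le> n" for n
      using vs(2)[of n] that by (metis dist_commute less_trans)
    then show "\<exists>no. \<forall>n\<ge>no. dist (v n) v0 < r" by blast
  qed
  note v0' = sphere_VD[OF v0(1)] and vn = sphere_VD[OF vs(1)]
  define g where "g n = grad (v n)" for n
  have gV: "g n \<in> V" for n unfolding g_def grad_def by (rule riesz)
  have gl: "g \<longlonglongrightarrow> grad v0"
    unfolding g_def by (rule continuous_on_tendsto_compose[OF continuous_on_grad vl]) (use v0' vn in auto)
  define w where "w n = v n - s n *\<^sub>R g n" for n
  have "w \<longlonglongrightarrow> v0 - 0 *\<^sub>R grad v0" unfolding w_def by (intro tendsto_intros vl sl gl)
  then have wl: "w \<longlonglongrightarrow> v0" by simp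
  have wV: "w n \<in> V" for n unfolding w_def using vn gV by (intro subspace_diff subspace_scale subspace_V) auto
  have w0: "\<forall>\<^sub>F n in sequentially. w n \<noteq> 0"
    using tendsto_imp_eventually_ne[OF wl] v0' by blast
  have ul: "(\<lambda>n. fibre_point (w n)) \<longlonglongrightarrow> fibre_point v0"
    by (rule continuous_on_tendsto_compose[OF continuous_on_fibre_point wl])
      (use v0' wV w0 in \<open>auto elim: eventually_mono\<close>)
  have "(\<lambda>n. norm (pr (fibre_point (w n))) / norm (w n)) \<longlonglongrightarrow> norm (pr (fibre_point v0)) / norm v0"
    using v0' by (intro tendsto_intros bounded_linear.tendsto[OF bounded_linear_pr] ul wl) auto
  then have tl: "(\<lambda>n. fibre_scale (w n)) \<longlonglongrightarrow> fibre_scale v0" unfolding fibre_scale_def .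
  define Q where "Q n \<theta> \<longleftrightarrow> 0 < \<theta> \<and> \<theta> < 1 \<and>
      fibre_scale (w n) * s n * dual_deriv J (fibre_point (w n) + (\<theta> * (fibre_scale (w n) * s n)) *\<^sub>R g n) (g n)
      \<le> reduced (v n) - reduced (w n)" for n \<theta>
  have "\<exists>\<theta>. Q n \<theta>" if "w n \<noteq> 0" for n
    using reduced_drop[of "v n" "s n" "g n"] vn gV that unfolding Q_def w_def[of n] Let_def by simp
  then obtain \<theta> where "\<And>n. w n \<noteq> 0 \<Longrightarrow> Q n (\<theta> n)" by metis
  note \<theta> = this[unfolded Q_def]
  have \<theta>s: "(\<lambda>n. \<theta> n * (fibre_scale (w n) * s n)) \<longlonglongrightarrow> 0"
  proof (rule Lim_null_comparison)
    have "(\<lambda>n. \<bar>fibre_scale (w n) * s n\<bar>) \<longlonglongrightarrow> \<bar>fibre_scale v0 * 0\<bar>"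
      by (intro tendsto_intros tl sl)
    then show "(\<lambda>n. \<bar>fibre_scale (w n) * s n\<bar>) \<longlonglongrightarrow> 0" by simp
    show "\<forall>\<^sub>F n in sequentially. norm (\<theta> n * (fibre_scale (w n) * s n)) \<le> \<bar>fibre_scale (w n) * s n\<bar>"
      using w0
    proof eventually_elim
      case (elim n)
      have "\<bar>\<theta> n\<bar> * \<bar>fibre_scale (w n) * s n\<bar> \<le> 1 * \<bar>fibre_scale (w n) * s n\<bar>"
        using \<theta>[OF elim] by (intro mult_right_mono) auto
      then show ?case by (simp add: abs_mult)
    qed
  qed
  have "(\<lambda>n. fibre_point (w n) + (\<theta> n * (fibre_scale (w n) * s n)) *\<^sub>R g n)
      \<longlonglongrightarrow> fibre_point v0 + 0 *\<^sub>R grad v0"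
    by (intro tendsto_intros ul \<theta>s gl)
  then have "(\<lambda>n. dual_deriv J (fibre_point (w n) + (\<theta> n * (fibre_scale (w n) * s n)) *\<^sub>R g n))
      \<longlonglongrightarrow> dual_deriv J (fibre_point v0)"
    by (intro continuous_on_tendsto_compose[OF continuous_on_dual_deriv_J[of UNIV]]) auto
  then have "(\<lambda>n. fibre_scale (w n) *
      dual_deriv J (fibre_point (w n) + (\<theta> n * (fibre_scale (w n) * s n)) *\<^sub>R g n) (g n) - k * (norm (g n))\<^sup>2)
      \<longlonglongrightarrow> fibre_scale v0 * dual_deriv J (fibre_point v0) (grad v0) - k * (norm (grad v0))\<^sup>2"
    by (intro tendsto_intros tl gl)
  moreover have "dual_deriv J (fibre_point v0) (grad v0) = (norm (grad v0))\<^sup>2"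
    unfolding grad_def using norm_riesz_sq by simp
  moreover have "0 < (fibre_scale v0 - k) * (norm (grad v0))\<^sup>2"
    using k(2)[OF fibre_point(1)] v0 v0' k(1) unfolding fibre_scale_def by (intro mult_pos_pos) force+
  ultimately have pos: "\<forall>\<^sub>F n in sequentially. 0 < fibre_scale (w n) *
      dual_deriv J (fibre_point (w n) + (\<theta> n * (fibre_scale (w n) * s n)) *\<^sub>R g n) (g n) - k * (norm (g n))\<^sup>2"
    by (intro order_tendstoD(1)) (auto simp: algebra_simps)
  have "(\<lambda>n. s n * norm (g n)) \<longlonglongrightarrow> 0 * norm (grad v0)" by (intro tendsto_intros sl gl)
  then have "\<forall>\<^sub>F n in sequentially. s n * norm (g n) < h" using h by (intro order_tendstoD(2)) auto
  from eventually_happens[OF eventually_conj[OF this eventually_conj[OF pos w0]]]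
  obtain n where n: "s n * norm (g n) < h" "w n \<noteq> 0"
    "k * (norm (g n))\<^sup>2 < fibre_scale (w n) *
      dual_deriv J (fibre_point (w n) + (\<theta> n * (fibre_scale (w n) * s n)) *\<^sub>R g n) (g n)"
    by auto
  have "s n * (k * (norm (g n))\<^sup>2) \<le> s n * (fibre_scale (w n) *
      dual_deriv J (fibre_point (w n) + (\<theta> n * (fibre_scale (w n) * s n)) *\<^sub>R g n) (g n))"
    using n(3) vs(3)[of n] by (intro mult_left_mono) auto
  then have "k * s n * (norm (g n))\<^sup>2 \<le> reduced (v n) - reduced (w n)"
    using \<theta>[OF n(2)] by (simp add: mult_ac)
  then show False using bad[of n] n(1) unfolding P_def w_def g_def by simp
qed

lemma even_fibre_point:
  assumes even: "\<And>u. J (- u) = J u" and v: "v \<in> V" "v \<noteq> 0"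
  shows "fibre_point (- v) = - fibre_point v"
proof (rule fibre_point_eqI)
  show "- fibre_point v \<in> nehari J W"
  proof -
    have "u \<in> W \<longleftrightarrow> - u \<in> W" for u using subspace_neg[OF subspace_W] by force
    then show ?thesis
      using fibre_point(1)[OF v] even_functional_dual_deriv[OF C1_J even]
      by (simp add: nehari_iff[OF subspace_W] blinfun.minus_left blinfun.minus_right)
  qed
  show "0 < fibre_scale v" "- v \<in> V" using fibre_scale(1)[OF v] subspace_neg[OF subspace_V v(1)] by auto
  show "pr (- fibre_point v) = fibre_scale v *\<^sub>R (- v)"
    using fibre_scale(2)[OF v] linear_neg[OF linear_pr] by simp
qed

lemma even_grad:
  assumes even: "\<And>u. J (- u) = J u" and v: "v \<in> V" "v \<noteq> 0"
  shows "grad (- v) = - grad v"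
  unfolding grad_def even_fibre_point[OF assms] even_functional_dual_deriv[OF C1_J even]
  by (rule riesz_minus)

lemma even_reduced:
  assumes even: "\<And>u. J (- u) = J u" and v: "v \<in> V" "v \<noteq> 0"
  shows "reduced (- v) = reduced v"
  unfolding reduced_def even_fibre_point[OF assms] by (rule even)

lemma uminus_sphere_V: "v \<in> sphere_V \<Longrightarrow> - v \<in> sphere_V"
  unfolding sphere_V_def using subspace_neg[OF subspace_V] by auto

text \<open>A gradient step scaled by half the uniform radius for the estimate of \<open>local_descent\<close>, followed by radial
  projection. The projection at most doubles the distance moved, which halves the constant, and it does not
  change \<open>reduced\<close>, which is constant on rays. The scaling factor is positive unless the gradient vanishes.\<close>

theorem descent_map:
  assumes h: "0 < h"
  shows "\<exists>\<sigma> k. 0 < k \<and> (\<forall>v\<in>sphere_V. \<sigma> v \<in> sphere_V) \<and> continuous_on sphere_V \<sigma> \<and>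
    (\<forall>v\<in>sphere_V. dist (\<sigma> v) v \<le> h) \<and>
    (\<forall>v\<in>sphere_V. k * norm (grad v) * dist (\<sigma> v) v \<le> reduced v - reduced (\<sigma> v)) \<and>
    (\<forall>v\<in>sphere_V. 0 < norm (grad v) \<longrightarrow> \<sigma> v \<noteq> v) \<and>
    ((\<forall>u. J (- u) = J u) \<longrightarrow> (\<forall>v\<in>sphere_V. \<sigma> (- v) = - \<sigma> v))"
proof -
  obtain k' where k': "0 < k'" "\<And>u. u \<in> nehari J W \<Longrightarrow> k' \<le> norm (pr u)"
    using norm_pr_nehari_ge by blast
  define k where "k = k' / 2"
  have k: "0 < k" "\<And>u. u \<in> nehari J W \<Longrightarrow> 2 * k \<le> norm (pr u)" using k' by (auto simp: k_def)
  \<comment> \<open>Steps shorter than \<open>1 / 2\<close> stay away from the origin, so that they can be normalized.\<close>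
  define h' where "h' = min (h / 2) (1 / 2)"
  have h': "0 < h'" "2 * h' \<le> h" "h' \<le> 1/2" using h by (auto simp: h'_def)
  define P where "P v s \<longleftrightarrow> s * norm (grad v) \<le> h' \<and>
    k * s * (norm (grad v))\<^sup>2 \<le> reduced v - reduced (v - s *\<^sub>R grad v)" for v s
  define \<tau> where "\<tau> v = uniform_radius P sphere_V v / 2" for v
  have \<tau>0: "0 \<le> \<tau> v" for v unfolding \<tau>_def using uniform_radius_nonneg[of P sphere_V v] by simp
  have \<tau>pos: "0 < \<tau> v" if v: "v \<in> sphere_V" "grad v \<noteq> 0" for v
  proof -
    obtain \<rho> where \<rho>: "0 < \<rho>"
      "\<And>w s. w \<in> sphere_V \<Longrightarrow> dist v w < \<rho> \<Longrightarrow> 0 < s \<Longrightarrow> s \<le> \<rho> \<Longrightarrow> P w s"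
      using local_descent[OF k h'(1) v] unfolding P_def by blast
    have "min \<rho> 1 \<le> uniform_radius P sphere_V v" by (rule uniform_radius_ge) (use \<rho> in auto)
    then show ?thesis using \<rho>(1) unfolding \<tau>_def by (simp add: min_def split: if_splits)
  qed
  have P\<tau>: "P v (\<tau> v)" if v: "v \<in> sphere_V" for v
  proof (cases "\<tau> v = 0")
    case True
    then show ?thesis using h' by (simp add: P_def)
  next
    case False
    then have "\<tau> v < uniform_radius P sphere_V v" "0 < \<tau> v" using \<tau>0[of v] by (auto simp: \<tau>_def)
    then show ?thesis using uniform_radius_lessD[of "\<tau> v" P sphere_V v] v by (metis dist_self less_imp_le less_trans)
  qed
  have cont\<tau>: "continuous_on A \<tau>" for A
  proof -
    have "continuous_on A (uniform_radius P sphere_V)"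
      by (rule lipschitz_on_continuous_on[of 1])
        (use uniform_radius_lipschitz[of P sphere_V] in \<open>auto simp: lipschitz_on_def dist_real_def\<close>)
    then show ?thesis unfolding \<tau>_def by (intro continuous_intros) auto
  qed
  define x where "x v = v - \<tau> v *\<^sub>R grad v" for v
  define \<sigma> where "\<sigma> v = (1 / norm (x v)) *\<^sub>R x v" for v
  have gV: "grad v \<in> V" for v unfolding grad_def by (rule riesz)
  have xV: "x v \<in> V" if "v \<in> sphere_V" for v
    unfolding x_def using sphere_VD[OF that] gV by (intro subspace_diff subspace_scale subspace_V) auto
  have xv: "norm (x v - v) = \<tau> v * norm (grad v)" for v unfolding x_def using \<tau>0[of v] by simp
  have xn: "\<bar>norm (x v) - 1\<bar> \<le> \<tau> v * norm (grad v)" if "v \<in> sphere_V" for v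
    using norm_triangle_ineq3[of "x v" v] xv[of v] sphere_VD[OF that] by simp
  have small: "\<tau> v * norm (grad v) \<le> h'" if "v \<in> sphere_V" for v using P\<tau>[OF that] by (simp add: P_def)
  have x0: "x v \<noteq> 0" if "v \<in> sphere_V" for v
    using xn[OF that] small[OF that] h' by auto
  have d: "dist (\<sigma> v) v \<le> 2 * (\<tau> v * norm (grad v))" if v: "v \<in> sphere_V" for v
  proof -
    have "\<sigma> v - x v = (1 / norm (x v) - 1) *\<^sub>R x v" by (simp add: \<sigma>_def algebra_simps)
    then have "norm (\<sigma> v - x v) = \<bar>(1 / norm (x v) - 1) * norm (x v)\<bar>" by (simp add: abs_mult)
    also have "(1 / norm (x v) - 1) * norm (x v) = 1 - norm (x v)" using x0[OF v] by (simp add: field_simps)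
    finally have "norm (\<sigma> v - x v) = \<bar>norm (x v) - 1\<bar>" by simp
    then show ?thesis
      using xn[OF v] xv[of v] norm_triangle_ineq[of "\<sigma> v - x v" "x v - v"] by (simp add: dist_norm)
  qed
  have red: "reduced (\<sigma> v) = reduced (x v)" if v: "v \<in> sphere_V" for v
    unfolding reduced_def \<sigma>_def using fibre_point_cong[OF xV[OF v] x0[OF v]] x0[OF v] by simp
  have drop: "k * \<tau> v * (norm (grad v))\<^sup>2 \<le> reduced v - reduced (\<sigma> v)" if v: "v \<in> sphere_V" for v
    using P\<tau>[OF v] red[OF v] by (simp add: P_def x_def)
  show ?thesis
  proof (intro exI[of _ \<sigma>] exI[of _ "k / 2"] conjI ballI impI)
    show "0 < k / 2" using k by simp
    fix v assume v: "v \<in> sphere_V"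
    show "\<sigma> v \<in> sphere_V"
      unfolding sphere_V_def \<sigma>_def using x0[OF v] subspace_scale[OF subspace_V xV[OF v]] by simp
    show "dist (\<sigma> v) v \<le> h" using d[OF v] small[OF v] h' by linarith
    have "k / 2 * norm (grad v) * dist (\<sigma> v) v \<le> k / 2 * norm (grad v) * (2 * (\<tau> v * norm (grad v)))"
      using d[OF v] k by (intro mult_left_mono) auto
    also have "\<dots> = k * \<tau> v * (norm (grad v))\<^sup>2" by (simp add: power2_eq_square)
    finally show "k / 2 * norm (grad v) * dist (\<sigma> v) v \<le> reduced v - reduced (\<sigma> v)" using drop[OF v] by linarith
    show "\<sigma> v \<noteq> v" if "0 < norm (grad v)"
    proof
      assume "\<sigma> v = v"
      then have "k * \<tau> v * (norm (grad v))\<^sup>2 \<le> 0" using drop[OF v] by simp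
      moreover have "0 < k * \<tau> v * (norm (grad v))\<^sup>2" using k \<tau>pos[OF v] that by simp
      ultimately show False by linarith
    qed
  next
    have "continuous_on sphere_V x"
      unfolding x_def
      by (intro continuous_intros cont\<tau> continuous_on_subset[OF continuous_on_grad sphere_V_subset])
    then show "continuous_on sphere_V \<sigma>"
      unfolding \<sigma>_def using x0 by (intro continuous_intros) auto
  next
    fix v assume "\<forall>u. J (- u) = J u" and v: "v \<in> sphere_V"
    then have even: "J (- u) = J u" for u by blast
    have Peq: "P (- w) s" if w: "w \<in> sphere_V" and P: "P w s" for w s
    proof (cases "w - s *\<^sub>R grad w = 0")
      case True
      then show ?thesis
        using P sphere_VD[OF w] even_grad[OF even, of w] even_reduced[OF even, of w]
        by (simp add: P_def)
    next
      case False
      have "w - s *\<^sub>R grad w \<in> V" using sphere_VD[OF w] gV by (intro subspace_diff subspace_scale subspace_V) auto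
      from even_reduced[OF even this False]
      show ?thesis
        using P sphere_VD[OF w] even_grad[OF even, of w] even_reduced[OF even, of w] by (simp add: P_def)
    qed
    have "\<tau> (- v) = \<tau> v"
      unfolding \<tau>_def using uniform_radius_uminus[of sphere_V P v] uminus_sphere_V Peq by simp
    then have "x (- v) = - x v" using even_grad[OF even, of v] sphere_VD[OF v] by (simp add: x_def)
    then show "\<sigma> (- v) = - \<sigma> v" by (simp add: \<sigma>_def)
  qed
qed

end

section \<open>Palais-Smale sequences and weak limits\<close>

lemma coercive_on_bounded:
  assumes "coercive_on N J" "\<And>n. u n \<in> N" "\<And>n. J (u n) \<le> K"
  shows "bounded (range u)"
proof -
  have "\<forall>\<^sub>F x in inf at_infinity (principal N). K < J x"
    using assms(1) unfolding coercive_on_def filterlim_at_top_dense by blast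
  then obtain R where R: "\<And>x. R \<le> norm x \<Longrightarrow> x \<in> N \<Longrightarrow> K < J x"
    unfolding eventually_inf_principal eventually_at_infinity by blast
  have "norm (u n) \<le> R" for n
    using R[of "u n"] assms(2,3)[of n] by (meson linear not_le)
  then show ?thesis unfolding bounded_iff by blast
qed

lemma convergent_real_upper_bound:
  fixes f :: "nat \<Rightarrow> real"
  assumes "f \<longlonglongrightarrow> l"
  obtains K where "\<And>n. f n \<le> K"
  using convergent_imp_Bseq[OF convergentI[OF assms]] unfolding Bseq_def
  by (metis abs_le_D1 real_norm_def)

text \<open>The point \<open>s *\<^sub>R pr u\<close> lies in the half space of \<open>u\<close>, so \<open>J\<close> is at most \<open>J u\<close> there; as its quadratic
  part is \<open>s\<^sup>2\<close> times that of \<open>u\<close>, \<open>I\<close> has to compensate for it. So sequences in the Nehari set satisfy the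
  hypothesis of \<open>superquadratic_away_from_zero\<close>.\<close>

lemma (in nehari_setting) superquadratic_hypothesis_on_nehari:
  obtains a where "0 < a" "\<And>u s. u \<in> nehari J W \<Longrightarrow> 1 < s \<Longrightarrow> (s\<^sup>2 - 1) * a \<le> I (s *\<^sub>R pr u)"
proof -
  obtain a where a: "0 < a" "\<And>u. u \<in> nehari J W \<Longrightarrow> a \<le> J u" using nehari_level_positive by blast
  have "(s\<^sup>2 - 1) * a \<le> I (s *\<^sub>R pr u)" if u: "u \<in> nehari J W" and s: "1 < s" for u s
  proof -
    have "J (s *\<^sub>R pr u + 0) \<le> J u"
      by (rule nehari_scaled_component_le[OF u]) (use s subspace_0[OF subspace_W] in auto)
    then have "J (s *\<^sub>R pr u) \<le> 1/2 * (norm (pr u))\<^sup>2" using J_le[of u] by simp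
    moreover have "pr (s *\<^sub>R pr u) = s *\<^sub>R pr u" by (rule pr_V[OF subspace_scale[OF subspace_V pr_in]])
    ultimately have "(s\<^sup>2 - 1) * (1/2 * (norm (pr u))\<^sup>2) \<le> I (s *\<^sub>R pr u)"
      using J_eq[of "s *\<^sub>R pr u"] by (simp add: power_mult_distrib algebra_simps)
    moreover have "(s\<^sup>2 - 1) * a \<le> (s\<^sup>2 - 1) * (1/2 * (norm (pr u))\<^sup>2)"
      using a(2)[OF u] J_le[of u] s by (intro mult_left_mono) (auto simp: one_le_power)
    ultimately show ?thesis by linarith
  qed
  then show ?thesis using that a(1) by blast
qed

locale nehari_pair = nehari_hilbert V W J I ip + cp: nehari_setting H Z Jcp Icp
  for V W H Z :: "'a::banach set" and J I Jcp Icp :: "'a \<Rightarrow> real" and ip :: "'a \<Rightarrow> 'a \<Rightarrow> real" +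
  assumes V_subset: "V \<subseteq> H" and Z_subset: "Z \<subseteq> W"
    and coercive_cp: "coercive_on (nehari Jcp Z) Jcp"
    and close: "compactly_close J Jcp H Z"
    and superq: "superquadratic_away_from_zero I V W"
begin

text \<open>If the \<open>V\<close>-component of the limit vanished, the components \<open>v\<^sub>n\<close> of \<open>u\<^sub>n\<close> would tend weakly to zero.
  The points \<open>w\<^sub>n = t\<^sub>n v\<^sub>n + y\<^sub>n\<close> of the Nehari set of \<open>Jcp\<close> over \<open>v\<^sub>n\<close> satisfy
  \<open>J w\<^sub>n \<le> J u\<^sub>n\<close>, because \<open>u\<^sub>n\<close> maximizes \<open>J\<close> over its half space, which contains \<open>w\<^sub>n\<close>. Their factors \<open>t\<^sub>n\<close> are
  bounded: otherwise \<open>I w\<^sub>n\<close> would outgrow \<open>t\<^sub>n\<^sup>2\<close>, against the quadratic bound for \<open>Jcp - J\<close> and the positivity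
  of \<open>Jcp\<close>. Then coercivity bounds \<open>w\<^sub>n\<close>, so \<open>Jcp\<close> and \<open>J\<close> agree along them in the limit, and the limit level is
  at least the infimum of \<open>Jcp\<close>.\<close>

lemma weak_limit_component_nonzero:
  assumes u: "\<And>n. u n \<in> nehari J W" and bdd: "bounded (range u)"
    and lim: "(\<lambda>n. J (u n)) \<longlonglongrightarrow> \<beta>" and \<beta>: "ereal \<beta> < nehari_level Jcp Z"
    and weak: "weakly_converges u l"
  shows "pr l \<noteq> 0"
proof
  assume "pr l = 0"
  define v where "v n = pr (u n)" for n
  have v_weak: "weakly_converges v 0"
    using weakly_converges_bounded_linear[OF bounded_linear_pr weak] \<open>pr l = 0\<close> unfolding v_def by simp
  have v: "v n \<in> V" "v n \<in> H" "v n \<noteq> 0" for n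
    using u[of n] pr_in V_subset pr_eq_0_iff nehari_iff[OF subspace_W] by (auto simp: v_def)
  obtain B where B: "\<And>n. norm (v n) \<le> B"
  proof -
    obtain B where "\<And>n. norm (u n) \<le> B" using bdd unfolding bounded_iff by auto
    then have "norm (v n) \<le> B" for n unfolding v_def using norm_pr_le order_trans by blast
    then show ?thesis using that by blast
  qed
  define w where "w n = cp.fibre_point (v n)" for n
  define t where "t n = cp.fibre_scale (v n)" for n
  define y where "y n = w n - cp.pr (w n)" for n
  have w: "w n \<in> nehari Jcp Z" "cp.pr (w n) = t n *\<^sub>R v n" "0 < t n" for n
    unfolding w_def t_def using cp.fibre_point(1)[OF v(2,3)] cp.fibre_scale[OF v(2,3)] by auto
  have y: "y n \<in> Z" "w n = t n *\<^sub>R v n + y n" for n unfolding y_def using cp.rest_in[of "w n"] w(2)[of n] by auto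
  then have yW: "y n \<in> W" for n using Z_subset by blast
  have Jw: "J (w n) \<le> J (u n)" for n
    unfolding y(2) v_def by (rule nehari_scaled_component_le[OF u]) (use w(3) yW less_imp_le in auto)
  have prw: "pr (w n) = t n *\<^sub>R v n" for n
    unfolding y(2) by (rule pr_sum[OF subspace_scale[OF subspace_V v(1)] yW])
  obtain M where M: "0 < M" "\<And>x. x \<in> nehari Jcp Z \<Longrightarrow> Jcp x - J x \<le> M * (norm (cp.pr x))\<^sup>2"
    using close unfolding compactly_close_def by blast
  obtain a' where a': "0 < a'" "\<And>x. x \<in> nehari Jcp Z \<Longrightarrow> a' \<le> Jcp x" using cp.nehari_level_positive by blast
  have diff: "Jcp (w n) - J (w n) \<le> M * (t n)\<^sup>2 * B\<^sup>2" for n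
  proof -
    have "(norm (cp.pr (w n)))\<^sup>2 = (t n)\<^sup>2 * (norm (v n))\<^sup>2" unfolding w(2) by (simp add: power_mult_distrib)
    also have "\<dots> \<le> (t n)\<^sup>2 * B\<^sup>2" using B[of n] by (intro mult_left_mono power_mono) auto
    finally have "M * (norm (cp.pr (w n)))\<^sup>2 \<le> M * ((t n)\<^sup>2 * B\<^sup>2)" using M(1) by (intro mult_left_mono) auto
    then show ?thesis using M(2)[OF w(1), of n] by (simp add: mult.assoc)
  qed
  have "bdd_above (range t)"
  proof (rule ccontr)
    assume "\<not> bdd_above (range t)"
    then obtain s where s: "strict_mono (s :: nat \<Rightarrow> nat)" "filterlim (t \<circ> s) at_top sequentially"
      by (rule unbounded_imp_subseq_at_top)
    define z where "z n = v (s n) + (1 / t (s n)) *\<^sub>R y (s n)" for n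
    have prz: "pr (z n) = v (s n)" for n
      unfolding z_def by (rule pr_sum[OF v(1) subspace_scale[OF subspace_W yW]])
    have tz: "t (s n) *\<^sub>R z n = w (s n)" for n
      unfolding z_def y(2) using w(3)[of "s n"] by (simp add: algebra_simps)
    obtain a where a: "0 < a" "\<And>u s. u \<in> nehari J W \<Longrightarrow> 1 < s \<Longrightarrow> (s\<^sup>2 - 1) * a \<le> I (s *\<^sub>R pr u)"
      using superquadratic_hypothesis_on_nehari by blast
    have "\<exists>\<delta>>0. \<forall>n. \<delta> \<le> \<bar>I (c *\<^sub>R pr (z n))\<bar>" if c: "1 < c" for c
    proof (intro exI conjI allI)
      have "1 < c\<^sup>2" using one_less_power[OF c, of 2] by simp
      then show "0 < (c\<^sup>2 - 1) * a" using a(1) by simp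
      show "(c\<^sup>2 - 1) * a \<le> \<bar>I (c *\<^sub>R pr (z n))\<bar>" for n
        using a(2)[OF u c, of "s n"] unfolding prz v_def by linarith
    qed
    then have "filterlim (\<lambda>n. I ((t \<circ> s) n *\<^sub>R z n) / ((t \<circ> s) n)\<^sup>2) at_top sequentially"
      using superq s(2) unfolding superquadratic_away_from_zero_def by blast
    then have "\<forall>\<^sub>F n in sequentially. (1 + M) * B\<^sup>2 < I (w (s n)) / (t (s n))\<^sup>2"
      unfolding filterlim_at_top_dense o_def tz by blast
    then obtain n where n: "(1 + M) * B\<^sup>2 < I (w (s n)) / (t (s n))\<^sup>2"
      using eventually_happens trivial_limit_sequentially by blast
    let ?t = "t (s n)"
    define X where "X = ?t\<^sup>2 * B\<^sup>2"
    have "X + M * X < I (w (s n))" using n w(3)[of "s n"] by (simp add: X_def field_simps)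
    moreover have "I (w (s n)) \<le> 1/2 * X + M * X"
    proof -
      have "(norm (pr (w (s n))))\<^sup>2 = ?t\<^sup>2 * (norm (v (s n)))\<^sup>2" unfolding prw by (simp add: power_mult_distrib)
      also have "\<dots> \<le> ?t\<^sup>2 * B\<^sup>2" using B[of "s n"] by (intro mult_left_mono power_mono) auto
      finally have "(norm (pr (w (s n))))\<^sup>2 \<le> X" unfolding X_def .
      moreover have "Jcp (w (s n)) - J (w (s n)) \<le> M * X" using diff[of "s n"] by (simp add: X_def mult.assoc)
      ultimately show ?thesis using J_eq[of "w (s n)"] a'(2)[OF w(1), of "s n"] a'(1) by linarith
    qed
    moreover have "0 \<le> X" by (simp add: X_def)
    ultimately show False by linarith
  qed
  then obtain T where T: "\<And>n. t n \<le> T" unfolding bdd_above_def by auto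
  have tb: "\<bar>t n\<bar> \<le> T" for n using T[of n] w(3)[of n] by simp
  have comp_weak: "weakly_converges (\<lambda>n. cp.pr (w n)) 0"
    unfolding weakly_converges_def
  proof
    fix f :: "'a \<Rightarrow>\<^sub>L real"
    have fv: "(\<lambda>n. f (v n)) \<longlonglongrightarrow> 0" using v_weak unfolding weakly_converges_def by (metis blinfun.zero_right)
    have "(\<lambda>n. T * \<bar>f (v n)\<bar>) \<longlonglongrightarrow> T * \<bar>0\<bar>" by (intro tendsto_intros fv)
    then have T0: "(\<lambda>n. T * \<bar>f (v n)\<bar>) \<longlonglongrightarrow> 0" by simp
    have "norm (f (cp.pr (w n))) \<le> T * \<bar>f (v n)\<bar>" for n
      unfolding w(2) using tb[of n] by (simp add: blinfun.scaleR_right abs_mult mult_right_mono)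
    then have "(\<lambda>n. f (cp.pr (w n))) \<longlonglongrightarrow> 0"
      by (intro Lim_null_comparison[OF always_eventually T0] allI)
    then show "(\<lambda>n. f (cp.pr (w n))) \<longlonglongrightarrow> f 0" by (simp add: blinfun.zero_right)
  qed
  obtain K where K: "\<And>n. J (u n) \<le> K" using convergent_real_upper_bound[OF lim] by blast
  have "Jcp (w n) \<le> K + M * T\<^sup>2 * B\<^sup>2" for n
  proof -
    have "(t n)\<^sup>2 \<le> T\<^sup>2" using tb[of n] by (simp add: abs_le_square_iff[symmetric])
    then have "M * (t n)\<^sup>2 * B\<^sup>2 \<le> M * T\<^sup>2 * B\<^sup>2" using M(1) by (intro mult_right_mono mult_left_mono) auto
    then show ?thesis using diff[of n] Jw[of n] K[of n] by linarith
  qed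
  then have "bounded (range w)" by (rule coercive_on_bounded[where N = "nehari Jcp Z", OF coercive_cp w(1)])
  then have "(\<lambda>n. Jcp (w n) - J (w n)) \<longlonglongrightarrow> 0"
    using close w(1) comp_weak unfolding compactly_close_def by blast
  then have lim': "(\<lambda>n. (Jcp (w n) - J (w n)) + J (u n)) \<longlonglongrightarrow> 0 + \<beta>" by (intro tendsto_intros lim)
  obtain d where d: "\<beta> < d" "ereal d < nehari_level Jcp Z"
    using ereal_dense2[OF \<beta>] by auto
  have "d \<le> (Jcp (w n) - J (w n)) + J (u n)" for n
  proof -
    have "nehari_level Jcp Z \<le> ereal (Jcp (w n))"
      unfolding nehari_level_def by (rule INF_lower[OF w(1)])
    then have "ereal d \<le> ereal (Jcp (w n))" using d(2) by (meson less_imp_le order_trans)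
    then show ?thesis using Jw[of n] by simp
  qed
  then have "d \<le> 0 + \<beta>" by (intro LIMSEQ_le_const[OF lim']) auto
  then show False using d(1) by simp
qed

lemma nehari_sequence_weak_limit:
  assumes coercive: "coercive_on (nehari J W) J"
    and u: "\<And>n. u n \<in> nehari J W" and lim: "(\<lambda>n. J (u n)) \<longlonglongrightarrow> \<beta>"
    and \<beta>: "ereal \<beta> < nehari_level Jcp Z"
  obtains r l where "strict_mono (r :: nat \<Rightarrow> nat)" "weakly_converges (u \<circ> r) l" "pr l \<noteq> 0"
proof -
  obtain K where "\<And>n. J (u n) \<le> K" using convergent_real_upper_bound[OF lim] by blast
  then have bdd: "bounded (range u)" by (rule coercive_on_bounded[where N = "nehari J W", OF coercive u])
  then obtain r l where r: "strict_mono (r :: nat \<Rightarrow> nat)" "weakly_converges (u \<circ> r) l"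
    using reflexive_bounded_weakly_convergent_subseq[OF refl] by blast
  have "pr l \<noteq> 0"
  proof (rule weak_limit_component_nonzero[OF _ _ _ \<beta> r(2)])
    show "(u \<circ> r) n \<in> nehari J W" for n using u by simp
    show "bounded (range (u \<circ> r))" by (rule bounded_subset[OF bdd]) auto
    show "(\<lambda>n. J ((u \<circ> r) n)) \<longlonglongrightarrow> \<beta>" using LIMSEQ_subseq_LIMSEQ[OF lim r(1)] by (simp add: o_def)
  qed
  then show ?thesis using that r by blast
qed

end

section \<open>Ground states\<close>

context nehari_hilbert
begin

lemma normalized_component:
  assumes u: "u \<in> nehari J W"
  shows "(1 / norm (pr u)) *\<^sub>R pr u \<in> sphere_V" "fibre_point ((1 / norm (pr u)) *\<^sub>R pr u) = u"
proof -
  have ne: "pr u \<noteq> 0" using u pr_eq_0_iff nehari_iff[OF subspace_W] by auto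
  then show "(1 / norm (pr u)) *\<^sub>R pr u \<in> sphere_V"
    unfolding sphere_V_def using subspace_scale[OF subspace_V pr_in] by simp
  then show "fibre_point ((1 / norm (pr u)) *\<^sub>R pr u) = u"
    using ne sphere_VD by (intro fibre_point_eqI[OF u, of "norm (pr u)"]) auto
qed

lemma sphere_V_eq_normalized:
  assumes "v \<in> sphere_V"
  shows "v = (1 / norm (pr (fibre_point v))) *\<^sub>R pr (fibre_point v)"
proof -
  note v = sphere_VD[OF assms]
  have "0 < fibre_scale v" "pr (fibre_point v) = fibre_scale v *\<^sub>R v" using fibre_scale v by auto
  then show ?thesis using v by simp
qed

lemma reduced_lower_bound:
  obtains a where "0 < a" "\<And>v. v \<in> sphere_V \<Longrightarrow> a \<le> reduced v"
proof -
  obtain a where "0 < a" "\<And>u. u \<in> nehari J W \<Longrightarrow> a \<le> J u" using nehari_level_positive by blast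
  then show ?thesis using that fibre_point(1) sphere_VD unfolding reduced_def by blast
qed

text \<open>The orbit of an almost minimal direction only lowers the level and reaches arbitrarily small
  gradients.\<close>

lemma minimizing_PS_sequence:
  assumes c: "nehari_level J W = ereal c"
  obtains u where "PS_sequence_in (nehari J W) J c u"
proof -
  obtain \<sigma> k where k: "0 < (k :: real)" and \<sigma>: "\<And>v. v \<in> sphere_V \<Longrightarrow> \<sigma> v \<in> sphere_V"
    "continuous_on sphere_V \<sigma>"
    "\<And>v. v \<in> sphere_V \<Longrightarrow> k * norm (grad v) * dist (\<sigma> v) v \<le> reduced v - reduced (\<sigma> v)"
    "\<And>v. v \<in> sphere_V \<Longrightarrow> 0 < norm (grad v) \<Longrightarrow> \<sigma> v \<noteq> v"
    using descent_map[OF zero_less_one] by blast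
  obtain a where a: "\<And>v. v \<in> sphere_V \<Longrightarrow> a \<le> reduced v" using reduced_lower_bound by blast
  have orbit: "(\<sigma> ^^ m) v \<in> sphere_V \<and> reduced ((\<sigma> ^^ m) v) \<le> reduced v" if v: "v \<in> sphere_V" for v m
  proof (induction m)
    case (Suc m)
    have "0 \<le> k * norm (grad ((\<sigma> ^^ m) v)) * dist (\<sigma> ((\<sigma> ^^ m) v)) ((\<sigma> ^^ m) v)" using k by simp
    then show ?case using Suc \<sigma>(1) \<sigma>(3)[of "(\<sigma> ^^ m) v"] by auto
  qed (use v in auto)
  have "\<exists>x\<in>sphere_V. reduced x < c + 1 / real (Suc n) \<and> norm (grad x) < 1 / real (Suc n)" for n
  proof -
    have "(INF u \<in> nehari J W. ereal (J u)) < ereal (c + 1 / real (Suc n))"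
      using c unfolding nehari_level_def by simp
    then obtain u where u: "u \<in> nehari J W" "J u < c + 1 / real (Suc n)"
      unfolding INF_less_iff by auto
    define v where "v = (1 / norm (pr u)) *\<^sub>R pr u"
    have v: "v \<in> sphere_V" "reduced v < c + 1 / real (Suc n)"
      using normalized_component[OF u(1)] u(2) by (auto simp: v_def reduced_def)
    have "\<exists>m. norm (grad ((\<sigma> ^^ m) v)) < 1 / real (Suc n)"
      by (rule descent_orbit[where S = sphere_V and G = "\<lambda>v. norm (grad v)" and \<Psi> = reduced and b = a and k = k])
        (use closed_sphere_V \<sigma> k a v(1) in \<open>auto intro!: continuous_on_norm continuous_on_subset[OF continuous_on_grad sphere_V_subset]\<close>)
    then show ?thesis using orbit[OF v(1)] v(2) by (meson le_less_trans)
  qed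
  then obtain x where x: "\<And>n. x n \<in> sphere_V" "\<And>n. reduced (x n) < c + 1 / real (Suc n)"
    "\<And>n. norm (grad (x n)) < 1 / real (Suc n)" by metis
  have xN: "fibre_point (x n) \<in> nehari J W" for n using fibre_point(1) sphere_VD[OF x(1)] by blast
  have inv: "(\<lambda>n. 1 / real (Suc n)) \<longlonglongrightarrow> 0" by (rule LIMSEQ_Suc[OF lim_1_over_n])
  have "(\<lambda>n. dual_deriv J (fibre_point (x n))) \<longlonglongrightarrow> 0"
  proof (rule Lim_null_comparison[OF always_eventually inv])
    show "\<forall>n. norm (dual_deriv J (fibre_point (x n))) \<le> 1 / real (Suc n)"
      using norm_dual_deriv_le_grad sphere_VD[OF x(1)] less_imp_le[OF x(3)] order_trans by blast
  qed
  moreover have "(\<lambda>n. J (fibre_point (x n))) \<longlonglongrightarrow> c"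
  proof (rule tendsto_sandwich[OF _ _ tendsto_const])
    have "ereal c \<le> ereal (J (fibre_point (x n)))" for n
      unfolding c[symmetric] nehari_level_def by (rule INF_lower[OF xN])
    then show "\<forall>\<^sub>F n in sequentially. c \<le> J (fibre_point (x n))" by simp
    show "\<forall>\<^sub>F n in sequentially. J (fibre_point (x n)) \<le> c + 1 / real (Suc n)"
      using less_imp_le[OF x(2)] by (simp only: reduced_def eventually_True)
    show "(\<lambda>n. c + 1 / real (Suc n)) \<longlonglongrightarrow> c" using tendsto_add[OF tendsto_const inv, of c] by simp
  qed
  ultimately show ?thesis using that[of "\<lambda>n. fibre_point (x n)"] xN unfolding PS_sequence_in_def by blast
qed

end

text \<open>The weak limit of a minimizing Palais-Smale sequence is critical. There may be nonzero critical points in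
  \<open>W\<close>, but the limit is not one of them, because its \<open>V\<close>-component is nonzero; so it lies in the Nehari set, where
  \<open>J\<close> is weakly lower semicontinuous.
\<close>

theorem (in nehari_pair) ground_state_exists:
  assumes coercive: "coercive_on (nehari J W) J"
    and C3: "weakly_continuous_on_nehari J W"
    and level: "nehari_level J W < nehari_level Jcp Z"
  shows "\<exists>u\<in>nehari J W. ereal (J u) = nehari_level J W \<and> dual_deriv J u = 0"
proof -
  obtain a where a: "\<And>u. u \<in> nehari J W \<Longrightarrow> a \<le> J u" using nehari_level_positive by blast
  have "ereal a \<le> nehari_level J W"
    unfolding nehari_level_def by (rule INF_greatest) (use a in auto)
  then obtain c where c: "nehari_level J W = ereal c"
    using level by (cases "nehari_level J W") auto
  obtain u where "PS_sequence_in (nehari J W) J c u" using minimizing_PS_sequence[OF c] by blast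
  then have u: "\<And>n. u n \<in> nehari J W" "(\<lambda>n. dual_deriv J (u n)) \<longlonglongrightarrow> 0" "(\<lambda>n. J (u n)) \<longlonglongrightarrow> c"
    unfolding PS_sequence_in_def by auto
  obtain r l where r: "strict_mono (r :: nat \<Rightarrow> nat)" "weakly_converges (u \<circ> r) l" and l: "pr l \<noteq> 0"
    using nehari_sequence_weak_limit[OF coercive u(1,3)] level c by metis
  have ur: "\<And>n. (u \<circ> r) n \<in> nehari J W" using u(1) by simp
  have "dual_deriv J l = 0"
  proof (rule blinfun_eqI)
    fix z
    have "(\<lambda>n. dual_deriv J ((u \<circ> r) n) z) \<longlonglongrightarrow> dual_deriv J l z"
      using C3 ur r(2) unfolding weakly_continuous_on_nehari_def weakly_star_converges_def by blast
    moreover have "(\<lambda>n. dual_deriv J ((u \<circ> r) n) z) \<longlonglongrightarrow> (0 :: 'a \<Rightarrow>\<^sub>L real) z"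
      using LIMSEQ_subseq_LIMSEQ[OF u(2) r(1)] by (intro blinfun.tendsto tendsto_const) (simp add: o_def)
    ultimately show "dual_deriv J l z = (0 :: 'a \<Rightarrow>\<^sub>L real) z" by (rule LIMSEQ_unique)
  qed
  moreover have lN: "l \<in> nehari J W"
    using l pr_eq_0_iff[of l] \<open>dual_deriv J l = 0\<close> by (simp add: nehari_iff[OF subspace_W])
  moreover have "ereal (J l) = nehari_level J W"
  proof (rule antisym)
    have "ereal (J l) \<le> liminf (\<lambda>n. ereal (J ((u \<circ> r) n)))"
      using C3 ur r(2) lN unfolding weakly_continuous_on_nehari_def by blast
    also have "(\<lambda>n. ereal (J ((u \<circ> r) n))) \<longlonglongrightarrow> ereal c"
      using LIMSEQ_subseq_LIMSEQ[OF u(3) r(1)] by (simp add: o_def)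
    then have "liminf (\<lambda>n. ereal (J ((u \<circ> r) n))) = ereal c"
      by (intro lim_imp_Liminf) auto
    finally show "ereal (J l) \<le> nehari_level J W" using c by simp
    show "nehari_level J W \<le> ereal (J l)" unfolding nehari_level_def by (rule INF_lower[OF lN])
  qed
  ultimately show ?thesis by blast
qed

section \<open>Genus\<close>

lemma genus_le_odd_map:
  assumes \<nu>: "continuous_on B \<nu>" "\<nu> ` B \<subseteq> A" "\<And>x. x \<in> B \<Longrightarrow> \<nu> (- x) = - \<nu> x"
  shows "genus B \<le> genus A"
  unfolding genus_def
proof (rule Inf_superset_mono, clarify)
  fix k and f :: "'b \<Rightarrow> nat \<Rightarrow> real"
  assume f: "\<forall>i<k. continuous_on A (\<lambda>x. f x i)" "\<forall>x\<in>A. \<forall>i<k. f (- x) i = - f x i"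
    "\<forall>x\<in>A. \<exists>i<k. f x i \<noteq> 0"
  show "\<exists>k'. enat k = enat k' \<and> (\<exists>f :: 'a \<Rightarrow> nat \<Rightarrow> real. (\<forall>i<k'. continuous_on B (\<lambda>x. f x i)) \<and>
      (\<forall>x\<in>B. \<forall>i<k'. f (- x) i = - f x i) \<and> (\<forall>x\<in>B. \<exists>i<k'. f x i \<noteq> 0))"
  proof (intro exI[of _ k] conjI exI[of _ "\<lambda>x. f (\<nu> x)"])
    show "\<forall>i<k. continuous_on B (\<lambda>x. f (\<nu> x) i)"
      using f(1) \<nu>(1,2) continuous_on_compose2 by blast
  qed (use f(2,3) \<nu>(2,3) in auto)
qed

lemma infdist_uminus:
  fixes x :: "'a::real_normed_vector"
  shows "infdist (- x) (uminus ` A) = infdist x A"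
proof -
  have "dist (- x) ` uminus ` A = dist x ` A"
    unfolding image_image dist_minus ..
  then show ?thesis unfolding infdist_def by simp
qed

text \<open>A set which is disjoint from its mirror image carries the odd function that compares the
  distances to the complements of the two.\<close>

lemma genus_le_paired_cover:
  fixes A :: "'a::real_normed_vector set"
  assumes sym: "uminus ` A = A"
    and U: "\<And>i. i < k \<Longrightarrow> U i \<subseteq> A" "\<And>i. i < k \<Longrightarrow> U i \<inter> uminus ` U i = {}"
    and op: "\<And>i x. i < k \<Longrightarrow> x \<in> U i \<Longrightarrow> \<exists>e>0. \<forall>y\<in>A. dist y x < e \<longrightarrow> y \<in> U i"
    and cover: "\<And>x. x \<in> A \<Longrightarrow> \<exists>i<k. x \<in> U i \<or> - x \<in> U i"
  shows "genus A \<le> enat k"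
proof -
  define f where "f x i = infdist x (A - U i) - infdist x (A - uminus ` U i)" for x i
  have mirror: "uminus ` (A - U i) = A - uminus ` U i" "uminus ` (A - uminus ` U i) = A - U i" for i
    using sym by (auto simp: image_set_diff[OF inj_uminus] image_image)
  have odd: "f (- x) i = - f x i" for x i
    using infdist_uminus[of x "A - U i"] infdist_uminus[of x "A - uminus ` U i"]
    unfolding f_def mirror by simp
  have pos: "0 < f x i" if i: "i < k" and x: "x \<in> U i" for x i
  proof -
    have xA: "x \<in> A" "- x \<in> A" using U(1)[OF i] x sym by auto
    have "- x \<notin> U i" using U(2)[OF i] x by force
    then have ne: "A - U i \<noteq> {}" using xA by blast
    obtain e where e: "0 < e" "\<forall>y\<in>A. dist y x < e \<longrightarrow> y \<in> U i" using op[OF i x] by blast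
    have "x \<notin> closure (A - U i)" unfolding closure_approachable using e by blast
    then have "infdist x (A - U i) \<noteq> 0" using in_closure_iff_infdist_zero[OF ne] by blast
    then have "0 < infdist x (A - U i)" using infdist_nonneg[of x "A - U i"] by linarith
    moreover have "x \<in> A - uminus ` U i" using xA U(2)[OF i] x by blast
    then have "infdist x (A - uminus ` U i) = 0" by simp
    ultimately show ?thesis by (simp add: f_def)
  qed
  have "\<exists>i<k. f x i \<noteq> 0" if x: "x \<in> A" for x
  proof -
    obtain i where i: "i < k" "x \<in> U i \<or> - x \<in> U i" using cover[OF x] by blast
    then have "0 < f x i \<or> 0 < f (- x) i" using pos by blast
    then show ?thesis using i(1) odd[of x i] by force
  qed
  moreover have "continuous_on A (\<lambda>x. f x i)" for i
    unfolding f_def by (intro continuous_intros)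
  ultimately show ?thesis
    unfolding genus_def using odd by (intro Inf_lower) (auto intro!: exI[of _ f])
qed

section \<open>Multiplicity of critical points\<close>

text \<open>Where \<open>G\<close> is bounded below, an orbit pays for its length with a drop of \<open>\<Psi>\<close>; since steps are too short
  to jump over the annulus between the radii \<open>r / 2\<close> and \<open>r\<close>, leaving the larger ball costs a definite
  amount.\<close>

lemma descent_orbit_trapped:
  fixes \<sigma> :: "'a::metric_space \<Rightarrow> 'a" and \<Psi> G :: "'a \<Rightarrow> real"
  assumes A: "\<And>x. x \<in> A \<Longrightarrow> \<sigma> x \<in> A"
    and step: "\<And>x. x \<in> A \<Longrightarrow> k * G x * dist (\<sigma> x) x \<le> \<Psi> x - \<Psi> (\<sigma> x)"
    and short: "\<And>x. x \<in> A \<Longrightarrow> dist (\<sigma> x) x \<le> r / 4"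
    and G: "\<And>x. x \<in> A \<Longrightarrow> 0 \<le> G x"
    and annulus: "\<And>x. x \<in> A \<Longrightarrow> r / 2 \<le> dist x p \<Longrightarrow> dist x p \<le> r \<Longrightarrow> d \<le> G x"
    and pos: "0 < k" "0 < d" "0 < r"
    and x: "x \<in> A" "dist x p < r / 2"
    and drop: "\<Psi> x - \<Psi> ((\<sigma> ^^ n) x) < k * d * r / 4"
  shows "dist ((\<sigma> ^^ n) x) p < r"
proof -
  \<comment> \<open>The distance to \<open>p\<close>, clipped so that it is constant within the reach of one step from the ball of
    radius \<open>r / 2\<close>, and beyond \<open>r\<close>. Elsewhere a step changes it by at most its own length, which is paid for by
    the drop of \<open>\<Psi>\<close>. So \<open>F\<close> never increases along the orbit.\<close>
  define q where "q y = min r (max (3 * r / 4) (dist y p))" for y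
  define F where "F y = \<Psi> y + k * d * q y" for y
  have mono: "F (\<sigma> y) \<le> F y" if y: "y \<in> A" for y
  proof -
    have tri: "dist (\<sigma> y) p \<le> dist (\<sigma> y) y + dist y p" by (rule dist_triangle)
    have drop0: "\<Psi> (\<sigma> y) \<le> \<Psi> y"
      using step[OF y] G[OF y] pos(1) zero_le_dist[of "\<sigma> y" y]
      by (smt (verit) mult_nonneg_nonneg)
    have kd: "0 \<le> k * d" using pos by simp
    consider "dist y p < r / 2" | "r < dist y p" | "r / 2 \<le> dist y p" "dist y p \<le> r" by linarith
    then show ?thesis
    proof cases
      case 1
      then have "q (\<sigma> y) = q y" unfolding q_def using tri short[OF y] by (auto simp: max_def)
      then show ?thesis unfolding F_def using drop0 by simp
    next
      case 2
      then have "q (\<sigma> y) \<le> q y" unfolding q_def by auto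
      then have "k * d * q (\<sigma> y) \<le> k * d * q y" by (rule mult_left_mono[OF _ kd])
      then show ?thesis unfolding F_def using drop0 by linarith
    next
      case 3
      have "q (\<sigma> y) \<le> q y + dist (\<sigma> y) y"
        unfolding q_def using tri zero_le_dist[of "\<sigma> y" y] by linarith
      then have "k * d * q (\<sigma> y) \<le> k * d * (q y + dist (\<sigma> y) y)" by (rule mult_left_mono[OF _ kd])
      moreover have "k * d * dist (\<sigma> y) y \<le> k * G y * dist (\<sigma> y) y"
        using annulus[OF y 3] pos(1) by (intro mult_right_mono mult_left_mono) auto
      ultimately show ?thesis unfolding F_def using step[OF y] by (simp add: algebra_simps)
    qed
  qed
  have "(\<sigma> ^^ n) x \<in> A \<and> F ((\<sigma> ^^ n) x) \<le> F x" for n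
  proof (induction n)
    case (Suc n)
    then show ?case using A mono[of "(\<sigma> ^^ n) x"] by auto
  qed (use x in auto)
  then have "F ((\<sigma> ^^ n) x) \<le> F x" by blast
  moreover have "q x = 3 * r / 4" unfolding q_def using x(2) pos(3) by auto
  ultimately have le: "k * d * q ((\<sigma> ^^ n) x) \<le> k * d * (3 * r / 4) + (\<Psi> x - \<Psi> ((\<sigma> ^^ n) x))"
    unfolding F_def by simp
  show ?thesis
  proof (rule ccontr)
    assume "\<not> ?thesis"
    then have "q ((\<sigma> ^^ n) x) = r" unfolding q_def using pos(3) by auto
    then have "k * d * r \<le> k * d * (3 * r / 4) + (\<Psi> x - \<Psi> ((\<sigma> ^^ n) x))" using le by simp
    then show False using drop by (simp add: algebra_simps)
  qed
qed

lemma eventually_small: "0 < (d::real) \<Longrightarrow> \<forall>\<^sub>F r in at_right 0. r \<le> d"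
  unfolding eventually_at_right_field by (intro exI[of _ d]) auto

context nehari_hilbert
begin

text \<open>In \<open>T_converges\<close> the \<open>V\<close>-components converge in norm, and points of the sphere are the normalized
  components of their Nehari points, which are bounded away from zero.\<close>

lemma sphere_PS_compactness:
  assumes PS: "\<And>b. b \<le> \<beta> \<Longrightarrow> PS_T_condition J V W b"
    and x: "\<And>n. x n \<in> sphere_V" "\<And>n. reduced (x n) \<le> \<beta>" "(\<lambda>n. grad (x n)) \<longlonglongrightarrow> 0"
  obtains s l where "strict_mono (s :: nat \<Rightarrow> nat)" "(x \<circ> s) \<longlonglongrightarrow> l" "l \<in> sphere_V" "grad l = 0"
    "reduced l \<le> \<beta>"
proof -
  obtain a where a: "0 < a" "\<And>v. v \<in> sphere_V \<Longrightarrow> a \<le> reduced v" using reduced_lower_bound by blast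
  have "norm (reduced (x n)) \<le> \<beta>" for n using a(1) a(2)[OF x(1), of n] x(2)[of n] by simp
  then have "bounded (range (\<lambda>n. reduced (x n)))" unfolding bounded_iff by blast
  then obtain s b where s: "strict_mono (s :: nat \<Rightarrow> nat)" "((\<lambda>n. reduced (x n)) \<circ> s) \<longlonglongrightarrow> b"
    using bounded_imp_convergent_subsequence by metis
  have b: "b \<le> \<beta>" by (rule LIMSEQ_le_const2[OF s(2)]) (use x(2) in auto)
  define u where "u n = fibre_point (x (s n))" for n
  have uN: "u n \<in> nehari J W" for n unfolding u_def using fibre_point(1) sphere_VD[OF x(1)] by blast
  have "(\<lambda>n. dual_deriv J (u n)) \<longlonglongrightarrow> 0"
  proof (rule Lim_null_comparison[OF always_eventually])
    show "\<forall>n. norm (dual_deriv J (u n)) \<le> norm (grad (x (s n)))"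
      unfolding u_def using norm_dual_deriv_le_grad sphere_VD[OF x(1)] by blast
    show "(\<lambda>n. norm (grad (x (s n)))) \<longlonglongrightarrow> 0"
      using tendsto_norm_zero[OF LIMSEQ_subseq_LIMSEQ[OF x(3) s(1)]] by (simp add: o_def)
  qed
  moreover have "(\<lambda>n. J (u n)) \<longlonglongrightarrow> b" using s(2) by (simp add: o_def u_def reduced_def)
  ultimately have "PS_sequence_in (nehari J W) J b u" using uN unfolding PS_sequence_in_def by blast
  then obtain t y where t: "strict_mono (t :: nat \<Rightarrow> nat)" "T_converges V W (u \<circ> t) y"
    using PS[OF b] unfolding PS_T_condition_def by blast
  then have pu: "(\<lambda>n. pr (u (t n))) \<longlonglongrightarrow> pr y" unfolding T_converges_def by simp
  obtain k where k: "0 < k" "\<And>u. u \<in> nehari J W \<Longrightarrow> k \<le> norm (pr u)" using norm_pr_nehari_ge by blast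
  have "k \<le> norm (pr y)" by (rule LIMSEQ_le_const[OF tendsto_norm[OF pu]]) (use k(2) uN in auto)
  then have "pr y \<noteq> 0" using k(1) by auto
  then have "(\<lambda>n. (1 / norm (pr (u (t n)))) *\<^sub>R pr (u (t n))) \<longlonglongrightarrow> (1 / norm (pr y)) *\<^sub>R pr y"
    by (intro tendsto_intros pu) auto
  moreover have "(1 / norm (pr (u (t n)))) *\<^sub>R pr (u (t n)) = x (s (t n))" for n
    unfolding u_def by (rule sphere_V_eq_normalized[OF x(1), symmetric])
  ultimately have lim: "(\<lambda>n. x (s (t n))) \<longlonglongrightarrow> (1 / norm (pr y)) *\<^sub>R pr y" (is "_ \<longlonglongrightarrow> ?l") by simp
  have l: "?l \<in> sphere_V" by (rule closed_sequentially[OF closed_sphere_V x(1) lim])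
  have st: "strict_mono (s \<circ> t)" by (rule strict_mono_o[OF s(1) t(1)])
  have "(\<lambda>n. grad (x (s (t n)))) \<longlonglongrightarrow> grad ?l"
    by (rule continuous_on_tendsto_compose[OF continuous_on_grad lim]) (use l x(1) sphere_V_subset in \<open>auto intro!: always_eventually dest: sphere_VD\<close>)
  moreover have "(\<lambda>n. grad (x (s (t n)))) \<longlonglongrightarrow> 0" using LIMSEQ_subseq_LIMSEQ[OF x(3) st] by (simp add: o_def)
  ultimately have "grad ?l = 0" by (rule LIMSEQ_unique)
  moreover have "(\<lambda>n. reduced (x (s (t n)))) \<longlonglongrightarrow> reduced ?l"
    by (rule continuous_on_tendsto_compose[OF continuous_on_reduced lim]) (use l x(1) sphere_V_subset in \<open>auto intro!: always_eventually dest: sphere_VD\<close>)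
  then have "reduced ?l \<le> \<beta>" by (rule LIMSEQ_le_const2) (use x(2) in auto)
  ultimately show ?thesis using that[OF st] lim l by (simp add: o_def)
qed

text \<open>Every orbit of the descent map visits a small ball around some critical point, and by the trapping
  estimate never two balls around opposite ones. So the directions whose orbit visits the ball around \<open>w i\<close>
  form a relatively open set, disjoint from its mirror image, and the \<open>k\<close> pairs cover the sublevel set.\<close>

lemma genus_sublevel_le:
  assumes even: "\<And>u. J (- u) = J u"
    and PS: "\<And>b. b \<le> \<beta> \<Longrightarrow> PS_T_condition J V W b"
    and w: "\<And>i. i < k \<Longrightarrow> w i \<in> sphere_V"
    and crit: "\<And>x. x \<in> sphere_V \<Longrightarrow> grad x = 0 \<Longrightarrow> reduced x \<le> \<beta> \<Longrightarrow> \<exists>i<k. x = w i \<or> x = - w i"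
  shows "genus {x \<in> sphere_V. reduced x \<le> \<beta>} \<le> enat k"
proof -
  define A where "A = {x \<in> sphere_V. reduced x \<le> \<beta>}"
  define K where "K = w ` {..<k} \<union> uminus ` w ` {..<k}"
  have K: "finite K" "K \<subseteq> sphere_V" "\<And>p. p \<in> K \<Longrightarrow> - p \<in> K"
    unfolding K_def using w uminus_sphere_V by auto
  have Kcrit: "x \<in> K" if "x \<in> A" "grad x = 0" for x
    using crit[of x] that unfolding A_def K_def by auto
  \<comment> \<open>Used for two radii: \<open>r / 2\<close>, where it makes the annuli expensive to cross, and the smaller \<open>\<rho>\<close>, where it
    makes every orbit visit one of the balls.\<close>
  have far: "\<exists>d>0. \<forall>x\<in>A. (\<forall>p\<in>K. e \<le> dist x p) \<longrightarrow> d \<le> norm (grad x)" if e: "0 < e" for e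
  proof (rule ccontr)
    assume neg: "\<not> ?thesis"
    have "\<exists>x\<in>A. (\<forall>p\<in>K. e \<le> dist x p) \<and> norm (grad x) < 1 / real (Suc n)" for n
    proof -
      have "0 < 1 / real (Suc n)" by simp
      then show ?thesis using neg by (meson not_le)
    qed
    then obtain x where x: "\<And>n. x n \<in> A" "\<And>n p. p \<in> K \<Longrightarrow> e \<le> dist (x n) p"
      "\<And>n. norm (grad (x n)) < 1 / real (Suc n)" by metis
    have "(\<lambda>n. grad (x n)) \<longlonglongrightarrow> 0"
      by (rule Lim_null_comparison[OF always_eventually LIMSEQ_Suc[OF lim_1_over_n]])
        (use less_imp_le[OF x(3)] in blast)
    then obtain s :: "nat \<Rightarrow> nat" and l where l: "(x \<circ> s) \<longlonglongrightarrow> l" "l \<in> sphere_V" "grad l = 0" "reduced l \<le> \<beta>"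
      using sphere_PS_compactness[where x = x and \<beta> = \<beta>, OF PS] x(1) unfolding A_def by blast
    then have "l \<in> K" using Kcrit[of l] by (simp add: A_def)
    then have "e \<le> dist l l"
      by (intro LIMSEQ_le_const[OF tendsto_dist[OF l(1) tendsto_const]]) (use x(2) in auto)
    then show False using e by simp
  qed
  have "\<forall>\<^sub>F r in at_right 0. \<forall>p\<in>K. \<forall>q\<in>K. p \<noteq> q \<longrightarrow> 2 * r \<le> dist p q"
  proof (intro eventually_ball_finite[OF K(1)] ballI)
    fix p q
    show "\<forall>\<^sub>F r in at_right 0. p \<noteq> q \<longrightarrow> 2 * r \<le> dist p q"
    proof (cases "p = q")
      case False
      then have "0 < dist p q / 2" by simp
      from eventually_small[OF this] show ?thesis by eventually_elim simp
    qed simp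
  qed
  from eventually_happens[OF eventually_conj[OF this eventually_at_right_less[of "0::real"]]]
  obtain r where r: "0 < r" "\<And>p q. p \<in> K \<Longrightarrow> q \<in> K \<Longrightarrow> p \<noteq> q \<Longrightarrow> 2 * r \<le> dist p q" by auto
  have opp: "p \<noteq> - p" if "p \<in> K" for p
  proof -
    have "p \<noteq> 0" using that K(2) sphere_VD by blast
    moreover have "2 *\<^sub>R p = p + p" by (simp add: scaleR_2)
    ultimately show ?thesis by (metis add.right_inverse scaleR_eq_0_iff zero_neq_numeral)
  qed
  obtain d where d: "0 < d" "\<And>x. x \<in> A \<Longrightarrow> (\<And>p. p \<in> K \<Longrightarrow> r / 2 \<le> dist x p) \<Longrightarrow> d \<le> norm (grad x)"
    using far[of "r / 2"] r(1) by auto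
  have annulus: "d \<le> norm (grad x)" if x: "x \<in> A" and p: "p \<in> K" "r / 2 \<le> dist x p" "dist x p \<le> r" for x p
  proof (rule d(2)[OF x])
    fix q assume q: "q \<in> K"
    show "r / 2 \<le> dist x q"
    proof (cases "p = q")
      case False
      then show ?thesis using r(2)[OF p(1) q] dist_triangle[of p q x] p(3) r(1) by (simp add: dist_commute)
    qed (use p in simp)
  qed
  have r4: "0 < r / 4" using r(1) by simp
  obtain \<sigma> c where c: "0 < c" and \<sigma>: "\<And>v. v \<in> sphere_V \<Longrightarrow> \<sigma> v \<in> sphere_V"
    "continuous_on sphere_V \<sigma>" "\<And>v. v \<in> sphere_V \<Longrightarrow> dist (\<sigma> v) v \<le> r / 4"
    "\<And>v. v \<in> sphere_V \<Longrightarrow> c * norm (grad v) * dist (\<sigma> v) v \<le> reduced v - reduced (\<sigma> v)"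
    "\<And>v. v \<in> sphere_V \<Longrightarrow> 0 < norm (grad v) \<Longrightarrow> \<sigma> v \<noteq> v"
    "(\<forall>u. J (- u) = J u) \<longrightarrow> (\<forall>v\<in>sphere_V. \<sigma> (- v) = - \<sigma> v)"
    using descent_map[OF r4] by blast
  have \<sigma>odd: "\<sigma> (- v) = - \<sigma> v" if "v \<in> sphere_V" for v using \<sigma>(6) even that by blast
  have \<sigma>A: "\<sigma> x \<in> A" if "x \<in> A" for x
  proof -
    have "0 \<le> c * norm (grad x) * dist (\<sigma> x) x" using c by simp
    then show ?thesis using that \<sigma>(1) \<sigma>(4)[of x] unfolding A_def by auto
  qed
  have orbitA: "(\<sigma> ^^ n) x \<in> A" if "x \<in> A" for n x by (induction n) (use that \<sigma>A in auto)
  have AS: "A \<subseteq> sphere_V" unfolding A_def by blast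
  have orbit_cont: "continuous_on A (\<sigma> ^^ n)" for n
  proof (induction n)
    case (Suc n)
    have "continuous_on A (\<lambda>x. \<sigma> ((\<sigma> ^^ n) x))"
      by (rule continuous_on_compose2[OF \<sigma>(2) Suc]) (use orbitA AS in blast)
    then show ?case by (simp add: o_def)
  qed (simp add: continuous_on_id)
  have orbit_odd: "(\<sigma> ^^ n) (- x) = - (\<sigma> ^^ n) x" if "x \<in> A" for n x
  proof (induction n)
    case (Suc n)
    have "(\<sigma> ^^ n) x \<in> sphere_V" using orbitA[OF that] AS by blast
    then show ?case using Suc \<sigma>odd by simp
  qed simp
  have symA: "uminus ` A = A"
  proof -
    have "- x \<in> A" if "x \<in> A" for x
      using that uminus_sphere_V even_reduced[OF even, of x] sphere_VD unfolding A_def by auto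
    then show ?thesis by force
  qed
  \<comment> \<open>Half the cost of leaving a ball of radius \<open>r\<close>: two points whose levels differ by less than \<open>m\<close> from that of
    \<open>p\<close> differ from each other by less than the cost.\<close>
  define m where "m = c * d * r / 8"
  have m: "0 < m" unfolding m_def using c d(1) r(1) by simp
  have "\<forall>\<^sub>F \<rho> in at_right 0. \<forall>p\<in>K. \<forall>x\<in>sphere_V. dist x p < \<rho> \<longrightarrow> \<bar>reduced x - reduced p\<bar> < m"
  proof (rule eventually_ball_finite[OF K(1)], rule ballI)
    fix p assume p: "p \<in> K"
    have "continuous_on sphere_V reduced" by (rule continuous_on_subset[OF continuous_on_reduced sphere_V_subset])
    then obtain e where e: "0 < e" "\<forall>x\<in>sphere_V. dist x p < e \<longrightarrow> dist (reduced x) (reduced p) < m"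
      unfolding continuous_on_iff using p K(2) m by blast
    from eventually_small[OF e(1)]
    show "\<forall>\<^sub>F \<rho> in at_right 0. \<forall>x\<in>sphere_V. dist x p < \<rho> \<longrightarrow> \<bar>reduced x - reduced p\<bar> < m"
      by eventually_elim (use e(2) in \<open>auto simp: dist_real_def\<close>)
  qed
  from eventually_happens[OF eventually_conj[OF this eventually_conj[OF eventually_at_right_less[of "0::real"]
      eventually_small[of "r / 2"]]]] r(1)
  obtain \<rho> where \<rho>: "0 < \<rho>" "\<rho> \<le> r / 2"
    and osc: "\<And>p x. p \<in> K \<Longrightarrow> x \<in> sphere_V \<Longrightarrow> dist x p < \<rho> \<Longrightarrow> \<bar>reduced x - reduced p\<bar> < m"
    by auto
  define U where "U p = {x \<in> A. \<exists>n. dist ((\<sigma> ^^ n) x) p < \<rho>}" for p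
  have U_uminus: "uminus ` U p = U (- p)" for p
  proof -
    have sub: "- x \<in> U (- p)" if "x \<in> U p" for x p
    proof -
      obtain n where n: "x \<in> A" "dist ((\<sigma> ^^ n) x) p < \<rho>" using \<open>x \<in> U p\<close> unfolding U_def by blast
      then have "dist ((\<sigma> ^^ n) (- x)) (- p) < \<rho>" using orbit_odd[OF n(1)] by (simp add: dist_minus)
      moreover have "- x \<in> A" using n(1) symA by blast
      ultimately show ?thesis unfolding U_def by blast
    qed
    have "y \<in> uminus ` U p" if "y \<in> U (- p)" for y using sub[OF that] by (metis image_eqI minus_minus)
    then show ?thesis using sub by blast
  qed
  have trapped: "\<rho> \<le> dist ((\<sigma> ^^ n) x) (- p)" if x: "x \<in> A" "dist x p < \<rho>" and p: "p \<in> K" for x p n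
  proof (rule ccontr)
    assume "\<not> ?thesis"
    then have close: "dist ((\<sigma> ^^ n) x) (- p) < \<rho>" by simp
    have "\<bar>reduced x - reduced p\<bar> < m" using osc[OF p] x AS by blast
    moreover have "\<bar>reduced ((\<sigma> ^^ n) x) - reduced (- p)\<bar> < m" using osc[OF K(3)[OF p]] orbitA[OF x(1)] AS close by blast
    moreover have "reduced (- p) = reduced p" using even_reduced[OF even] p K(2) sphere_VD by blast
    ultimately have drop: "reduced x - reduced ((\<sigma> ^^ n) x) < c * d * r / 4" unfolding m_def by linarith
    have "dist ((\<sigma> ^^ n) x) p < r"
      by (rule descent_orbit_trapped[where A = A and \<Psi> = reduced and G = "\<lambda>v. norm (grad v)" and k = c and d = d])
        (use \<sigma>A \<sigma>(3,4) AS annulus p c d(1) r(1) x \<rho> drop in auto)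
    moreover have "2 * r \<le> dist p (- p)" by (rule r(2)[OF p K(3)[OF p] opp[OF p]])
    ultimately show False
      using dist_triangle[of p "- p" "(\<sigma> ^^ n) x"] close \<rho> r(1) by (simp add: dist_commute)
  qed
  have disj: "U p \<inter> U (- p) = {}" if p: "p \<in> K" for p
  proof (rule ccontr)
    assume "\<not> ?thesis"
    then obtain x i j where x: "x \<in> A" "dist ((\<sigma> ^^ i) x) p < \<rho>" "dist ((\<sigma> ^^ j) x) (- p) < \<rho>"
      unfolding U_def by blast
    show False
    proof (cases "i \<le> j")
      case True
      have "(\<sigma> ^^ j) x = (\<sigma> ^^ (j - i)) ((\<sigma> ^^ i) x)"
        using True by (metis comp_apply funpow_add le_add_diff_inverse2)
      then show False using trapped[OF orbitA[OF x(1)] x(2) p, of "j - i"] x(3) by simp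
    next
      case False
      then have "(\<sigma> ^^ i) x = (\<sigma> ^^ (i - j)) ((\<sigma> ^^ j) x)"
        by (metis comp_apply funpow_add le_add_diff_inverse2 linear)
      then show False using trapped[OF orbitA[OF x(1)] x(3) K(3)[OF p], of "i - j"] x(2) by simp
    qed
  qed
  have Uopen: "\<exists>e>0. \<forall>y\<in>A. dist y x < e \<longrightarrow> y \<in> U p" if x: "x \<in> U p" for x p
  proof -
    obtain n where n: "x \<in> A" "dist ((\<sigma> ^^ n) x) p < \<rho>" using x unfolding U_def by blast
    then have "0 < \<rho> - dist ((\<sigma> ^^ n) x) p" by simp
    then obtain e where e: "0 < e"
      "\<forall>y\<in>A. dist y x < e \<longrightarrow> dist ((\<sigma> ^^ n) y) ((\<sigma> ^^ n) x) < \<rho> - dist ((\<sigma> ^^ n) x) p"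
      using orbit_cont[of n] n(1) unfolding continuous_on_iff by blast
    have "y \<in> U p" if "y \<in> A" "dist y x < e" for y
    proof -
      have "dist ((\<sigma> ^^ n) y) p < \<rho>"
        using e(2) that dist_triangle[of "(\<sigma> ^^ n) y" p "(\<sigma> ^^ n) x"] by force
      then show ?thesis using that(1) unfolding U_def by blast
    qed
    then show ?thesis using e(1) by blast
  qed
  obtain d' where d': "0 < d'" "\<And>x. x \<in> A \<Longrightarrow> (\<And>p. p \<in> K \<Longrightarrow> \<rho> \<le> dist x p) \<Longrightarrow> d' \<le> norm (grad x)"
    using far[OF \<rho>(1)] by blast
  obtain a where a: "\<And>v. v \<in> sphere_V \<Longrightarrow> a \<le> reduced v" using reduced_lower_bound by blast
  have hit: "\<exists>p\<in>K. x \<in> U p" if x: "x \<in> A" for x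
  proof -
    have "\<exists>n. norm (grad ((\<sigma> ^^ n) x)) < d'"
      by (rule descent_orbit[where S = sphere_V and G = "\<lambda>v. norm (grad v)" and \<Psi> = reduced and b = a and k = c])
        (use closed_sphere_V \<sigma>(1,2,4,5) c a x AS d'(1) in \<open>auto intro!: continuous_on_norm continuous_on_subset[OF continuous_on_grad sphere_V_subset]\<close>)
    then obtain n where "norm (grad ((\<sigma> ^^ n) x)) < d'" by blast
    then obtain p where "p \<in> K" "dist ((\<sigma> ^^ n) x) p < \<rho>"
      using d'(2)[OF orbitA[OF x, of n]] by (meson not_le)
    then show ?thesis using x unfolding U_def by blast
  qed
  have "genus A \<le> enat k"
  proof (rule genus_le_paired_cover[OF symA, where U = "\<lambda>i. U (w i)"])
    fix i assume i: "i < k"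
    then have wK: "w i \<in> K" unfolding K_def by blast
    show "U (w i) \<subseteq> A" unfolding U_def by blast
    show "U (w i) \<inter> uminus ` U (w i) = {}" unfolding U_uminus by (rule disj[OF wK])
    show "\<exists>e>0. \<forall>y\<in>A. dist y x < e \<longrightarrow> y \<in> U (w i)" if "x \<in> U (w i)" for x by (rule Uopen[OF that])
  next
    fix x assume "x \<in> A"
    then obtain p where p: "p \<in> K" "x \<in> U p" using hit by blast
    then obtain i where i: "i < k" "p = w i \<or> p = - w i" unfolding K_def by blast
    have "- x \<in> U (- p)" using p(2) U_uminus[of p] by blast
    then show "\<exists>i<k. x \<in> U (w i) \<or> - x \<in> U (w i)" using i p(2) by auto
  qed
  then show ?thesis unfolding A_def .
qed

text \<open>Normalizing the component is an odd continuous map from the sublevel sets of the Nehari set to those of the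
  sphere. A critical point at a level above the infimum lies in the Nehari set, because \<open>J\<close> is nonpositive on \<open>W\<close>;
  so the pairs of critical directions are those of the critical points.\<close>

theorem genus_bound_le_critical_pairs:
  assumes even: "\<And>u. J (- u) = J u"
    and PS: "\<And>\<beta>::real. ereal \<beta> < \<beta>0 \<Longrightarrow> PS_T_condition J V W \<beta>"
  shows "genus_bound J (nehari J W) \<beta>0 \<le>
    ecard {{u, - u} | u. dual_deriv J u = 0 \<and> u \<noteq> 0 \<and> nehari_level J W \<le> ereal (J u) \<and> ereal (J u) < \<beta>0}"
    (is "_ \<le> ecard ?P")
proof (cases "finite ?P")
  case False
  then show ?thesis by (simp add: ecard_def)
next
  case True
  define C where "C = {u. dual_deriv J u = 0 \<and> u \<noteq> 0 \<and> nehari_level J W \<le> ereal (J u) \<and> ereal (J u) < \<beta>0}"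
  define k where "k = card ?P"
  obtain a where a: "0 < a" "\<And>u. u \<in> nehari J W \<Longrightarrow> a \<le> J u" using nehari_level_positive by blast
  have aN: "ereal a \<le> nehari_level J W" unfolding nehari_level_def by (rule INF_greatest) (use a in auto)
  have CN: "u \<in> nehari J W" if "u \<in> C" for u
  proof -
    have "ereal a \<le> ereal (J u)" using aN that unfolding C_def by (blast intro: order_trans)
    then have "a \<le> J u" by simp
    then have "0 < 1/2 * (norm (pr u))\<^sup>2" using a(1) J_le[of u] by linarith
    then have "pr u \<noteq> 0" by auto
    then show ?thesis using that unfolding nehari_iff[OF subspace_W] C_def using pr_eq_0_iff[of u] by simp
  qed
  obtain e where e: "bij_betw e {0..<k} ?P" using ex_bij_betw_nat_finite[OF True] k_def by blast
  have "\<exists>u\<in>C. e i = {u, - u}" if "i < k" for i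
  proof -
    have "e i \<in> ?P" using bij_betwE[OF e] that by auto
    then show ?thesis unfolding C_def by blast
  qed
  then obtain U where U: "\<And>i. i < k \<Longrightarrow> U i \<in> C" "\<And>i. i < k \<Longrightarrow> e i = {U i, - U i}" by metis
  define \<nu> where "\<nu> u = (1 / norm (pr u)) *\<^sub>R pr u" for u
  have \<nu>_odd: "\<nu> (- u) = - \<nu> u" for u unfolding \<nu>_def using linear_neg[OF linear_pr] by simp
  have "genus (J -` {0<..\<beta>} \<inter> nehari J W) \<le> enat k" if \<beta>: "ereal \<beta> < \<beta>0" for \<beta>
  proof -
    have "genus (J -` {0<..\<beta>} \<inter> nehari J W) \<le> genus {x \<in> sphere_V. reduced x \<le> \<beta>}"
    proof (rule genus_le_odd_map)
      have "pr u \<noteq> 0" if "u \<in> nehari J W" for u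
        using that pr_eq_0_iff nehari_iff[OF subspace_W] by auto
      then show "continuous_on (J -` {0<..\<beta>} \<inter> nehari J W) \<nu>"
        unfolding \<nu>_def by (intro continuous_intros bounded_linear.continuous_on[OF bounded_linear_pr]) auto
      show "\<nu> ` (J -` {0<..\<beta>} \<inter> nehari J W) \<subseteq> {x \<in> sphere_V. reduced x \<le> \<beta>}"
        using normalized_component by (auto simp: \<nu>_def reduced_def)
    qed (rule \<nu>_odd)
    also have "\<dots> \<le> enat k"
    proof (rule genus_sublevel_le[OF even, where w = "\<lambda>i. \<nu> (U i)"])
      fix b assume "b \<le> \<beta>"
      then have "ereal b < \<beta>0" using \<beta> by (meson ereal_less_eq(3) le_less_trans)
      then show "PS_T_condition J V W b" by (rule PS)
    next
      fix i assume "i < k"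
      then show "\<nu> (U i) \<in> sphere_V" unfolding \<nu>_def using normalized_component CN U(1) by blast
    next
      fix x assume x: "x \<in> sphere_V" "grad x = 0" "reduced x \<le> \<beta>"
      let ?u = "fibre_point x"
      have uN: "?u \<in> nehari J W" using fibre_point(1) sphere_VD[OF x(1)] by blast
      have "ereal (J ?u) < \<beta>0" using x(3) \<beta> unfolding reduced_def by (meson ereal_less_eq(3) le_less_trans)
      moreover have "dual_deriv J ?u = 0" using grad_eq_0_iff sphere_VD[OF x(1)] x(2) by blast
      moreover have "?u \<noteq> 0" using uN subspace_0[OF subspace_W] nehari_iff[OF subspace_W] by metis
      moreover have "nehari_level J W \<le> ereal (J ?u)" unfolding nehari_level_def by (rule INF_lower[OF uN])
      ultimately have "{?u, - ?u} \<in> ?P" by blast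
      then obtain i where i: "i < k" "e i = {?u, - ?u}"
        using e unfolding bij_betw_def by (metis (no_types, lifting) atLeastLessThan_iff imageE)
      then have "?u = U i \<or> ?u = - U i" using U(2)[OF i(1)] by (metis doubleton_eq_iff minus_minus)
      moreover have "x = \<nu> ?u" unfolding \<nu>_def by (rule sphere_V_eq_normalized[OF x(1)])
      ultimately show "\<exists>i<k. x = \<nu> (U i) \<or> x = - \<nu> (U i)" using i(1) \<nu>_odd by metis
    qed
    finally show ?thesis .
  qed
  then have "genus_bound J (nehari J W) \<beta>0 \<le> enat k" unfolding genus_bound_def by (intro SUP_least) auto
  then show ?thesis using True by (simp add: ecard_def k_def)
qed

end

section \<open>Weak limits, ground states and multiplicity for the given decomposition\<close>

theorem theorem3p2:
  fixes Xp Xt X0 X1 :: "'a::banach set"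
    and ip :: "'a \<Rightarrow> 'a \<Rightarrow> real"
    and J Jcp I Icp :: "'a \<Rightarrow> real"
  assumes "reflexive_space TYPE('a)"
    and "space_decomposition Xp Xt X0 X1 ip"
    and "C1_functional J" and "C1_functional Jcp"
    and "has_form J I Xp Xt" and "has_form Jcp Icp (sum_space Xp X0) X1"
    and "coercive_on (nehari J Xt) J" and "coercive_on (nehari Jcp X1) Jcp"
    and "generalized_nehari_setting J I Xp Xt"
    and "generalized_nehari_setting Jcp Icp (sum_space Xp X0) X1"
  shows
    "(compactly_close J Jcp (sum_space Xp X0) X1 \<and> superquadratic_away_from_zero I Xp Xt \<longrightarrow>
       (\<forall>\<beta> u. ereal \<beta> < nehari_level Jcp X1 \<and> PS_sequence_in (nehari J Xt) J \<beta> u \<longrightarrow>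
         (\<exists>(r :: nat \<Rightarrow> nat) l. strict_mono r \<and> weakly_converges (u \<circ> r) l \<and> l \<noteq> 0)))
     \<and>
     (compactly_close J Jcp (sum_space Xp X0) X1 \<and> superquadratic_away_from_zero I Xp Xt \<and>
      weakly_continuous_on_nehari J Xt \<and> nehari_level J Xt < nehari_level Jcp X1 \<longrightarrow>
       (\<exists>u \<in> nehari J Xt. ereal (J u) = nehari_level J Xt \<and> dual_deriv J u = 0))
     \<and>
     (\<forall>\<beta>0 :: ereal. (\<forall>u. J (- u) = J u) \<and> nehari_level J Xt < \<beta>0 \<and>
       (\<forall>\<beta>::real. ereal \<beta> < \<beta>0 \<longrightarrow> PS_T_condition J Xp Xt \<beta>) \<longrightarrow>
       genus_bound J (nehari J Xt) \<beta>0 \<le>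
         ecard {{u, - u} | u. dual_deriv J u = 0 \<and> u \<noteq> 0 \<and>
                  nehari_level J Xt \<le> ereal (J u) \<and> ereal (J u) < \<beta>0})"
proof -
  have dec: "direct_sum UNIV Xp Xt" "closed Xp" "closed Xt" "direct_sum Xt X0 X1" "closed X1"
      "inner_product_on (sum_space Xp X0) ip"
    and pyth: "\<And>u. (norm u)\<^sup>2 = (norm (component Xp Xt u))\<^sup>2 + (norm (component Xt Xp u))\<^sup>2"
    using assms(2) unfolding space_decomposition_def topological_direct_sum_def by blast+
  have sub: "subspace Xp" "subspace X0" "subspace X1" using dec unfolding direct_sum_def by auto
  have XpH: "Xp \<subseteq> sum_space Xp X0"
  proof
    fix x assume "x \<in> Xp"
    then show "x \<in> sum_space Xp X0" unfolding sum_space_def using subspace_0[OF sub(2)] by force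
  qed
  have X1Xt: "X1 \<subseteq> Xt"
  proof
    fix x assume "x \<in> X1"
    then have "x \<in> sum_space X0 X1" unfolding sum_space_def using subspace_0[OF sub(2)] by force
    then show "x \<in> Xt" using dec(4) unfolding direct_sum_def by blast
  qed
  have ipXp: "inner_product_on Xp ip"
    using dec(6) XpH unfolding inner_product_on_def by (meson subsetD)
  have normle: "norm (component Xp Xt u) \<le> norm u" for u
    using pyth[of u] by (simp add: power2_le_imp_le)
  interpret nehari_hilbert Xp Xt J I ip
    by unfold_locales (use assms dec sub ipXp normle in auto)
  interpret cp: nehari_setting "sum_space Xp X0" X1 Jcp Icp
    by unfold_locales (use assms dec direct_sum_assoc[OF dec(1,4)] in auto)
  have pair: "nehari_pair Xp Xt (sum_space Xp X0) X1 J I Jcp Icp ip"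
    if "compactly_close J Jcp (sum_space Xp X0) X1" "superquadratic_away_from_zero I Xp Xt"
    by unfold_locales (use that assms XpH X1Xt in auto)
  have a: "\<exists>(r :: nat \<Rightarrow> nat) l. strict_mono r \<and> weakly_converges (u \<circ> r) l \<and> l \<noteq> 0"
    if C: "compactly_close J Jcp (sum_space Xp X0) X1" "superquadratic_away_from_zero I Xp Xt"
      and \<beta>: "ereal \<beta> < nehari_level Jcp X1" and u: "PS_sequence_in (nehari J Xt) J \<beta> u" for \<beta> u
  proof -
    interpret nehari_pair Xp Xt "sum_space Xp X0" X1 J I Jcp Icp ip by (rule pair[OF C])
    have u': "\<And>n. u n \<in> nehari J Xt" "(\<lambda>n. J (u n)) \<longlonglongrightarrow> \<beta>" using u unfolding PS_sequence_in_def by auto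
    obtain r l where r: "strict_mono (r :: nat \<Rightarrow> nat)" "weakly_converges (u \<circ> r) l" "pr l \<noteq> 0"
      by (rule nehari_sequence_weak_limit[OF assms(7) u' \<beta>])
    have "l \<noteq> 0" using r(3) linear_0[OF linear_pr] by metis
    then show ?thesis using r by blast
  qed
  have b: "\<exists>u \<in> nehari J Xt. ereal (J u) = nehari_level J Xt \<and> dual_deriv J u = 0"
    if C: "compactly_close J Jcp (sum_space Xp X0) X1" "superquadratic_away_from_zero I Xp Xt"
      "weakly_continuous_on_nehari J Xt" "nehari_level J Xt < nehari_level Jcp X1"
    by (rule nehari_pair.ground_state_exists[OF pair[OF C(1,2)] assms(7) C(3,4)])
  have c: "genus_bound J (nehari J Xt) \<beta>0 \<le>
      ecard {{u, - u} | u. dual_deriv J u = 0 \<and> u \<noteq> 0 \<and>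
        nehari_level J Xt \<le> ereal (J u) \<and> ereal (J u) < \<beta>0}"
    if "\<forall>u. J (- u) = J u" "\<forall>\<beta>::real. ereal \<beta> < \<beta>0 \<longrightarrow> PS_T_condition J Xp Xt \<beta>" for \<beta>0 :: ereal
    by (rule genus_bound_le_critical_pairs) (use that in auto)
  show ?thesis
    by (intro conjI impI allI; (elim conjE)?) (rule a b c; assumption)+
qed

end
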